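(* For the Range Join problem, given any $\Delta\ge 1$, there is a data structure of $\tilde{O}(N+N^{\rho^*}/\Delta)$ space that answers a query with an $\tilde{O}(\Delta)$ delay.
   Context: Range Join: $\mathcal{R}$ is a set of $O(1)$ relations, each with $O(1)$ real-valued attributes; $\mathit{scheme}(R)$ is the set of attributes of $R$, $\mathcal{X}=\bigcup_{R\in\mathcal{R}}\mathit{scheme}(R)$, and $N=\sum_{R\in\mathcal{R}}|R|$. $\mathit{join}(\mathcal{R})$ is the natural join of the relations in $\mathcal{R}$. Given an interval $q=[x_1,x_2]$, a query reports all tuples $t\in\mathit{join}(\mathcal{R})$ such that $t[X]\in q$ for every attribute $X\in\mathcal{X}$. Consider the hypergraph with vertex set $\mathcal{X}$ and edge set $\mathcal{E}=\{\mathit{scheme}(R)\mid R\in\mathcal{R}\}$; a fractional edge covering is a function $W:\mathcal{E}\to\mathbb{R}_{\ge 0}$ with $\sum_{e\in\mathcal{E}: X\in e}W(e)\ge 1$ for all $X\in\mathcal{X}$, and $\rho^*$ is the minimum of $\sum_{e\in\mathcal{E}}W(e)$ over all fractional edge coverings. A query has delay $\Delta$ if, after the previous output (with a dummy output assumed at the start), it reports a new result tuple or declares that there are no more within $\Delta$ time. $\tilde{O}(\cdot)$ hides polylogarithmic factors. *)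

theory Defs
  imports "HOL-Analysis.Analysis"
begin

section \<open>Natural joins and range queries\<close>

text \<open>
  A database schema is a set \<open>Rs\<close> of relation names with a map \<open>scheme\<close> giving the attribute set
  of each relation. An instance is a map \<open>rel\<close> from relation names to sets of tuples; a tuple is a
  partial map from attributes to reals whose domain is the scheme. Two names may have equal schemes.
\<close>

type_synonym 'a tuple = "'a \<rightharpoonup> real"

definition is_schema :: "'r set \<Rightarrow> ('r \<Rightarrow> 'a set) \<Rightarrow> bool" where
  "is_schema Rs scheme \<longleftrightarrow> finite Rs \<and> (\<forall>r\<in>Rs. finite (scheme r))"

definition is_instance :: "'r set \<Rightarrow> ('r \<Rightarrow> 'a set) \<Rightarrow> ('r \<Rightarrow> 'a tuple set) \<Rightarrow> bool" where
  "is_instance Rs scheme rel \<longleftrightarrow>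
     (\<forall>r\<in>Rs. finite (rel r) \<and> (\<forall>t\<in>rel r. dom t = scheme r))"

definition attributes :: "'r set \<Rightarrow> ('r \<Rightarrow> 'a set) \<Rightarrow> 'a set" where
  "attributes Rs scheme = (\<Union>r\<in>Rs. scheme r)"

definition input_size :: "'r set \<Rightarrow> ('r \<Rightarrow> 'a tuple set) \<Rightarrow> nat" where
  "input_size Rs rel = (\<Sum>r\<in>Rs. card (rel r))"

definition natural_join :: "'r set \<Rightarrow> ('r \<Rightarrow> 'a set) \<Rightarrow> ('r \<Rightarrow> 'a tuple set) \<Rightarrow> 'a tuple set" where
  "natural_join Rs scheme rel =
     {t. dom t = attributes Rs scheme \<and> (\<forall>r\<in>Rs. t |` scheme r \<in> rel r)}"

definition range_join ::
  "'r set \<Rightarrow> ('r \<Rightarrow> 'a set) \<Rightarrow> ('r \<Rightarrow> 'a tuple set) \<Rightarrow> real \<Rightarrow> real \<Rightarrow> 'a tuple set" where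
  "range_join Rs scheme rel x1 x2 =
     {t \<in> natural_join Rs scheme rel. \<forall>X\<in>attributes Rs scheme. the (t X) \<in> {x1..x2}}"

section \<open>Fractional edge coverings\<close>

definition fractional_edge_covering :: "'a set \<Rightarrow> 'a set set \<Rightarrow> ('a set \<Rightarrow> real) \<Rightarrow> bool" where
  "fractional_edge_covering V E W \<longleftrightarrow>
     (\<forall>e\<in>E. 0 \<le> W e) \<and> (\<forall>X\<in>V. 1 \<le> (\<Sum>e\<in>{e\<in>E. X \<in> e}. W e))"

text \<open>The infimum is attained, see \<open>fractional_edge_covering_number_attained\<close> below.\<close>

definition fractional_edge_covering_number :: "'a set \<Rightarrow> 'a set set \<Rightarrow> real" where
  "fractional_edge_covering_number V E = (INF W\<in>Collect (fractional_edge_covering V E). \<Sum>e\<in>E. W e)"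

lemma fractional_edge_covering_number_attained:
  assumes "finite E" and "\<Union>E = V"
  shows "\<exists>W. fractional_edge_covering V E W \<and> (\<Sum>e\<in>E. W e) = fractional_edge_covering_number V E
           \<and> (\<forall>W'. fractional_edge_covering V E W' \<longrightarrow> (\<Sum>e\<in>E. W e) \<le> (\<Sum>e\<in>E. W' e))"
proof -
  have cont: "continuous_on UNIV (\<lambda>W::'a set \<Rightarrow> real. \<Sum>e\<in>A. W e)" for A
    by (intro continuous_intros continuous_on_product_coordinates)
  define B where "B = Pi\<^sub>E UNIV (\<lambda>_::'a set. {0..1::real})"
  define K where "K = B \<inter> (\<Inter>X\<in>V. {W. 1 \<le> (\<Sum>e\<in>{e\<in>E. X \<in> e}. W e)})"
  have "compact B"
    using compactin_PiE[of "\<lambda>_::'a set. euclidean" UNIV "\<lambda>_. {0..1::real}"]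
    by (simp add: B_def euclidean_product_topology)
  moreover have "closed (\<Inter>X\<in>V. {W::'a set \<Rightarrow> real. 1 \<le> (\<Sum>e\<in>{e\<in>E. X \<in> e}. W e)})"
    by (intro closed_INT ballI closed_Collect_le cont continuous_intros)
  ultimately have K: "compact K"
    unfolding K_def by (rule compact_Int_closed)
  have trunc: "\<exists>W'\<in>K. (\<Sum>e\<in>E. W' e) \<le> (\<Sum>e\<in>E. W e)" if W: "fractional_edge_covering V E W" for W
  proof -
    define W' where "W' = (\<lambda>e. if e \<in> E then min 1 (W e) else 0)"
    have nn: "0 \<le> W' e" for e
      using W by (auto simp: W'_def fractional_edge_covering_def)
    have "1 \<le> (\<Sum>e\<in>{e\<in>E. X \<in> e}. W' e)" if "X \<in> V" for X
    proof (cases "\<exists>e\<in>E. X \<in> e \<and> 1 \<le> W e")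
      case True
      then obtain e where e: "e \<in> {e\<in>E. X \<in> e}" "W' e = 1" by (auto simp: W'_def)
      then show ?thesis
        using member_le_sum[of e "{e\<in>E. X \<in> e}" W'] nn \<open>finite E\<close> by auto
    next
      case False
      then have "(\<Sum>e\<in>{e\<in>E. X \<in> e}. W' e) = (\<Sum>e\<in>{e\<in>E. X \<in> e}. W e)"
        by (intro sum.cong) (auto simp: W'_def)
      then show ?thesis using W that by (simp add: fractional_edge_covering_def)
    qed
    then have "W' \<in> K"
      using nn by (auto simp: K_def B_def W'_def)
    moreover have "(\<Sum>e\<in>E. W' e) \<le> (\<Sum>e\<in>E. W e)"
      by (intro sum_mono) (auto simp: W'_def)
    ultimately show ?thesis by blast
  qed
  have "1 \<le> (\<Sum>e\<in>{e\<in>E. X \<in> e}. (1::real))" if X: "X \<in> V" for X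
  proof -
    obtain e where "e \<in> {e\<in>E. X \<in> e}" using X assms(2) by auto
    then show ?thesis
      using member_le_sum[of e "{e\<in>E. X \<in> e}" "\<lambda>_. 1::real"] assms(1) by simp
  qed
  then have "fractional_edge_covering V E (\<lambda>_. 1)"
    by (simp add: fractional_edge_covering_def)
  then have "K \<noteq> {}" using trunc by blast
  then obtain W where W: "W \<in> K" "\<And>U. U \<in> K \<Longrightarrow> (\<Sum>e\<in>E. W e) \<le> (\<Sum>e\<in>E. U e)"
    using continuous_attains_inf[OF K _ continuous_on_subset[OF cont]] by (metis subset_UNIV)
  have cov: "fractional_edge_covering V E W"
    using W(1) by (auto simp: K_def B_def fractional_edge_covering_def PiE_iff)
  have least: "(\<Sum>e\<in>E. W e) \<le> (\<Sum>e\<in>E. U e)" if "fractional_edge_covering V E U" for U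
    using trunc[OF that] W(2) by fastforce
  have "fractional_edge_covering_number V E = (\<Sum>e\<in>E. W e)"
    unfolding fractional_edge_covering_number_def
    by (rule cInf_eq_minimum) (use cov least in auto)
  with cov least show ?thesis by auto
qed

text \<open>The hypergraph has a single edge for all relations with the same scheme.\<close>

definition rho_star :: "'r set \<Rightarrow> ('r \<Rightarrow> 'a set) \<Rightarrow> real" where
  "rho_star Rs scheme = fractional_edge_covering_number (attributes Rs scheme) (scheme ` Rs)"

section \<open>Random access machine\<close>

text \<open>
  A RAM with word length \<open>w\<close>. It has registers and memory cells for words (naturals below \<open>2 ^ w\<close>)
  and for reals; reals can only be copied and compared, so no information can be packed
  into them. Programs are structured, with unit cost per executed command or evaluated guard. Since
  expressions are part of the program text, this is the usual RAM time up to a factor that depends on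
  the program only. The memory has a fixed number of cells, and accesses outside it get stuck, so this
  number bounds the working space of a run as well. The output command reports a tuple whose
  components are taken from real registers.
\<close>

datatype word_op = Add | Sub | Mul | Div | Mod

datatype wexp = Lit nat | Reg nat | Op word_op wexp wexp

datatype guard = Less wexp wexp | RLess nat nat | Neg guard | Conj guard guard

datatype 'a com =
    Skip
  | Set nat wexp
  | RSet nat nat
  | Load nat wexp
  | Store wexp wexp
  | RLoad nat wexp
  | RStore wexp nat
  | Report "('a \<times> nat) list"
  | Seq "'a com" "'a com"
  | If guard "'a com" "'a com"
  | While guard "'a com"

record mem =
  wmem :: "nat list"
  rmem :: "real list"

record config = mem +
  wreg :: "nat \<Rightarrow> nat"
  rreg :: "nat \<Rightarrow> real"

fun apply_op :: "word_op \<Rightarrow> nat \<Rightarrow> nat \<Rightarrow> nat" where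
  "apply_op Add x y = x + y"
| "apply_op Sub x y = x - y"
| "apply_op Mul x y = x * y"
| "apply_op Div x y = x div y"
| "apply_op Mod x y = x mod y"

fun wval :: "nat \<Rightarrow> config \<Rightarrow> wexp \<Rightarrow> nat" where
  "wval w s (Lit n) = n mod 2 ^ w"
| "wval w s (Reg i) = wreg s i"
| "wval w s (Op f a b) = apply_op f (wval w s a) (wval w s b) mod 2 ^ w"

fun gval :: "nat \<Rightarrow> config \<Rightarrow> guard \<Rightarrow> bool" where
  "gval w s (Less a b) \<longleftrightarrow> wval w s a < wval w s b"
| "gval w s (RLess i j) \<longleftrightarrow> rreg s i < rreg s j"
| "gval w s (Neg g) \<longleftrightarrow> \<not> gval w s g"
| "gval w s (Conj g h) \<longleftrightarrow> gval w s g \<and> gval w s h"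

text \<open>
  A run is recorded by its trace of time steps and reported tuples. Only terminating runs have one;
  termination is the declaration that there are no more results.
\<close>

datatype 'a event = Tick | Emit "'a tuple"

inductive exec :: "nat \<Rightarrow> 'a com \<Rightarrow> config \<Rightarrow> 'a event list \<Rightarrow> config \<Rightarrow> bool" for w where
  Skip: "exec w Skip s [Tick] s"
| Set: "exec w (Set i a) s [Tick] (s\<lparr>wreg := (wreg s)(i := wval w s a)\<rparr>)"
| RSet: "exec w (RSet i j) s [Tick] (s\<lparr>rreg := (rreg s)(i := rreg s j)\<rparr>)"
| Load: "wval w s a < length (wmem s) \<Longrightarrow>
    exec w (Load i a) s [Tick] (s\<lparr>wreg := (wreg s)(i := wmem s ! wval w s a)\<rparr>)"
| Store: "wval w s a < length (wmem s) \<Longrightarrow>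
    exec w (Store a b) s [Tick] (s\<lparr>wmem := (wmem s)[wval w s a := wval w s b]\<rparr>)"
| RLoad: "wval w s a < length (rmem s) \<Longrightarrow>
    exec w (RLoad i a) s [Tick] (s\<lparr>rreg := (rreg s)(i := rmem s ! wval w s a)\<rparr>)"
| RStore: "wval w s a < length (rmem s) \<Longrightarrow>
    exec w (RStore a j) s [Tick] (s\<lparr>rmem := (rmem s)[wval w s a := rreg s j]\<rparr>)"
| Report: "exec w (Report l) s [Tick, Emit (map_of (map (\<lambda>(X, i). (X, rreg s i)) l))] s"
| Seq: "exec w c s tr s' \<Longrightarrow> exec w d s' tr' s'' \<Longrightarrow> exec w (Seq c d) s (tr @ tr') s''"
| If_True: "gval w s g \<Longrightarrow> exec w c s tr s' \<Longrightarrow> exec w (If g c d) s (Tick # tr) s'"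
| If_False: "\<not> gval w s g \<Longrightarrow> exec w d s tr s' \<Longrightarrow> exec w (If g c d) s (Tick # tr) s'"
| While_False: "\<not> gval w s g \<Longrightarrow> exec w (While g c) s [Tick] s"
| While_True: "gval w s g \<Longrightarrow> exec w c s tr s' \<Longrightarrow> exec w (While g c) s' tr' s'' \<Longrightarrow>
    exec w (While g c) s (Tick # tr @ tr') s''"

fun reported :: "'a event list \<Rightarrow> 'a tuple list" where
  "reported [] = []"
| "reported (Tick # tr) = reported tr"
| "reported (Emit t # tr) = t # reported tr"

text \<open>The blocks of ticks at the start and at the end of the trace count as well.\<close>

definition has_delay :: "real \<Rightarrow> 'a event list \<Rightarrow> bool" where
  "has_delay D tr \<longleftrightarrow> (\<forall>us n vs. tr = us @ replicate n Tick @ vs \<longrightarrow> real n \<le> D)"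

section \<open>Data structures for range joins\<close>

definition valid_mem :: "nat \<Rightarrow> real \<Rightarrow> mem \<Rightarrow> bool" where
  "valid_mem w S m \<longleftrightarrow>
     real (length (wmem m) + length (rmem m)) \<le> S \<and> (\<forall>x\<in>set (wmem m). x < 2 ^ w)"

text \<open>A query starts with its endpoints in the real registers 0 and 1.\<close>

definition query_start :: "mem \<Rightarrow> real \<Rightarrow> real \<Rightarrow> config" where
  "query_start m x1 x2 =
     mem.extend m (config.fields (\<lambda>_. 0) ((\<lambda>_. 0)(0 := x1, 1 := x2)))"

text \<open>
  Queries may write to the memory. Therefore a data structure is a set \<open>Ms\<close> of memory
  contents that is closed under queries, so that arbitrary sequences of queries can be answered.
\<close>

definition range_join_structure ::
  "nat \<Rightarrow> 'a com \<Rightarrow> 'r set \<Rightarrow> ('r \<Rightarrow> 'a set) \<Rightarrow> ('r \<Rightarrow> 'a tuple set) \<Rightarrow> real \<Rightarrow> real \<Rightarrow> mem set \<Rightarrow> bool"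
where
  "range_join_structure w P Rs scheme rel S D Ms \<longleftrightarrow>
     Ms \<noteq> {} \<and>
     (\<forall>m\<in>Ms. valid_mem w S m \<and>
       (\<forall>x1 x2. x1 \<le> x2 \<longrightarrow>
         (\<exists>tr s. exec w P (query_start m x1 x2) tr s \<and> mem.truncate s \<in> Ms \<and>
           distinct (reported tr) \<and> set (reported tr) = range_join Rs scheme rel x1 x2 \<and>
           has_delay D tr)))"

text \<open>
  Word length \<open>\<Theta>(log N)\<close> and polylogarithmic factor. The shift by 2 keeps the logarithm at least 1 for
  all \<open>N\<close>.
\<close>

definition word_length :: "nat \<Rightarrow> nat \<Rightarrow> nat" where
  "word_length k N = k * nat \<lceil>log 2 (real N + 2)\<rceil>"

definition polylog :: "nat \<Rightarrow> nat \<Rightarrow> real" where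
  "polylog c N = log 2 (real N + 2) ^ c"

end

theory Submission
  imports Defs "HOL-Library.Discrete_Functions"
begin

text \<open>
  The values are ranked and put at the leaves of a complete binary tree of height \<open>L = O(log N)\<close>. A
  query searches the boxes, that is, the products of dyadic intervals, by halving one coordinate at a
  time. A box is abandoned if it misses the query, if some relation has no tuple in it, or if it is
  heavy, which means that its AGM bound exceeds \<open>\<Delta>\<close>, and its join is empty. Halving a coordinate
  splits the AGM bound (Hoelder), and a box without empty relation has AGM bound at least 1. Hence a
  light box is searched completely in time \<open>\<Delta>\<close> up to logarithms, and there are at most
  \<open>(L + 1) ^ d * N powr \<rho> / \<Delta>\<close> heavy boxes up to a constant. A visited heavy box inside the query
  contains a result, so two consecutive outputs are separated by few fruitless light boxes.

  The two emptiness tests are automata that read the halvings and are stored as pointer structures: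
  one for each relation, of size \<open>N\<close> up to logarithms, and one for the heavy boxes. The search needs no
  stack: leaves of the search tree are numbered from left to right, and after each terminal node the
  program descends again from the root to the first leaf that is not yet covered. So the memory is
  never written.
\<close>

section \<open>Gaps between outputs\<close>

text \<open>The obstacle is a box that sticks out of the query: its join may be nonempty while all
  of its tuples miss the query, so the test for heavy boxes says nothing about it. Hence the order
  in which coordinates are halved matters, and the gaps are bounded separately for boxes inside the
  query and for those that cross its border. The delay argument is divided into combinatorics and
  execution. The terminal nodes of the search, from left to right, form a list of Booleans in which
  \<open>True\<close> marks a result; the longest run of \<open>False\<close> is bounded first and
  then multiplied by the cost of one descent. The program depends on the schema only, so loops over
  attributes and relations are unrolled, while \<open>L\<close>, \<open>\<Delta>\<close> and the
  covering \<open>W\<close> act only through the contents of the memory. As no construction time is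
  claimed, the rank coding and the pointer structure merely have to exist.\<close>

definition calm :: "real \<Rightarrow> bool list \<Rightarrow> bool" where
  "calm F xs \<longleftrightarrow> (\<forall>us n vs. xs = us @ replicate n False @ vs \<longrightarrow> real n \<le> F)"

lemma calmD: "calm F (us @ replicate n False @ vs) \<Longrightarrow> real n \<le> F"
  by (auto simp: calm_def)

lemma calm_length: "calm (length xs) xs"
  by (auto simp: calm_def)

lemma calm_mono: "calm F xs \<Longrightarrow> F \<le> G \<Longrightarrow> calm G xs"
  by (metis calm_def order.trans)

text \<open>Only a run across the seam needs a bound that involves both lists; the two concatenation
  rules for \<open>calm\<close> differ in how they treat this case.\<close>

lemma replicate_append_cases:
  assumes "a @ b = us @ replicate n x @ vs"
  obtains (left) vs' where "a = us @ replicate n x @ vs'"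
  | (right) us' where "b = us' @ replicate n x @ vs"
  | (mid) n1 n2 where "n = n1 + n2" "a = us @ replicate n1 x" "b = replicate n2 x @ vs"
proof -
  consider ws where "us = a @ ws" "b = ws @ replicate n x @ vs"
    | ws where "a = us @ ws" "ws @ b = replicate n x @ vs"
    using assms by (auto simp: append_eq_append_conv2)
  then show thesis
  proof cases
    case 1 then show ?thesis using right by blast
  next
    case 2
    from 2(2) consider xs where "replicate n x = ws @ xs" "b = xs @ vs"
      | xs where "ws = replicate n x @ xs" "vs = xs @ b"
      unfolding append_eq_append_conv2 by metis
    then show ?thesis
    proof cases
      case 1
      from 1(1) have "n = length ws + length xs"
        by (metis length_append length_replicate)
      moreover from 1(1) have "ws = replicate (length ws) x" "xs = replicate (length xs) x"
        by (metis append_eq_append_conv length_replicate calculation replicate_add)+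
      ultimately show ?thesis using mid 2 1(2) by metis
    next
      case 2
      with \<open>a = us @ ws\<close> left show ?thesis by simp
    qed
  qed
qed

lemma calm_append:
  assumes "calm F a" "calm G b"
  shows "calm (F + G) (a @ b)"
  unfolding calm_def
proof (intro allI impI)
  fix us n vs assume "a @ b = us @ replicate n False @ vs"
  then show "real n \<le> F + G"
  proof (cases rule: replicate_append_cases)
    case (left vs')
    \<comment> \<open>The run of length 0 yields \<open>0 \<le> G\<close>.\<close>
    then show ?thesis using calmD[of F us n vs'] calmD[of G "[]" 0 b] assms by simp
  next
    case (right us')
    then show ?thesis using calmD[of G us' n vs] calmD[of F "[]" 0 a] assms by simp
  next
    case (mid n1 n2)
    then show ?thesis using calmD[of F us n1 "[]"] calmD[of G "[]" n2 vs] assms by simp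
  qed
qed

text \<open>On a list without \<open>True\<close> this is the whole length, so a fruitless subtree
  is absorbed into the gap of its sibling.\<close>

definition initial_gap :: "bool list \<Rightarrow> nat" where
  "initial_gap xs = length (takeWhile Not xs)"

definition final_gap :: "bool list \<Rightarrow> nat" where
  "final_gap xs = initial_gap (rev xs)"

lemma initial_gap_replicate: "n \<le> initial_gap (replicate n False @ vs)"
  by (induction n) (auto simp: initial_gap_def)

lemma final_gap_replicate: "n \<le> final_gap (us @ replicate n False)"
  by (simp add: final_gap_def initial_gap_replicate)

lemma initial_gap_append:
  "initial_gap (a @ b) = (if True \<in> set a then initial_gap a else length a + initial_gap b)"
  by (induction a) (auto simp: initial_gap_def)

lemma final_gap_append:
  "final_gap (a @ b) = (if True \<in> set b then final_gap b else length b + final_gap a)"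
  by (simp add: final_gap_def initial_gap_append)

lemma initial_gap_le_length: "initial_gap xs \<le> length xs"
  unfolding initial_gap_def by (rule length_takeWhile_le)

lemma final_gap_le_length: "final_gap xs \<le> length xs"
  using initial_gap_le_length[of "rev xs"] by (simp add: final_gap_def)

text \<open>In contrast to \<open>calm_append\<close> the bounds do not add up, so the same
  \<open>F\<close> survives any number of concatenations as long as the gaps at each seam
  fit.\<close>

lemma calm_append_gaps:
  assumes "calm F a" "calm F b" "real (final_gap a + initial_gap b) \<le> F"
  shows "calm F (a @ b)"
  unfolding calm_def
proof (intro allI impI)
  fix us n vs assume "a @ b = us @ replicate n False @ vs"
  then show "real n \<le> F"
  proof (cases rule: replicate_append_cases)
    case (left vs') then show ?thesis using calmD assms by blast
  next
    case (right us') then show ?thesis using calmD assms by blast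
  next
    case (mid n1 n2)
    then have "n1 \<le> final_gap a" "n2 \<le> initial_gap b"
      by (simp_all add: initial_gap_replicate final_gap_replicate)
    then show ?thesis using mid(1) assms(3) by linarith
  qed
qed

text \<open>A left-to-right form of \<open>calm\<close> for the induction along a run;
  \<open>k\<close> counts the entries since the last \<open>True\<close>.\<close>

fun gaps_within :: "real \<Rightarrow> nat \<Rightarrow> bool list \<Rightarrow> bool" where
  "gaps_within F k [] \<longleftrightarrow> real k \<le> F"
| "gaps_within F k (x # xs) \<longleftrightarrow> (if x then real k \<le> F \<and> gaps_within F 0 xs else gaps_within F (Suc k) xs)"

lemma calm_gaps_within: "calm F (replicate k False @ xs) \<Longrightarrow> gaps_within F k xs"
proof (induction xs arbitrary: k)
  case Nil
  then show ?case using calmD[of F "[]" k "[]"] by simp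
next
  case (Cons x xs)
  show ?case
  proof (cases x)
    case True
    have "real k \<le> F" using Cons.prems calmD[of F "[]" k "x # xs"] by simp
    moreover have "calm F xs"
      unfolding calm_def
    proof (intro allI impI)
      fix us n vs assume "xs = us @ replicate n False @ vs"
      then show "real n \<le> F"
        using Cons.prems calmD[of F "replicate k False @ x # us" n vs] by simp
    qed
    ultimately show ?thesis using Cons.IH[of 0] True by simp
  next
    case False
    then have "calm F (replicate (Suc k) False @ xs)"
      using Cons.prems by (simp add: replicate_app_Cons_same)
    then show ?thesis using Cons.IH False by simp
  qed
qed

text \<open>The same form for traces; \<open>k\<close> counts the ticks since the last
  output.\<close>

fun delays_within :: "real \<Rightarrow> nat \<Rightarrow> 'a event list \<Rightarrow> bool" where
  "delays_within D k [] \<longleftrightarrow> real k \<le> D"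
| "delays_within D k (Tick # tr) \<longleftrightarrow> delays_within D (Suc k) tr"
| "delays_within D k (Emit t # tr) \<longleftrightarrow> real k \<le> D \<and> delays_within D 0 tr"

lemma delays_within_bound: "delays_within D k tr \<Longrightarrow> real k \<le> D"
proof (induction tr arbitrary: k)
  case (Cons e tr)
  then show ?case using Cons.IH[of "Suc k"] by (cases e) auto
qed simp

lemma delays_within_ticks [simp]: "delays_within D k (replicate n Tick @ tr) = delays_within D (k + n) tr"
  by (induction n arbitrary: k) auto

lemma delays_within_split:
  assumes "delays_within D k (us @ replicate n Tick @ vs)"
  shows "real n \<le> D"
  using assms
proof (induction us arbitrary: k)
  case Nil
  then have "delays_within D (k + n) vs" by simp
  then have "real (k + n) \<le> D" by (rule delays_within_bound)
  then show ?case by simp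
next
  case (Cons e us)
  then show ?case by (cases e) auto
qed

lemma has_delayI: "delays_within D k tr \<Longrightarrow> has_delay D tr"
  unfolding has_delay_def using delays_within_split by blast

lemma reported_append [simp]: "reported (us @ vs) = reported us @ reported vs"
proof (induction us)
  case (Cons e us) then show ?case by (cases e) auto
qed simp

lemma reported_ticks [simp]: "reported (replicate n Tick) = []"
  by (induction n) auto

section \<open>A Hoelder-type inequality\<close>

text \<open>As every \<open>p e\<close> is at most 1, dividing the exponents by their sum, which is
  at least 1, can only increase the product. With normalised exponents this is the weighted AM-GM
  inequality, that is, convexity of \<open>exp\<close>.\<close>

lemma prod_powr_le_weighted_mean:
  fixes w p :: "'b \<Rightarrow> real"
  assumes "finite F" "\<And>e. e \<in> F \<Longrightarrow> 0 \<le> w e" "1 \<le> (\<Sum>e\<in>F. w e)"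
    and p: "\<And>e. e \<in> F \<Longrightarrow> 0 < p e \<and> p e \<le> 1"
  shows "(\<Prod>e\<in>F. p e powr w e) \<le> (\<Sum>e\<in>F. w e / (\<Sum>e\<in>F. w e) * p e)"
proof -
  define S where "S = (\<Sum>e\<in>F. w e)"
  have S: "1 \<le> S" using assms(3) by (simp add: S_def)
  have "F \<noteq> {}" using assms(3) by auto
  have "(\<Prod>e\<in>F. p e powr w e) = exp (\<Sum>e\<in>F. w e * ln (p e))"
    unfolding exp_sum[OF \<open>finite F\<close>]
    by (intro prod.cong refl) (use p in \<open>simp add: powr_def less_imp_neq[symmetric]\<close>)
  also have "\<dots> \<le> exp (\<Sum>e\<in>F. w e / S * ln (p e))"
  proof -
    have "w e * ln (p e) \<le> w e / S * ln (p e)" if "e \<in> F" for e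
    proof -
      have "ln (p e) \<le> 0" using p[OF that] by simp
      moreover have "w e / S \<le> w e"
        using S assms(2)[OF that] by (simp add: divide_le_eq mult_left_le mult_le_cancel_left1)
      ultimately show ?thesis by (rule mult_right_mono_neg[rotated])
    qed
    then show ?thesis by (auto intro: sum_mono)
  qed
  also have "\<dots> \<le> (\<Sum>e\<in>F. w e / S * exp (ln (p e)))"
  proof -
    have "(\<Sum>e\<in>F. w e / S) = 1"
      using S by (simp add: sum_divide_distrib[symmetric] S_def)
    then show ?thesis
      using convex_on_sum[OF \<open>finite F\<close> \<open>F \<noteq> {}\<close> exp_convex, of "\<lambda>e. w e / S" "\<lambda>e. ln (p e)"]
        S assms(2) by simp
  qed
  also have "\<dots> = (\<Sum>e\<in>F. w e / S * p e)"
    by (intro sum.cong refl) (use p in simp)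
  finally show ?thesis by (simp add: S_def)
qed

text \<open>After division by the right-hand side, the bases \<open>a e / (a e + b e)\<close> and
  \<open>b e / (a e + b e)\<close> add up to 1 for each \<open>e\<close>, and hence so do the two
  weighted means that bound the products.\<close>

lemma prod_powr_add_le:
  fixes w a b :: "'b \<Rightarrow> real"
  assumes "finite F" "\<And>e. e \<in> F \<Longrightarrow> 0 \<le> w e" "1 \<le> (\<Sum>e\<in>F. w e)"
    and pos: "\<And>e. e \<in> F \<Longrightarrow> 0 < a e \<and> 0 < b e"
  shows "(\<Prod>e\<in>F. a e powr w e) + (\<Prod>e\<in>F. b e powr w e) \<le> (\<Prod>e\<in>F. (a e + b e) powr w e)"
proof -
  define S where "S = (\<Sum>e\<in>F. w e)"
  define T where "T = (\<Prod>e\<in>F. (a e + b e) powr w e)"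
  have S: "1 \<le> S" using assms(3) by (simp add: S_def)
  have T: "0 \<le> T" by (auto simp: T_def intro: prod_nonneg)
  have part: "(\<Prod>e\<in>F. c e powr w e) \<le> T * (\<Sum>e\<in>F. w e / S * (c e / (a e + b e)))"
    if c: "\<And>e. e \<in> F \<Longrightarrow> 0 < c e \<and> c e \<le> a e + b e" for c
  proof -
    have "(\<Prod>e\<in>F. c e powr w e) = T * (\<Prod>e\<in>F. (c e / (a e + b e)) powr w e)"
      unfolding T_def prod.distrib[symmetric]
    proof (intro prod.cong refl)
      fix e assume "e \<in> F"
      then show "c e powr w e = (a e + b e) powr w e * (c e / (a e + b e)) powr w e"
        using c[of e] pos[of e] by (subst powr_mult[symmetric]) auto
    qed
    also have "\<dots> \<le> T * (\<Sum>e\<in>F. w e / S * (c e / (a e + b e)))"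
    proof -
      have "0 < c e / (a e + b e) \<and> c e / (a e + b e) \<le> 1" if "e \<in> F" for e
        using c[OF that] by auto
      then show ?thesis
        using prod_powr_le_weighted_mean[OF assms(1-3), of "\<lambda>e. c e / (a e + b e)"] T
        by (intro mult_left_mono) (auto simp: S_def)
    qed
    finally show ?thesis .
  qed
  have "(\<Prod>e\<in>F. a e powr w e) + (\<Prod>e\<in>F. b e powr w e)
      \<le> T * (\<Sum>e\<in>F. w e / S * (a e / (a e + b e))) + T * (\<Sum>e\<in>F. w e / S * (b e / (a e + b e)))"
    by (intro add_mono part) (use pos in force)+
  also have "\<dots> = T * (\<Sum>e\<in>F. w e / S * (a e / (a e + b e) + b e / (a e + b e)))"
    by (simp add: distrib_left sum.distrib)
  also have "(\<Sum>e\<in>F. w e / S * (a e / (a e + b e) + b e / (a e + b e))) = (\<Sum>e\<in>F. w e / S)"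
  proof (intro sum.cong refl)
    fix e assume "e \<in> F"
    then have "a e + b e > 0" using pos[of e] by simp
    then have "a e / (a e + b e) + b e / (a e + b e) = 1" by (simp add: add_divide_distrib[symmetric])
    then show "w e / S * (a e / (a e + b e) + b e / (a e + b e)) = w e / S" by simp
  qed
  also have "\<dots> = 1" using S by (simp add: sum_divide_distrib[symmetric] S_def)
  finally show ?thesis by (simp add: T_def)
qed

section \<open>Dyadic intervals\<close>

text \<open>
  The complete binary tree with \<open>2 ^ L\<close> leaves in heap numbering: the root is 1, the children of \<open>u\<close>
  are \<open>2 * u\<close> and \<open>2 * u + 1\<close>, and the leaves are the numbers from \<open>2 ^ L\<close> to \<open>2 ^ Suc L - 1\<close>.
\<close>

definition height :: "nat \<Rightarrow> nat \<Rightarrow> nat" where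
  "height L u = L - floor_log u"

text \<open>Dividing by \<open>2 ^ h\<close> climbs \<open>h\<close> levels in heap numbering, so
  for a leaf \<open>y\<close> this means that \<open>u\<close> lies on the path from the root to
  \<open>y\<close>.\<close>

definition covers :: "nat \<Rightarrow> nat \<Rightarrow> nat \<Rightarrow> bool" where
  "covers L u y \<longleftrightarrow> y div 2 ^ height L u = u"

lemma height_root [simp]: "height L (Suc 0) = L"
  by (simp add: height_def)

lemma floor_log_less: "1 \<le> u \<Longrightarrow> u < 2 ^ L \<Longrightarrow> floor_log u < L"
  using floor_log_exp2_le[of u] by (metis leD le_less_trans linorder_not_less not_one_le_zero one_le_numeral power_increasing zero_less_iff_neq_zero)

lemma height_pos: "1 \<le> u \<Longrightarrow> u < 2 ^ L \<Longrightarrow> 0 < height L u"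
  using floor_log_less by (simp add: height_def)

lemma height_child:
  assumes "1 \<le> u" "u < 2 ^ L" "s < 2"
  shows "height L u = Suc (height L (2 * u + s))"
proof -
  have "floor_log (2 * u + s) = Suc (floor_log u)"
    using assms floor_log_rec[of "2 * u + s"] by simp
  then show ?thesis using floor_log_less[OF assms(1,2)] by (simp add: height_def)
qed

lemma height_leaf: "2 ^ L \<le> u \<Longrightarrow> height L u = 0"
  using floor_log_le_iff[of "2 ^ L" u] by (simp add: height_def)

lemma height_le: "height L u \<le> L"
  by (simp add: height_def)

lemma height_zero_leaf: "1 \<le> u \<Longrightarrow> height L u = 0 \<Longrightarrow> 2 ^ L \<le> u"
  using height_pos[of u L] by (cases "u < 2 ^ L") auto

lemma covers_leaf [simp]: "2 ^ L \<le> u \<Longrightarrow> covers L u y \<longleftrightarrow> u = y"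
  by (auto simp: covers_def height_leaf)

lemma covers_root: "2 ^ L \<le> y \<Longrightarrow> y < 2 ^ Suc L \<Longrightarrow> covers L (Suc 0) y"
  by (auto simp: covers_def div_nat_eqI)

lemma covers_split:
  assumes "1 \<le> u" "u < 2 ^ L"
  shows "covers L u y \<longleftrightarrow> covers L (2 * u) y \<or> covers L (2 * u + 1) y"
    and "\<not> (covers L (2 * u) y \<and> covers L (2 * u + 1) y)"
proof -
  define h where "h = height L (2 * u)"
  have h: "height L u = Suc h" "height L (2 * u + 1) = h"
    using height_child[OF assms, of 0] height_child[OF assms, of 1] by (simp_all add: h_def)
  have "y div 2 ^ Suc h = (y div 2 ^ h) div 2"
    by (simp add: div_mult2_eq[symmetric] mult.commute)
  then show "covers L u y \<longleftrightarrow> covers L (2 * u) y \<or> covers L (2 * u + 1) y"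
    unfolding covers_def h h_def[symmetric] by (auto simp: covers_def h h_def[symmetric])
  show "\<not> (covers L (2 * u) y \<and> covers L (2 * u + 1) y)"
    unfolding covers_def h h_def[symmetric] by auto
qed

lemma covers_bounds:
  assumes "covers L u y"
  shows "u * 2 ^ height L u \<le> y" "y < (u + 1) * 2 ^ height L u"
proof -
  have "y div 2 ^ height L u = u" using assms by (simp add: covers_def)
  then show "u * 2 ^ height L u \<le> y" "y < (u + 1) * 2 ^ height L u"
    using div_times_less_eq_dividend[of y "2 ^ height L u"]
      dividend_less_div_times[of "2 ^ height L u" y] by (simp_all add: add.commute)
qed

text \<open>Codes are ranks shifted to the leaf numbers. \<open>val\<close> must be monotone on all
  naturals because the end leaves of a dyadic interval need not be codes; therefore it rounds down
  to the largest value whose code does not exceed the argument.\<close>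

lemma rank_coding:
  fixes S :: "real set"
  assumes "finite S" "card S \<le> 2 ^ L"
  shows "\<exists>(val :: nat \<Rightarrow> real) code. mono val \<and> (\<forall>x\<in>S. 2 ^ L \<le> code x \<and> code x < 2 ^ Suc L \<and> val (code x) = x)"
proof (cases "S = {}")
  case True
  then show ?thesis by (intro exI[of _ "\<lambda>_. 0"]) (auto simp: mono_def)
next
  case False
  define code where "code x = 2 ^ L + card {s\<in>S. s < x}" for x
  \<comment> \<open>Inserting \<open>Min S\<close> keeps the set nonempty for arguments below every
    code.\<close>
  define val where "val y = Max (insert (Min S) {x\<in>S. code x \<le> y})" for y
  have "mono val"
    unfolding mono_def val_def using assms by (auto intro!: Max_mono)
  moreover have "2 ^ L \<le> code x \<and> code x < 2 ^ Suc L \<and> val (code x) = x" if x: "x \<in> S" for x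
  proof -
    have lt: "code x < code y" if "x < y" "x \<in> S" for x y
      unfolding code_def using that assms by (auto intro!: psubset_card_mono)
    have "card {s\<in>S. s < x} < card S"
      using x assms by (auto intro!: psubset_card_mono)
    then have "code x < 2 ^ Suc L" using assms(2) by (simp add: code_def)
    moreover have "code s \<le> code x \<longleftrightarrow> s \<le> x" if "s \<in> S" for s
      using lt[of s x] lt[of x s] x that by (cases s x rule: linorder_cases) auto
    then have "{s\<in>S. code s \<le> code x} = {s\<in>S. s \<le> x}" by blast
    then have "val (code x) = Max (insert (Min S) {s\<in>S. s \<le> x})" by (simp add: val_def)
    moreover have "Max (insert (Min S) {s\<in>S. s \<le> x}) = x"
    proof (rule Max_eqI)
      show "finite (insert (Min S) {s \<in> S. s \<le> x})" using assms(1) by simp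
      show "x \<in> insert (Min S) {s \<in> S. s \<le> x}" using x by simp
      show "y \<le> x" if "y \<in> insert (Min S) {s \<in> S. s \<le> x}" for y
        using that Min_le[OF assms(1) x] by blast
    qed
    ultimately show ?thesis by (simp only:) (simp add: code_def)
  qed
  ultimately show ?thesis by blast
qed

section \<open>Boxes and the AGM bound\<close>

locale join_instance =
  fixes Rs :: "'r set" and scheme :: "'r \<Rightarrow> 'a set" and rel :: "'r \<Rightarrow> 'a tuple set"
    and as :: "'a list" and L :: nat and val :: "nat \<Rightarrow> real" and code :: "real \<Rightarrow> nat"
    and W :: "'a set \<Rightarrow> real" and \<Delta> :: real
  assumes schema: "is_schema Rs scheme" and inst: "is_instance Rs scheme rel"
    and distinct_as: "distinct as" and set_as: "set as = attributes Rs scheme"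
    and mono_val: "mono val"
    and code: "\<And>r t x. r \<in> Rs \<Longrightarrow> t \<in> rel r \<Longrightarrow> x \<in> ran t \<Longrightarrow>
      2 ^ L \<le> code x \<and> code x < 2 ^ Suc L \<and> val (code x) = x"
    and covering: "fractional_edge_covering (attributes Rs scheme) (scheme ` Rs) W"
    and Delta: "1 \<le> \<Delta>"
begin

abbreviation d :: nat where "d \<equiv> length as"

text \<open>A box assigns a node of the value tree to each attribute, given by its position in \<open>as\<close>.\<close>

definition boxes :: "(nat \<Rightarrow> nat) set" where
  "boxes = {b. (\<forall>i<d. 1 \<le> b i \<and> b i < 2 ^ Suc L) \<and> (\<forall>i\<ge>d. b i = 1)}"

definition root :: "nat \<Rightarrow> nat" where
  "root = (\<lambda>_. 1)"

definition child :: "(nat \<Rightarrow> nat) \<Rightarrow> nat \<Rightarrow> nat \<Rightarrow> nat \<Rightarrow> nat" where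
  "child b i s = b(i := 2 * b i + s)"

text \<open>Attributes outside \<open>dom t\<close> are ignored, so the predicate serves tuples of a
  relation as well as tuples of the join.\<close>

definition inside :: "(nat \<Rightarrow> nat) \<Rightarrow> 'a tuple \<Rightarrow> bool" where
  "inside b t \<longleftrightarrow> (\<forall>i<d. as ! i \<in> dom t \<longrightarrow> covers L (b i) (code (the (t (as ! i)))))"

definition cnt :: "'r \<Rightarrow> (nat \<Rightarrow> nat) \<Rightarrow> nat" where
  "cnt r b = card {t \<in> rel r. inside b t}"

definition has_empty :: "(nat \<Rightarrow> nat) \<Rightarrow> bool" where
  "has_empty b \<longleftrightarrow> (\<exists>r\<in>Rs. cnt r b = 0)"

text \<open>The hypergraph merges relations with equal schemes; one of them stands for the edge in
  the AGM bound.\<close>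

definition rep :: "'a set \<Rightarrow> 'r" where
  "rep e = (SOME r. r \<in> Rs \<and> scheme r = e)"

text \<open>The value is 0 as soon as any relation, chosen by \<open>rep\<close> or not, is empty in
  the box; otherwise it is at least 1.\<close>

definition agm :: "(nat \<Rightarrow> nat) \<Rightarrow> real" where
  "agm b = (if has_empty b then 0 else \<Prod>e\<in>scheme ` Rs. real (cnt (rep e) b) powr W e)"

lemma finite_Rs [simp]: "finite Rs"
  using schema by (simp add: is_schema_def)

lemma finite_rel [simp]: "r \<in> Rs \<Longrightarrow> finite (rel r)"
  using inst by (simp add: is_instance_def)

lemma dom_rel: "r \<in> Rs \<Longrightarrow> t \<in> rel r \<Longrightarrow> dom t = scheme r"
  using inst by (simp add: is_instance_def)

lemma rep: "e \<in> scheme ` Rs \<Longrightarrow> rep e \<in> Rs \<and> scheme (rep e) = e"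
  unfolding rep_def by (rule someI_ex) blast

lemma W_nonneg: "e \<in> scheme ` Rs \<Longrightarrow> 0 \<le> W e"
  using covering by (auto simp: fractional_edge_covering_def)

lemma root_boxes: "root \<in> boxes"
  using one_less_power[of "2::nat" "Suc L"] by (simp add: root_def boxes_def)

lemma child_boxes: "b \<in> boxes \<Longrightarrow> i < d \<Longrightarrow> b i < 2 ^ L \<Longrightarrow> s < 2 \<Longrightarrow> child b i s \<in> boxes"
  by (auto simp: boxes_def child_def)

lemma finite_boxes: "finite boxes"
proof -
  have "boxes \<subseteq> {f. \<forall>i. (i \<in> {..<d} \<longrightarrow> f i \<in> {..<2 ^ Suc L}) \<and> (i \<notin> {..<d} \<longrightarrow> f i = 1)}"
    by (auto simp: boxes_def)
  then show ?thesis using finite_set_of_finite_funs[of "{..<d}" "{..<2 ^ Suc L}" 1] finite_subset by blast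
qed

lemma active:
  assumes "r \<in> Rs" "t \<in> rel r" "i < d" "as ! i \<in> dom t"
  shows "2 ^ L \<le> code (the (t (as ! i)))" "code (the (t (as ! i))) < 2 ^ Suc L"
    "val (code (the (t (as ! i)))) = the (t (as ! i))"
proof -
  have "the (t (as ! i)) \<in> ran t" using assms(4) by (auto simp: ran_def)
  from code[OF assms(1,2) this]
  show "2 ^ L \<le> code (the (t (as ! i)))" "code (the (t (as ! i))) < 2 ^ Suc L"
    "val (code (the (t (as ! i)))) = the (t (as ! i))" by blast+
qed

lemma inside_child_other [simp]: "i < d \<Longrightarrow> as ! i \<notin> dom t \<Longrightarrow> inside (child b i s) t \<longleftrightarrow> inside b t"
  unfolding inside_def child_def by auto

lemma inside_child_same:
  assumes "i < d" "as ! i \<in> dom t"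
  shows "inside (child b i s) t \<longleftrightarrow>
    (\<forall>j<d. j \<noteq> i \<longrightarrow> as ! j \<in> dom t \<longrightarrow> covers L (b j) (code (the (t (as ! j)))))
    \<and> covers L (2 * b i + s) (code (the (t (as ! i))))"
  using assms unfolding inside_def child_def by (auto simp del: covers_leaf)

lemma inside_split:
  assumes "i < d" "1 \<le> b i" "b i < 2 ^ L"
  shows "inside b t \<longleftrightarrow> inside (child b i 0) t \<or> inside (child b i 1) t"
proof (cases "as ! i \<in> dom t")
  case True
  show ?thesis
    unfolding inside_child_same[OF assms(1) True] add_0_right
    using covers_split(1)[OF assms(2,3), of "code (the (t (as ! i)))"] assms(1) True
    unfolding inside_def by metis
qed (use assms in simp)

lemma inside_exclusive:
  assumes "i < d" "1 \<le> b i" "b i < 2 ^ L" "as ! i \<in> dom t"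
  shows "\<not> (inside (child b i 0) t \<and> inside (child b i 1) t)"
  unfolding inside_child_same[OF assms(1,4)] add_0_right
  using covers_split(2)[OF assms(2,3), of "code (the (t (as ! i)))"] by blast

lemma inside_child:
  assumes "i < d" "1 \<le> b i" "b i < 2 ^ L" "s < 2" "inside (child b i s) t"
  shows "inside b t"
proof -
  have "s = 0 \<or> s = 1" using assms(4) by linarith
  then show ?thesis using inside_split[of i b, OF assms(1-3)] assms(5) by auto
qed

lemma cnt_child_le:
  assumes "r \<in> Rs" "i < d" "1 \<le> b i" "b i < 2 ^ L" "s < 2"
  shows "cnt r (child b i s) \<le> cnt r b"
  unfolding cnt_def using assms inside_child[of i b s] by (intro card_mono) auto

lemma cnt_child_other:
  assumes "r \<in> Rs" "i < d" "as ! i \<notin> scheme r"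
  shows "cnt r (child b i s) = cnt r b"
proof -
  have "inside (child b i s) t = inside b t" if "t \<in> rel r" for t
    using dom_rel[OF assms(1) that] assms by simp
  then show ?thesis unfolding cnt_def by (metis (lifting))
qed

lemma cnt_split:
  assumes "r \<in> Rs" "i < d" "1 \<le> b i" "b i < 2 ^ L" "as ! i \<in> scheme r"
  shows "cnt r b = cnt r (child b i 0) + cnt r (child b i 1)"
proof -
  have "{t \<in> rel r. inside b t} = {t \<in> rel r. inside (child b i 0) t} \<union> {t \<in> rel r. inside (child b i 1) t}"
    using inside_split[of i b, OF assms(2-4)] by blast
  moreover have "{t \<in> rel r. inside (child b i 0) t} \<inter> {t \<in> rel r. inside (child b i 1) t} = {}"
    using inside_exclusive[of i b, OF assms(2-4)] dom_rel[OF assms(1)] assms(5) by blast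
  ultimately show ?thesis
    unfolding cnt_def using assms(1) by (simp add: card_Un_disjoint)
qed

lemma has_empty_child:
  assumes "i < d" "1 \<le> b i" "b i < 2 ^ L" "s < 2" "has_empty b"
  shows "has_empty (child b i s)"
  using assms(5) cnt_child_le[of _ i b s, OF _ assms(1-4)] unfolding has_empty_def by (metis le_zero_eq)

lemma agm_nonneg: "0 \<le> agm b"
  by (auto simp: agm_def intro!: prod_nonneg)

lemma agm_ge_1:
  assumes "\<not> has_empty b"
  shows "1 \<le> agm b"
proof -
  have "1 \<le> real (cnt (rep e) b) powr W e" if "e \<in> scheme ` Rs" for e
  proof (rule ge_one_powr_ge_zero)
    have "cnt (rep e) b \<noteq> 0" using rep[OF that] assms by (auto simp: has_empty_def)
    then show "1 \<le> real (cnt (rep e) b)" by simp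
  qed (rule W_nonneg[OF that])
  then show ?thesis using assms by (auto simp: agm_def intro: prod_ge_1)
qed

lemma agm_child_le:
  assumes "i < d" "1 \<le> b i" "b i < 2 ^ L" "s < 2"
  shows "agm (child b i s) \<le> agm b"
proof (cases "has_empty (child b i s)")
  case True
  then show ?thesis using agm_nonneg by (simp add: agm_def)
next
  case False
  then have "\<not> has_empty b" using has_empty_child[of i b s, OF assms] by blast
  have "(\<Prod>e\<in>scheme ` Rs. real (cnt (rep e) (child b i s)) powr W e)
      \<le> (\<Prod>e\<in>scheme ` Rs. real (cnt (rep e) b) powr W e)"
  proof (intro prod_mono conjI powr_mono2)
    fix e assume e: "e \<in> scheme ` Rs"
    show "0 \<le> W e" by (rule W_nonneg[OF e])
    show "real (cnt (rep e) (child b i s)) \<le> real (cnt (rep e) b)"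
      using cnt_child_le[of _ i b s, OF _ assms] rep[OF e] by simp
  qed auto
  then show ?thesis using False \<open>\<not> has_empty b\<close> by (simp add: agm_def)
qed

text \<open>Edges without the split attribute contribute a common factor. Those with it have total
  weight at least 1 by the covering condition, and their counts are additive, so
  \<open>prod_powr_add_le\<close> applies. It needs positive counts; an empty child has bound 0 and
  is treated by monotonicity.\<close>

lemma agm_split:
  assumes "i < d" "1 \<le> b i" "b i < 2 ^ L"
  shows "agm (child b i 0) + agm (child b i 1) \<le> agm b"
proof (cases "has_empty (child b i 0) \<or> has_empty (child b i 1)")
  case True
  then have "agm (child b i 0) = 0 \<or> agm (child b i 1) = 0" by (auto simp: agm_def)
  then show ?thesis using agm_child_le[of i b 0, OF assms] agm_child_le[of i b 1, OF assms] by auto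
next
  case False
  then have nb: "\<not> has_empty b" using has_empty_child[of i b 0, OF assms] by auto
  define E where "E = scheme ` Rs"
  define F where "F = {e \<in> E. as ! i \<in> e}"
  have fin: "finite E" "finite F" by (auto simp: E_def F_def)
  have repE: "rep e \<in> Rs" "scheme (rep e) = e" if "e \<in> E" for e
    using rep that by (simp_all add: E_def)
  define c where "c b e = real (cnt (rep e) b) powr W e" for b e
  have split: "prod (c b') E = prod (c b') (E - F) * prod (c b') F" for b'
    using prod.subset_diff[of F E "c b'"] fin by (simp add: F_def)
  have other: "prod (c (child b i s)) (E - F) = prod (c b) (E - F)" for s
  proof (rule prod.cong[OF refl])
    fix e assume "e \<in> E - F"
    then show "c (child b i s) e = c b e"
      using cnt_child_other[of "rep e" i b s] repE assms(1) by (simp add: c_def F_def)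
  qed
  have "prod (c (child b i 0)) F + prod (c (child b i 1)) F
      \<le> (\<Prod>e\<in>F. (real (cnt (rep e) (child b i 0)) + real (cnt (rep e) (child b i 1))) powr W e)"
    unfolding c_def
  proof (rule prod_powr_add_le)
    show "0 \<le> W e" if "e \<in> F" for e using that W_nonneg by (simp add: F_def E_def)
    have "as ! i \<in> attributes Rs scheme" using assms(1) set_as nth_mem by blast
    then show "1 \<le> sum W F"
      using covering by (simp add: fractional_edge_covering_def F_def E_def)
    show "0 < real (cnt (rep e) (child b i 0)) \<and> 0 < real (cnt (rep e) (child b i 1))" if "e \<in> F" for e
      using that False repE by (auto simp: has_empty_def F_def)
  qed (rule fin)
  also have "\<dots> = prod (c b) F"
  proof (rule prod.cong[OF refl])
    fix e assume "e \<in> F"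
    then show "(real (cnt (rep e) (child b i 0)) + real (cnt (rep e) (child b i 1))) powr W e = c b e"
      using cnt_split[of "rep e" i b] assms repE by (simp add: c_def F_def)
  qed
  finally have "prod (c b) (E - F) * (prod (c (child b i 0)) F + prod (c (child b i 1)) F) \<le> prod (c b) E"
    unfolding split[of b] by (intro mult_left_mono) (auto simp: c_def intro!: prod_nonneg)
  then have "prod (c (child b i 0)) E + prod (c (child b i 1)) E \<le> prod (c b) E"
    unfolding split[of "child b i _"] other by (simp add: distrib_left)
  then show ?thesis using False nb by (simp add: agm_def c_def E_def)
qed

lemma cnt_le_input_size:
  assumes "r \<in> Rs"
  shows "cnt r b \<le> input_size Rs rel"
proof -
  have "cnt r b \<le> card (rel r)" unfolding cnt_def using assms by (intro card_mono) auto
  also have "\<dots> \<le> input_size Rs rel"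
    unfolding input_size_def using member_le_sum[OF assms, of "\<lambda>r. card (rel r)"] by simp
  finally show ?thesis .
qed

text \<open>The summand 1 pays for a schema without relations, where the empty product is 1 but
  \<open>0 powr 0\<close> is 0.\<close>

lemma agm_le: "agm b \<le> 1 + real (input_size Rs rel) powr (\<Sum>e\<in>scheme ` Rs. W e)"
proof (cases "has_empty b \<or> Rs = {}")
  case True
  then show ?thesis by (auto simp: agm_def has_empty_def intro: add_nonneg_nonneg)
next
  case False
  then obtain r where "r \<in> Rs" "cnt r b \<noteq> 0" by (auto simp: has_empty_def)
  then have N: "input_size Rs rel \<noteq> 0" using cnt_le_input_size by (metis le_zero_eq)
  have "agm b \<le> (\<Prod>e\<in>scheme ` Rs. real (input_size Rs rel) powr W e)"
    unfolding agm_def using False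
    by (auto intro!: prod_mono powr_mono2 W_nonneg cnt_le_input_size simp: rep)
  also have "\<dots> = real (input_size Rs rel) powr (\<Sum>e\<in>scheme ` Rs. W e)"
    using N by (subst powr_sum) auto
  finally show ?thesis by simp
qed

section \<open>Counting heavy boxes and nonempty projections\<close>

definition levels :: "(nat \<Rightarrow> nat) set" where
  "levels = {..<d} \<rightarrow>\<^sub>E {..L}"

definition grid :: "(nat \<Rightarrow> nat) \<Rightarrow> (nat \<Rightarrow> nat) set" where
  "grid l = {b \<in> boxes. \<forall>i<d. height L (b i) = l i}"

lemma card_levels: "card levels = Suc L ^ d" "finite levels"
  by (simp_all add: levels_def card_PiE finite_PiE)

lemma grid_refine:
  assumes i: "i < d" "l i < L"
  shows "grid l \<subseteq> (\<lambda>(b, s). child b i s) ` (grid (l(i := Suc (l i))) \<times> {0, 1})"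
proof
  fix b assume b: "b \<in> grid l"
  define b' where "b' = b(i := b i div 2)"
  have bi: "1 \<le> b i" "b i < 2 ^ Suc L" "height L (b i) = l i"
    using b i by (auto simp: grid_def boxes_def)
  have "b i \<noteq> 1" using bi i(2) by auto
  then have b2: "1 \<le> b i div 2" "b i div 2 < 2 ^ L" using bi by auto
  have child: "b = child b' i (b i mod 2)"
    by (simp add: child_def b'_def)
  have "height L (b i div 2) = Suc (l i)"
    using height_child[OF b2, of "b i mod 2"] bi by simp
  then have "b' \<in> grid (l(i := Suc (l i)))"
    using b b2 i by (auto simp: grid_def boxes_def b'_def)
  then show "b \<in> (\<lambda>(b, s). child b i s) ` (grid (l(i := Suc (l i))) \<times> {0, 1})"
    using child by (intro image_eqI[of _ _ "(b', b i mod 2)"]) auto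
qed

lemma finite_grid: "finite (grid l)"
  using finite_boxes by (simp add: grid_def)

text \<open>The grid is reached from the root by halving all boxes in one coordinate at a time, and
  by \<open>agm_split\<close> no such step increases the total. The induction measure is the number
  of these steps.\<close>

lemma sum_agm_grid: "l \<in> levels \<Longrightarrow> (\<Sum>b\<in>grid l. agm b) \<le> agm root"
proof (induction "\<Sum>i<d. L - l i" arbitrary: l rule: less_induct)
  case less
  show ?case
  proof (cases "\<exists>i<d. l i < L")
    case True
    then obtain i where i: "i < d" "l i < L" by blast
    let ?l = "l(i := Suc (l i))"
    have mem: "?l \<in> levels" using less.prems i by (auto simp: levels_def PiE_iff extensional_def)
    have "(\<Sum>i<d. L - ?l i) < (\<Sum>i<d. L - l i)"
      using i by (intro sum_strict_mono_ex1) auto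
    note IH = less.hyps[OF this mem]
    have "(\<Sum>b\<in>grid l. agm b) \<le> (\<Sum>b\<in>(\<lambda>(b, s). child b i s) ` (grid ?l \<times> {0, 1}). agm b)"
      by (intro sum_mono2 grid_refine i agm_nonneg) (simp add: finite_grid)
    also have "\<dots> \<le> (\<Sum>(b, s)\<in>grid ?l \<times> {0, 1}. agm (child b i s))"
      using sum_image_le[of "grid ?l \<times> {0, 1}" agm "\<lambda>(b, s). child b i s"]
      by (simp add: finite_grid agm_nonneg case_prod_unfold o_def)
    also have "\<dots> = (\<Sum>b\<in>grid ?l. agm (child b i 0) + agm (child b i 1))"
      by (simp add: sum.cartesian_product[symmetric])
    also have "\<dots> \<le> (\<Sum>b\<in>grid ?l. agm b)"
    proof (intro sum_mono agm_split i)
      fix b assume b: "b \<in> grid ?l"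
      then show "1 \<le> b i" using i by (auto simp: grid_def boxes_def)
      have "height L (b i) = Suc (l i)" using b i by (auto simp: grid_def)
      then show "b i < 2 ^ L" using height_leaf[of L "b i"] by (cases "b i < 2 ^ L") auto
    qed
    finally show ?thesis using IH by simp
  next
    case False
    have "b = root" if "b \<in> grid l" for b
    proof
      fix i
      show "b i = root i"
      proof (cases "i < d")
        case True
        then have "l i = L" using False less.prems by (auto simp: levels_def PiE_iff le_less)
        then have "L - floor_log (b i) = L" using that True by (auto simp: grid_def height_def)
        moreover have "1 \<le> b i" "b i < 2 ^ Suc L" using that True by (auto simp: grid_def boxes_def)
        ultimately show ?thesis
        \<comment> \<open>For \<open>L = 0\<close> the equation of heights is void because of
          truncated subtraction; there the bounds on \<open>b i\<close> leave only the root.\<close>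
        proof (cases "L = 0")
          case True
          then show ?thesis using \<open>1 \<le> b i\<close> \<open>b i < 2 ^ Suc L\<close> by (simp add: root_def)
        next
          case False
          with \<open>L - floor_log (b i) = L\<close> have "floor_log (b i) = 0" by simp
          then show ?thesis using floor_log_exp2_gt[of "b i"] \<open>1 \<le> b i\<close> by (simp add: root_def)
        qed
      next
        case False
        then show ?thesis using that by (simp add: grid_def boxes_def root_def)
      qed
    qed
    then have "grid l \<subseteq> {root}" by blast
    then show ?thesis using sum_mono2[of "{root}" "grid l" agm] agm_nonneg by simp
  qed
qed

definition heavy :: "(nat \<Rightarrow> nat) set" where
  "heavy = {b \<in> boxes. \<Delta> < agm b}"

lemma boxes_grid: "boxes = (\<Union>l\<in>levels. grid l)"
proof -
  have "\<exists>l\<in>levels. b \<in> grid l" if "b \<in> boxes" for b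
    using that by (intro bexI[of _ "restrict (\<lambda>i. height L (b i)) {..<d}"])
      (auto simp: grid_def levels_def height_le)
  then show ?thesis by (auto simp: grid_def)
qed

text \<open>Markov's inequality on each of the \<open>Suc L ^ d\<close> grids, whose totals are at
  most \<open>agm root\<close>.\<close>

lemma card_heavy: "real (card heavy) * \<Delta> \<le> real (Suc L ^ d) * agm root"
proof -
  have "real (card heavy) * \<Delta> = (\<Sum>b\<in>heavy. \<Delta>)" by simp
  also have "\<dots> \<le> (\<Sum>b\<in>heavy. agm b)" by (intro sum_mono) (auto simp: heavy_def)
  also have "\<dots> \<le> (\<Sum>b\<in>boxes. agm b)"
    using finite_boxes by (intro sum_mono2 agm_nonneg) (auto simp: heavy_def)
  also have "\<dots> \<le> (\<Sum>l\<in>levels. \<Sum>b\<in>grid l. agm b)"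
  proof -
    have "boxes = snd ` Sigma levels grid" unfolding boxes_grid by force
    then show ?thesis
      using sum_image_le[of "Sigma levels grid" agm snd]
      by (simp add: card_levels finite_grid agm_nonneg sum.Sigma case_prod_unfold o_def)
  qed
  also have "\<dots> \<le> (\<Sum>l\<in>levels. agm root)" by (intro sum_mono sum_agm_grid)
  finally show ?thesis by (simp add: card_levels)
qed

definition project :: "'r \<Rightarrow> (nat \<Rightarrow> nat) \<Rightarrow> nat \<Rightarrow> nat" where
  "project r b = (\<lambda>i. if i < d \<and> as ! i \<in> scheme r then b i else 1)"

text \<open>A nonempty projection is recovered from any tuple in it and the heights of the
  coordinates: its nodes are the ancestors of the codes of the tuple at these heights.\<close>

lemma card_projections:
  assumes r: "r \<in> Rs"
  shows "card {project r b |b. b \<in> boxes \<and> cnt r b \<noteq> 0} \<le> card (rel r) * Suc L ^ d"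
proof -
  define f where "f = (\<lambda>(t :: 'a tuple, l). \<lambda>i. if i < d \<and> as ! i \<in> scheme r then code (the (t (as ! i))) div 2 ^ l i else 1)"
  have "{project r b |b. b \<in> boxes \<and> cnt r b \<noteq> 0} \<subseteq> f ` (rel r \<times> levels)"
  proof
    fix x assume "x \<in> {project r b |b. b \<in> boxes \<and> cnt r b \<noteq> 0}"
    then obtain b where x: "x = project r b" and b: "b \<in> boxes" "cnt r b \<noteq> 0" by blast
    then have "{t \<in> rel r. inside b t} \<noteq> {}" unfolding cnt_def by (metis card.empty)
    then obtain t where t: "t \<in> rel r" "inside b t" by blast
    define l where "l = restrict (\<lambda>i. height L (b i)) {..<d}"
    have "l \<in> levels" by (auto simp: l_def levels_def height_le)
    moreover have "project r b = f (t, l)"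
      using t dom_rel[OF r t(1)] by (auto simp: project_def f_def fun_eq_iff inside_def covers_def l_def)
    ultimately show "x \<in> f ` (rel r \<times> levels)" using t x by blast
  qed
  then have "card {project r b |b. b \<in> boxes \<and> cnt r b \<noteq> 0} \<le> card (rel r \<times> levels)"
    using r card_levels surj_card_le[of "rel r \<times> levels" _ f] by simp
  then show ?thesis by (simp add: card_cartesian_product card_levels)
qed

end

section \<open>The search tree\<close>

text \<open>The final value of a register that starts with \<open>k\<close> and is overwritten at
  every hit of a loop over \<open>0, ..., n - 1\<close>; so the largest hit wins.\<close>

fun pick :: "(nat \<Rightarrow> bool) \<Rightarrow> nat \<Rightarrow> nat \<Rightarrow> nat" where
  "pick P 0 k = k"
| "pick P (Suc n) k = (if P n then n else pick P n k)"

lemma pick_cases: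
  obtains "pick P n k < n" "P (pick P n k)" "\<And>j. pick P n k < j \<Longrightarrow> j < n \<Longrightarrow> \<not> P j"
  | "pick P n k = k" "\<And>j. j < n \<Longrightarrow> \<not> P j"
proof (induction n arbitrary: thesis)
  case (Suc n)
  show ?case
  proof (cases "P n")
    case True
    then show ?thesis using Suc.prems(1) by auto
  next
    case False
    show ?thesis
    proof (cases rule: Suc.IH)
      case 1
      show ?thesis
        by (rule Suc.prems(1)) (use 1 False in \<open>auto simp: less_Suc_eq\<close>)
    next
      case 2
      show ?thesis
      proof (rule Suc.prems(2))
        show "pick P (Suc n) k = k" using 2(1) False by simp
        show "\<not> P j" if "j < Suc n" for j using 2(2) False that less_antisym by blast
      qed
    qed
  qed
qed simp

context join_instance
begin

text \<open>\<open>lo\<close> and \<open>hi\<close> are the values at the leftmost and the rightmost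
  leaf below \<open>u\<close>.\<close>

definition lo :: "nat \<Rightarrow> real" where
  "lo u = val (u * 2 ^ height L u)"

definition hi :: "nat \<Rightarrow> real" where
  "hi u = val ((u + 1) * 2 ^ height L u - 1)"

definition heavy_empty :: "(nat \<Rightarrow> nat) \<Rightarrow> bool" where
  "heavy_empty b \<longleftrightarrow> \<Delta> < agm b \<and> (\<forall>t\<in>natural_join Rs scheme rel. \<not> inside b t)"

definition tup :: "(nat \<Rightarrow> nat) \<Rightarrow> 'a tuple" where
  "tup b = map_of (map (\<lambda>i. (as ! i, val (b i))) [0..<d])"

definition leaf_box :: "'a tuple \<Rightarrow> nat \<Rightarrow> nat" where
  "leaf_box t = (\<lambda>i. if i < d then code (the (t (as ! i))) else 1)"

text \<open>Every halving lowers the total height by 1, whichever coordinate is chosen. So the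
  leaves below a box can be numbered by \<open>h\<close> bits although the order of splitting
  depends on the query.\<close>

definition box_at :: "nat \<Rightarrow> (nat \<Rightarrow> nat) \<Rightarrow> bool" where
  "box_at h b \<longleftrightarrow> b \<in> boxes \<and> (\<Sum>i<d. height L (b i)) = h"

lemma lo_hi_leaf: "2 ^ L \<le> u \<Longrightarrow> lo u = val u" "2 ^ L \<le> u \<Longrightarrow> hi u = val u"
  by (simp_all add: lo_def hi_def height_leaf)

lemma lo_hi_child:
  assumes "1 \<le> u" "u < 2 ^ L"
  shows "lo u \<le> lo (2 * u)" "hi (2 * u) \<le> lo (2 * u + 1)" "hi (2 * u + 1) \<le> hi u"
    "lo u \<le> lo (2 * u + 1)" "hi (2 * u) \<le> hi u"
proof -
  define h where "h = height L (2 * u)"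
  have h: "height L u = Suc h" "height L (2 * u + 1) = h"
    using height_child[OF assms, of 0] height_child[OF assms, of 1] by (simp_all add: h_def)
  have "(2 * u + 1) * 2 ^ h - 1 \<le> (2 * u + 1) * 2 ^ h" by simp
  then show "hi (2 * u) \<le> lo (2 * u + 1)"
    unfolding hi_def lo_def h h_def[symmetric] using mono_val by (simp only: monoD)
  show "lo u \<le> lo (2 * u)" "hi (2 * u + 1) \<le> hi u" "lo u \<le> lo (2 * u + 1)" "hi (2 * u) \<le> hi u"
    unfolding hi_def lo_def h h_def[symmetric]
    by (auto intro!: monoD[OF mono_val] simp: algebra_simps)
qed

lemma covers_val:
  assumes "covers L u y"
  shows "lo u \<le> val y" "val y \<le> hi u"
  using covers_bounds[OF assms] monoD[OF mono_val] unfolding lo_def hi_def by auto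

section \<open>Join tuples and leaf boxes\<close>

lemma natural_join_dom: "t \<in> natural_join Rs scheme rel \<Longrightarrow> dom t = set as"
  by (simp add: natural_join_def set_as)

lemma natural_join_restrict: "t \<in> natural_join Rs scheme rel \<Longrightarrow> r \<in> Rs \<Longrightarrow> t |` scheme r \<in> rel r"
  by (simp add: natural_join_def)

lemma attribute_relation:
  assumes "i < d"
  obtains r where "r \<in> Rs" "as ! i \<in> scheme r"
proof -
  have "as ! i \<in> attributes Rs scheme" using assms set_as nth_mem by blast
  then show thesis using that by (auto simp: attributes_def)
qed

lemma natural_join_code:
  assumes t: "t \<in> natural_join Rs scheme rel" and i: "i < d"
  shows "2 ^ L \<le> code (the (t (as ! i)))" "code (the (t (as ! i))) < 2 ^ Suc L"
    "val (code (the (t (as ! i)))) = the (t (as ! i))"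
proof -
  obtain r where r: "r \<in> Rs" "as ! i \<in> scheme r" using attribute_relation[OF i] .
  note tr = natural_join_restrict[OF t r(1)]
  have eq: "(t |` scheme r) (as ! i) = t (as ! i)" using r(2) by simp
  have "as ! i \<in> dom (t |` scheme r)" using dom_rel[OF r(1) tr] r(2) by simp
  from active[OF r(1) tr i this] show "2 ^ L \<le> code (the (t (as ! i)))"
    "code (the (t (as ! i))) < 2 ^ Suc L" "val (code (the (t (as ! i)))) = the (t (as ! i))"
    unfolding eq .
qed

lemma inside_natural_join:
  "t \<in> natural_join Rs scheme rel \<Longrightarrow> inside b t \<longleftrightarrow> (\<forall>i<d. covers L (b i) (code (the (t (as ! i)))))"
  using natural_join_dom nth_mem unfolding inside_def by blast

lemma inside_root_natural_join: "t \<in> natural_join Rs scheme rel \<Longrightarrow> inside root t"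
  using natural_join_code by (simp add: inside_natural_join root_def covers_root)

lemma natural_join_not_empty:
  assumes "t \<in> natural_join Rs scheme rel" "inside b t"
  shows "\<not> has_empty b"
proof -
  have "cnt r b \<noteq> 0" if r: "r \<in> Rs" for r
  proof -
    have "inside b (t |` scheme r)" using assms(2) by (auto simp: inside_def)
    then have "t |` scheme r \<in> {t \<in> rel r. inside b t}" using natural_join_restrict[OF assms(1) r] by simp
    then have "{t \<in> rel r. inside b t} \<noteq> {}" by blast
    then show ?thesis using r by (simp add: cnt_def)
  qed
  then show ?thesis by (simp add: has_empty_def)
qed

lemma tup_nth:
  assumes "i < d"
  shows "tup b (as ! i) = Some (val (b i))"
proof -
  have "map fst (map (\<lambda>i. (as ! i, val (b i))) [0..<d]) = as" by (simp add: o_def map_nth)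
  then show ?thesis
    unfolding tup_def using assms by (intro map_of_is_SomeI) (auto simp: distinct_as)
qed

lemma dom_tup: "dom (tup b) = set as"
proof -
  have "map fst (map (\<lambda>i. (as ! i, val (b i))) [0..<d]) = as" by (simp add: o_def map_nth)
  then show ?thesis unfolding tup_def dom_map_of_conv_image_fst by (metis set_map)
qed

lemma tup_leaf_box: "t \<in> natural_join Rs scheme rel \<Longrightarrow> tup (leaf_box t) = t"
proof (rule ext)
  fix X assume t: "t \<in> natural_join Rs scheme rel"
  show "tup (leaf_box t) X = t X"
  proof (cases "X \<in> set as")
    case True
    then obtain i where i: "i < d" "X = as ! i" by (auto simp: in_set_conv_nth)
    have "X \<in> dom t" using True natural_join_dom[OF t] by simp
    then show ?thesis using natural_join_code[OF t i(1)] i by (auto simp: tup_nth leaf_box_def)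
  next
    case False
    then have "X \<notin> dom t" "X \<notin> dom (tup (leaf_box t))"
      using natural_join_dom[OF t] dom_tup by simp_all
    then show ?thesis by (simp add: domIff)
  qed
qed

text \<open>Any tuple of a relation in a leaf box has exactly the entries of \<open>b\<close> as its
  codes, so it is a restriction of \<open>tup b\<close>. As every attribute occurs in some relation,
  all entries of \<open>b\<close> are codes of their values.\<close>

lemma leaf_natural_join:
  assumes "b \<in> boxes" "\<And>i. i < d \<Longrightarrow> 2 ^ L \<le> b i" "\<not> has_empty b"
  shows "tup b \<in> natural_join Rs scheme rel" "inside b (tup b)" "leaf_box (tup b) = b"
proof -
  have ex: "tup b |` scheme r \<in> rel r \<and> (\<forall>i<d. as ! i \<in> scheme r \<longrightarrow> code (val (b i)) = b i)"
    if r: "r \<in> Rs" for r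
  proof -
    have "cnt r b \<noteq> 0" using assms(3) r by (simp add: has_empty_def)
    then have "{t \<in> rel r. inside b t} \<noteq> {}" unfolding cnt_def by (metis card.empty)
    then obtain t where t: "t \<in> rel r" "inside b t" by blast
    have dt: "dom t = scheme r" by (rule dom_rel[OF r t(1)])
    have b: "b i = code (the (t (as ! i)))" if "i < d" "as ! i \<in> scheme r" for i
    proof -
      have "covers L (b i) (code (the (t (as ! i))))" using t(2) that dt by (simp add: inside_def)
      then show ?thesis by (simp only: covers_leaf[OF assms(2)[OF that(1)]])
    qed
    then have vb: "val (b i) = the (t (as ! i))" if "i < d" "as ! i \<in> scheme r" for i
      using active(3)[OF r t(1)] that dt by simp
    have "tup b |` scheme r = t"
    proof (rule ext)
      fix X show "(tup b |` scheme r) X = t X"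
      proof (cases "X \<in> scheme r")
        case True
        then have "X \<in> set as" using r set_as by (auto simp: attributes_def)
        then obtain i where i: "i < d" "X = as ! i" by (auto simp: in_set_conv_nth)
        have "X \<in> dom t" using True dt by simp
        then show ?thesis using True i vb by (auto simp: tup_nth)
      next
        case False
        then have "X \<notin> dom t" using dt by simp
        then show ?thesis using False by (simp add: domIff)
      qed
    qed
    then show ?thesis using t(1) b vb by simp
  qed
  have cv: "code (val (b i)) = b i" if i: "i < d" for i
    using attribute_relation[OF i] ex i by metis
  show nj: "tup b \<in> natural_join Rs scheme rel"
    using ex by (simp add: natural_join_def dom_tup set_as)
  show "inside b (tup b)"
    using cv assms(2) by (simp add: inside_natural_join[OF nj] tup_nth)
  show "leaf_box (tup b) = b"
    using cv assms(1) by (auto simp: leaf_box_def tup_nth fun_eq_iff boxes_def)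
qed

lemma box_at_child:
  assumes "box_at (Suc h) b" "i < d" "b i < 2 ^ L" "s < 2"
  shows "box_at h (child b i s)"
proof -
  have "1 \<le> b i" using assms by (auto simp: box_at_def boxes_def)
  then have "height L (b i) = Suc (height L (2 * b i + s))"
    using assms by (intro height_child)
  then have "(\<Sum>j<d. height L (b j)) = Suc (\<Sum>j<d. height L (child b i s j))"
    using assms(2) by (subst (1 2) sum.remove[of _ i]) (auto simp: child_def)
  then show ?thesis using assms child_boxes by (simp add: box_at_def)
qed

lemma box_at_root: "box_at (d * L) root"
  by (simp add: box_at_def root_boxes) (simp add: root_def)

lemma box_at_0:
  assumes "box_at 0 b" "i < d"
  shows "2 ^ L \<le> b i"
  using assms by (intro height_zero_leaf) (auto simp: box_at_def boxes_def)

end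

locale range_search = join_instance Rs scheme rel as L val code W \<Delta>
  for Rs :: "'r set" and scheme :: "'r \<Rightarrow> 'a set" and rel :: "'r \<Rightarrow> 'a tuple set"
    and as :: "'a list" and L :: nat and val :: "nat \<Rightarrow> real" and code :: "real \<Rightarrow> nat"
    and W :: "'a set \<Rightarrow> real" and \<Delta> :: real +
  fixes x1 x2 :: real
begin

definition disjoint :: "nat \<Rightarrow> bool" where
  "disjoint u \<longleftrightarrow> hi u < x1 \<or> x2 < lo u"

definition contained :: "nat \<Rightarrow> bool" where
  "contained u \<longleftrightarrow> x1 \<le> lo u \<and> hi u \<le> x2"

definition dead :: "(nat \<Rightarrow> nat) \<Rightarrow> bool" where
  "dead b \<longleftrightarrow> has_empty b \<or> heavy_empty b \<or> (\<exists>i<d. disjoint (b i))"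

text \<open>
  Coordinates are split until they are contained in the query, one coordinate after the other; only
  then are they split further. So only polylogarithmically many boxes stick out of the query.
\<close>

definition split :: "(nat \<Rightarrow> nat) \<Rightarrow> nat" where
  "split b = pick (\<lambda>i. \<not> contained (b i)) d (pick (\<lambda>i. b i < 2 ^ L) d 0)"

text \<open>
  A terminal node is listed with its height \<open>h\<close>, since the search then skips \<open>2 ^ h\<close> leaves. Leaves
  that yield a result carry their box.
\<close>

fun terminals :: "(nat \<Rightarrow> nat) \<Rightarrow> nat \<Rightarrow> (nat \<times> (nat \<Rightarrow> nat) option) list" where
  "terminals b 0 = [(0, if dead b then None else Some b)]"
| "terminals b (Suc h) = (if dead b then [(Suc h, None)]
     else terminals (child b (split b) 0) h @ terminals (child b (split b) 1) h)"

definition results :: "(nat \<times> (nat \<Rightarrow> nat) option) list \<Rightarrow> (nat \<Rightarrow> nat) list" where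
  "results xs = concat (map (\<lambda>(h, x). case x of None \<Rightarrow> [] | Some b \<Rightarrow> [b]) xs)"

definition flags :: "(nat \<times> (nat \<Rightarrow> nat) option) list \<Rightarrow> bool list" where
  "flags xs = map (\<lambda>x. snd x \<noteq> None) xs"

lemma results_simps [simp]:
  "results [] = []" "results ((h, None) # xs) = results xs"
  "results ((h, Some b) # xs) = b # results xs" "results (xs @ ys) = results xs @ results ys"
  by (simp_all add: results_def)

lemma flags_simps [simp]:
  "flags [] = []" "flags (x # xs) = (snd x \<noteq> None) # flags xs" "flags (xs @ ys) = flags xs @ flags ys"
  "length (flags xs) = length xs"
  by (simp_all add: flags_def)

lemma True_flags: "True \<in> set (flags xs) \<longleftrightarrow> results xs \<noteq> []"
proof (induction xs)
  case (Cons x xs)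
  then show ?case by (cases x; cases "snd x") auto
qed simp

text \<open>At a leaf \<open>lo\<close> and \<open>hi\<close> coincide, so it is either disjoint
  from the query or contained in it. In a box that is not dead, a coordinate that is not contained
  can therefore still be halved.\<close>

lemma split_valid:
  assumes "box_at (Suc h) b" "\<not> dead b"
  shows "split b < d" "b (split b) < 2 ^ L" "1 \<le> b (split b)"
proof -
  have leaf: "contained (b i)" if "i < d" "\<not> b i < 2 ^ L" for i
    using that assms(2) by (auto simp: dead_def contained_def disjoint_def lo_hi_leaf)
  have ex: "\<exists>i<d. b i < 2 ^ L"
  proof (rule ccontr)
    assume "\<not> ?thesis"
    then have "height L (b i) = 0" if "i < d" for i using that by (intro height_leaf) auto
    then have "(\<Sum>i<d. height L (b i)) = 0" by simp
    then show False using assms(1) by (simp add: box_at_def)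
  qed
  show *: "split b < d"
  proof (cases rule: pick_cases[of "\<lambda>i. \<not> contained (b i)" d "pick (\<lambda>i. b i < 2 ^ L) d 0"])
    case 2
    show ?thesis
      unfolding split_def 2(1) using ex by (cases rule: pick_cases[of "\<lambda>i. b i < 2 ^ L" d 0]) auto
  qed (simp add: split_def)
  show "b (split b) < 2 ^ L"
  proof (cases rule: pick_cases[of "\<lambda>i. \<not> contained (b i)" d "pick (\<lambda>i. b i < 2 ^ L) d 0"])
    case 1
    then show ?thesis using leaf unfolding split_def by blast
  next
    case 2
    show ?thesis
      unfolding split_def 2(1) using ex by (cases rule: pick_cases[of "\<lambda>i. b i < 2 ^ L" d 0]) auto
  qed
  show "1 \<le> b (split b)" using * assms(1) by (auto simp: box_at_def boxes_def)
qed

lemma box_at_split: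
  assumes "box_at (Suc h) b" "\<not> dead b" "s < 2"
  shows "box_at h (child b (split b) s)"
  using box_at_child split_valid assms by blast

lemma range_join_eq:
  "range_join Rs scheme rel x1 x2 =
    {t \<in> natural_join Rs scheme rel. \<forall>i<d. x1 \<le> the (t (as ! i)) \<and> the (t (as ! i)) \<le> x2}"
  unfolding range_join_def set_as[symmetric] by (auto simp: all_set_conv_all_nth set_conv_nth)

lemma dead_no_results:
  assumes "dead b" "t \<in> range_join Rs scheme rel x1 x2"
  shows "\<not> inside b t"
proof
  assume ins: "inside b t"
  have t: "t \<in> natural_join Rs scheme rel" using assms(2) by (simp add: range_join_eq)
  then have "\<not> has_empty b" "\<not> heavy_empty b"
    using natural_join_not_empty ins by (auto simp: heavy_empty_def)
  then obtain i where i: "i < d" "disjoint (b i)" using assms(1) by (auto simp: dead_def)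
  have "covers L (b i) (code (the (t (as ! i))))" using ins i by (simp add: inside_natural_join[OF t])
  from covers_val[OF this] show False
    using i assms(2) natural_join_code(3)[OF t i(1)] by (auto simp: disjoint_def range_join_eq)
qed

text \<open>A dead box loses no result, a halving distributes the results among the children, and a
  leaf box that is not dead is itself a result.\<close>

lemma set_results:
  "box_at h b \<Longrightarrow> set (results (terminals b h)) = leaf_box ` {t \<in> range_join Rs scheme rel x1 x2. inside b t}"
proof (induction h arbitrary: b)
  case 0
  show ?case
  proof (cases "dead b")
    case True
    then show ?thesis using dead_no_results by auto
  next
    case False
    have leaf: "2 ^ L \<le> b i" if "i < d" for i using box_at_0[OF 0 that] .
    have b: "b \<in> boxes" using 0 by (simp add: box_at_def)
    note nj = leaf_natural_join[OF b leaf, simplified]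
    have "\<not> has_empty b" using False by (simp add: dead_def)
    note nj = nj[OF this]
    have "x1 \<le> val (b i) \<and> val (b i) \<le> x2" if "i < d" for i
      using False that leaf[OF that] by (auto simp: dead_def disjoint_def lo_hi_leaf)
    then have "tup b \<in> range_join Rs scheme rel x1 x2"
      using nj(1) by (simp add: range_join_eq tup_nth)
    moreover have "leaf_box t = b" if "t \<in> range_join Rs scheme rel x1 x2" "inside b t" for t
    proof -
      have "t \<in> natural_join Rs scheme rel" using that by (simp add: range_join_eq)
      then show ?thesis using that leaf b
        by (auto simp: inside_natural_join leaf_box_def boxes_def fun_eq_iff)
    qed
    ultimately have "leaf_box ` {t \<in> range_join Rs scheme rel x1 x2. inside b t} = {b}"
      using nj by force
    then show ?thesis using False by simp
  qed
next
  case (Suc h)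
  show ?case
  proof (cases "dead b")
    case True
    then show ?thesis using dead_no_results by auto
  next
    case False
    note sv = split_valid[OF Suc.prems False]
    show ?thesis
      using False Suc.IH box_at_split[OF Suc.prems False] inside_split[of "split b" b, OF sv(1,3,2)]
      by (auto simp: image_Un)
  qed
qed

lemma distinct_results: "box_at h b \<Longrightarrow> distinct (results (terminals b h))"
proof (induction h arbitrary: b)
  case (Suc h)
  show ?case
  proof (cases "dead b")
    case False
    note sv = split_valid[OF Suc.prems False]
    note ch = box_at_split[OF Suc.prems False]
    have "set (results (terminals (child b (split b) 0) h)) \<inter> set (results (terminals (child b (split b) 1) h)) = {}"
    proof (rule ccontr)
      assume "\<not> ?thesis"
      then obtain t t' where t: "t \<in> range_join Rs scheme rel x1 x2" "t' \<in> range_join Rs scheme rel x1 x2"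
        "leaf_box t = leaf_box t'" "inside (child b (split b) 0) t" "inside (child b (split b) 1) t'"
        using set_results[OF ch, of 0] set_results[OF ch, of 1] by auto
      have nj: "t \<in> natural_join Rs scheme rel" "t' \<in> natural_join Rs scheme rel"
        using t by (simp_all add: range_join_eq)
      then have "t = t'" using tup_leaf_box t(3) by metis
      moreover have "as ! split b \<in> dom t" using sv(1) natural_join_dom[OF nj(1)] by simp
      ultimately show False
        using inside_exclusive[of "split b" b, OF sv(1,3,2)] t by blast
    qed
    then show ?thesis using False Suc.IH ch by simp
  qed simp
qed simp

lemma map_tup_results:
  "distinct (map tup (results (terminals root (d * L))))"
  "set (map tup (results (terminals root (d * L)))) = range_join Rs scheme rel x1 x2"
proof -
  have set: "set (results (terminals root (d * L))) = leaf_box ` range_join Rs scheme rel x1 x2"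
    using set_results[OF box_at_root] inside_root_natural_join by (auto simp: range_join_eq)
  have tl: "tup (leaf_box t) = t" if "t \<in> range_join Rs scheme rel x1 x2" for t
    using that tup_leaf_box by (simp add: range_join_eq)
  have "inj_on tup (leaf_box ` range_join Rs scheme rel x1 x2)"
    using tl by (auto intro!: inj_onI)
  then show "distinct (map tup (results (terminals root (d * L))))"
    using distinct_results[OF box_at_root] set by (simp add: distinct_map)
  show "set (map tup (results (terminals root (d * L)))) = range_join Rs scheme rel x1 x2"
    using set tl by (force simp: image_image)
qed

text \<open>
  The subtrees of a box partition its AGM bound, and only a box with an empty relation has AGM bound
  below 1. So every level of the search below \<open>b\<close> visits at most \<open>agm b\<close> nonempty boxes.
\<close>

lemma length_terminals: "box_at h b \<Longrightarrow> real (length (terminals b h)) \<le> 1 + real h * agm b"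
proof (induction h arbitrary: b)
  case (Suc h)
  show ?case
  proof (cases "dead b")
    case True
    then show ?thesis using agm_nonneg by simp
  next
    case False
    note sv = split_valid[OF Suc.prems False]
    note ch = box_at_split[OF Suc.prems False]
    have "real (length (terminals b (Suc h))) \<le> 2 + real h * (agm (child b (split b) 0) + agm (child b (split b) 1))"
      using False Suc.IH[OF ch, of 0] Suc.IH[OF ch, of 1] by (simp add: distrib_left)
    also have "\<dots> \<le> 2 + real h * agm b"
      using agm_split[of "split b" b, OF sv(1,3,2)] by (intro add_left_mono mult_left_mono) auto
    also have "\<dots> \<le> 1 + real (Suc h) * agm b"
      using agm_ge_1[of b] False by (simp add: dead_def distrib_right)
    finally show ?thesis .
  qed
qed simp

section \<open>Gaps in boxes inside the query\<close>

definition full :: "(nat \<Rightarrow> nat) \<Rightarrow> bool" where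
  "full b \<longleftrightarrow> (\<forall>i<d. contained (b i))"

text \<open>In a full box all join tuples are results. Without results its join is empty, so the box
  is light unless it is already dead.\<close>

lemma full_no_results:
  assumes "box_at h b" "full b" "results (terminals b h) = []"
  shows "real (length (terminals b h)) \<le> 1 + real h * \<Delta>"
proof (cases "dead b")
  case True
  then show ?thesis using Delta by (cases h) auto
next
  case False
  have "\<not> inside b t" if t: "t \<in> natural_join Rs scheme rel" for t
  proof
    assume ins: "inside b t"
    have "x1 \<le> the (t (as ! i)) \<and> the (t (as ! i)) \<le> x2" if i: "i < d" for i
    proof -
      have "covers L (b i) (code (the (t (as ! i))))" using ins i by (simp add: inside_natural_join[OF t])
      from covers_val[OF this] show ?thesis
        using i assms(2) natural_join_code(3)[OF t i] by (force simp: full_def contained_def)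
    qed
    then have "t \<in> range_join Rs scheme rel x1 x2" using t by (simp add: range_join_eq)
    then show False using set_results[OF assms(1)] assms(3) ins by auto
  qed
  then have "agm b \<le> \<Delta>" using False by (auto simp: dead_def heavy_empty_def)
  then have "real h * agm b \<le> real h * \<Delta>" by (intro mult_left_mono) auto
  then show ?thesis using length_terminals[OF assms(1)] by linarith
qed

lemma contained_child:
  assumes "1 \<le> u" "u < 2 ^ L" "s < 2" "contained u"
  shows "contained (2 * u + s)"
proof -
  have "s = 0 \<or> s = 1" using assms(3) by linarith
  then show ?thesis using lo_hi_child[OF assms(1,2)] assms(4) by (auto simp: contained_def)
qed

lemma full_child:
  assumes "full b" "i < d" "1 \<le> b i" "b i < 2 ^ L" "s < 2"
  shows "full (child b i s)"
  using assms contained_child by (auto simp: full_def child_def)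

text \<open>A final gap followed by an initial gap, each made of at most \<open>d * L + 1\<close>
  fruitless subtrees with at most \<open>1 + d * L * \<Delta>\<close> terminals.\<close>

definition gap_full :: real where
  "gap_full = 2 * real (d * L + 1) * (1 + real (d * L) * \<Delta>)"

lemma gap_full_ge:
  "1 \<le> gap_full" "1 + real (d * L) * \<Delta> \<le> gap_full"
proof -
  have "1 \<le> 1 + real (d * L) * \<Delta>" using Delta by simp
  moreover have "1 * (1 + real (d * L) * \<Delta>) \<le> 2 * real (d * L + 1) * (1 + real (d * L) * \<Delta>)"
    using Delta by (intro mult_right_mono) auto
  ultimately show "1 \<le> gap_full" "1 + real (d * L) * \<Delta> \<le> gap_full"
    unfolding gap_full_def by (simp_all only: mult_1)
qed

text \<open>For the initial gap, either the first child has a result, or it is fruitless as a whole,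
  costs at most \<open>E\<close> and passes the question on to the second child. So each level adds
  at most one \<open>E\<close>; final gaps are symmetric. Runs in the interior arise only at
  seams.\<close>

lemma full_gaps:
  assumes "box_at h b" "full b" "h \<le> d * L"
  defines "E \<equiv> 1 + real (d * L) * \<Delta>"
  shows "real (initial_gap (flags (terminals b h))) \<le> real (h + 1) * E \<and>
    real (final_gap (flags (terminals b h))) \<le> real (h + 1) * E \<and> calm gap_full (flags (terminals b h))"
  using assms(1-3)
proof (induction h arbitrary: b)
  case 0
  have "calm 1 (flags (terminals b 0))" using calm_length[of "flags (terminals b 0)"] by simp
  moreover have "1 \<le> E" using Delta by (simp add: E_def)
  ultimately show ?case
    using calm_mono gap_full_ge initial_gap_le_length[of "flags (terminals b 0)"]
      final_gap_le_length[of "flags (terminals b 0)"] by fastforce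
next
  case (Suc h)
  have E: "1 \<le> E" using Delta by (simp add: E_def)
  have empty: "real (length (terminals b' h')) \<le> E" if "box_at h' b'" "full b'" "h' \<le> d * L"
    "results (terminals b' h') = []" for b' h'
  proof -
    have "real h' * \<Delta> \<le> real (d * L) * \<Delta>" using that(3) Delta by (intro mult_right_mono) (auto simp flip: of_nat_mult)
    then show ?thesis using full_no_results[OF that(1,2,4)] by (simp add: E_def)
  qed
  show ?case
  proof (cases "results (terminals b (Suc h)) = []")
    case True
    let ?fs = "flags (terminals b (Suc h))"
    have len: "real (length ?fs) \<le> E" using empty[OF Suc.prems True] by simp
    have "E \<le> real (Suc h + 1) * E" using E by (simp add: mult_le_cancel_right1)
    moreover have "calm gap_full ?fs"
      using calm_mono[OF calm_length] len gap_full_ge by (auto simp: E_def)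
    ultimately show ?thesis
      using initial_gap_le_length[of ?fs] final_gap_le_length[of ?fs] len by linarith
  next
    case False
    then have nd: "\<not> dead b" by auto
    note sv = split_valid[OF Suc.prems(1) nd]
    define a where "a s = child b (split b) s" for s
    let ?fs = "\<lambda>s. flags (terminals (a s) h)"
    have a: "box_at h (a s)" "full (a s)" if "s < 2" for s
      using that box_at_split[OF Suc.prems(1) nd] full_child[OF Suc.prems(2) sv(1,3,2)] by (simp_all add: a_def)
    have IH: "real (initial_gap (?fs s)) \<le> real (h + 1) * E" "real (final_gap (?fs s)) \<le> real (h + 1) * E"
      "calm gap_full (?fs s)" if "s < 2" for s
      using Suc.IH[OF a[OF that]] Suc.prems(3) by auto
    have emp: "real (length (?fs s)) \<le> E" if "s < 2" "True \<notin> set (?fs s)" for s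
      using empty[OF a[OF that(1)]] that(2) Suc.prems(3) True_flags by simp
    have fs: "flags (terminals b (Suc h)) = ?fs 0 @ ?fs 1" using nd by (simp add: a_def)
    have "real (initial_gap (?fs 0 @ ?fs 1)) \<le> E + real (h + 1) * E"
      unfolding initial_gap_append using IH[of 0] IH[of 1] emp[of 0] E by auto
    moreover have "real (final_gap (?fs 0 @ ?fs 1)) \<le> E + real (h + 1) * E"
      unfolding final_gap_append using IH[of 0] IH[of 1] emp[of 1] E by auto
    moreover have "calm gap_full (?fs 0 @ ?fs 1)"
    proof (rule calm_append_gaps)
      have "real (final_gap (?fs 0) + initial_gap (?fs 1)) \<le> 2 * (real (h + 1) * E)"
        using IH[of 0] IH[of 1] by simp
      also have "\<dots> \<le> 2 * (real (d * L + 1) * E)"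
        using Suc.prems(3) E by (intro mult_left_mono mult_right_mono of_nat_mono) auto
      finally show "real (final_gap (?fs 0) + initial_gap (?fs 1)) \<le> gap_full"
        by (simp only: gap_full_def E_def mult.assoc)
    qed (use IH in auto)
    ultimately show ?thesis unfolding fs by (simp add: distrib_right)
  qed
qed

section \<open>Boxes that stick out of the query\<close>

definition cut :: "nat \<Rightarrow> nat" where
  "cut u = (if lo u < x1 \<and> x1 \<le> hi u then 1 else 0) + (if lo u \<le> x2 \<and> x2 < hi u then 1 else 0)"

lemma cut_le: "cut u \<le> 2"
  by (simp add: cut_def)

lemma cut_pos: "\<not> contained u \<Longrightarrow> \<not> disjoint u \<Longrightarrow> 1 \<le> cut u"
  by (auto simp: cut_def contained_def disjoint_def)

text \<open>The half-open conditions in \<open>cut\<close> matter: as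
  \<open>hi (2 * u) \<le> lo (2 * u + 1)\<close>, the half-open ranges of the children are disjoint,
  so each end of the query cuts at most one of them.\<close>

lemma cut_split:
  assumes "1 \<le> u" "u < 2 ^ L"
  shows "cut (2 * u) + cut (2 * u + 1) \<le> cut u"
  using lo_hi_child[OF assms] by (auto simp: cut_def)

text \<open>
  At each height at most two nodes of the value tree are cut by an end of the query. In the sum over
  the levels each of them is charged one subtree in which the next coordinate still has to be split.
\<close>

lemma partial_gaps:
  assumes "box_at h b" "h \<le> d * L" "i \<le> d" "\<And>j. i \<le> j \<Longrightarrow> j < d \<Longrightarrow> contained (b j)"
    and "\<And>j. j < i \<Longrightarrow> b j = 1"
  shows "calm (real (2 * L + 1) ^ i * gap_full) (flags (terminals b h))"
  using assms
proof (induction i arbitrary: b h)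
  case 0
  then have "full b" by (simp add: full_def)
  then show ?case using full_gaps[OF 0(1) _ 0(2)] by simp
next
  case (Suc i)
  note outer = Suc.IH
  define G where "G = real (2 * L + 1) ^ i * gap_full"
  have G: "1 \<le> G"
    using mult_mono[of 1 "real (2 * L + 1) ^ i" 1 gap_full] gap_full_ge by (simp add: G_def)
  \<comment> \<open>Height times cut ends serves as a potential for the number of subtrees in which
    coordinate \<open>i\<close> is settled. A split lowers the height by 1, and
    \<open>1 \<le> cut (b i)\<close> pays for the additional subtree.\<close>
  have main: "calm (real (height L (b i) * cut (b i) + 1) * G) (flags (terminals b h))"
    if "box_at h b" "h \<le> d * L" "\<And>j. i < j \<Longrightarrow> j < d \<Longrightarrow> contained (b j)" "\<And>j. j < i \<Longrightarrow> b j = 1" for b h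
    using that
  proof (induction h arbitrary: b)
    case 0
    have "1 * 1 \<le> real (height L (b i) * cut (b i) + 1) * G" using G by (intro mult_mono) auto
    then show ?case using calm_mono[OF calm_length[of "flags (terminals b 0)"]] by simp
  next
    case (Suc h)
    have one: "1 * 1 \<le> real (height L (b i) * cut (b i) + 1) * G" using G by (intro mult_mono) auto
    consider "dead b" | "contained (b i)" | "\<not> dead b" "\<not> contained (b i)" by blast
    then show ?case
    proof cases
      case 1
      then show ?thesis using calm_mono[OF calm_length[of "flags (terminals b (Suc h))"]] one by simp
    next
      case 2
      have "contained (b j)" if "i \<le> j" "j < d" for j
        using 2 Suc.prems(3)[of j] that by (cases "i = j") auto
      then have "calm G (flags (terminals b (Suc h)))"
        unfolding G_def using Suc.prems \<open>Suc i \<le> d\<close> by (intro outer) auto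
      moreover have "1 * G \<le> real (height L (b i) * cut (b i) + 1) * G"
        using G by (intro mult_right_mono) auto
      ultimately show ?thesis using calm_mono by simp
    next
      case 3
      \<comment> \<open>All coordinates above \<open>i\<close> are contained, and
        \<open>pick\<close> takes the largest one that is not.\<close>
      have "split b = i"
      proof (cases rule: pick_cases[of "\<lambda>i. \<not> contained (b i)" d "pick (\<lambda>i. b i < 2 ^ L) d 0"])
        case 1
        then have "\<not> i < split b" using Suc.prems(3) by (auto simp: split_def)
        moreover have "\<not> split b < i" using 1(3)[of i] 3(2) \<open>Suc i \<le> d\<close> by (auto simp: split_def)
        ultimately show ?thesis by simp
      next
        case 2
        then show ?thesis using 3(2) \<open>Suc i \<le> d\<close> by auto
      qed
      note sv = split_valid[OF Suc.prems(1) 3(1), unfolded this]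
      note ch = box_at_split[OF Suc.prems(1) 3(1), unfolded \<open>split b = i\<close>]
      define k where "k = height L (2 * b i)"
      have k: "height L (b i) = Suc k" "height L (2 * b i + 1) = k"
        using height_child[OF sv(3,2), of 0] height_child[OF sv(3,2), of 1] by (simp_all add: k_def)
      have IH: "calm (real (height L (child b i s i) * cut (child b i s i) + 1) * G) (flags (terminals (child b i s) h))"
        if "s < 2" for s
        using Suc.prems by (intro Suc.IH ch that) (auto simp: child_def)
      have "calm (real (k * cut (2 * b i) + 1) * G + real (k * cut (2 * b i + 1) + 1) * G)
          (flags (terminals (child b i 0) h) @ flags (terminals (child b i 1) h))"
        using IH[of 0] IH[of 1] k by (intro calm_append) (simp_all add: child_def k_def)
      moreover have "real (k * cut (2 * b i) + 1) * G + real (k * cut (2 * b i + 1) + 1) * G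
          \<le> real (height L (b i) * cut (b i) + 1) * G"
      proof -
        have "1 \<le> cut (b i)" using 3 sv(1) by (intro cut_pos) (auto simp: dead_def)
        moreover have "k * (cut (2 * b i) + cut (2 * b i + 1)) \<le> k * cut (b i)"
          by (intro mult_left_mono cut_split sv) auto
        ultimately have "k * cut (2 * b i) + 1 + (k * cut (2 * b i + 1) + 1) \<le> height L (b i) * cut (b i) + 1"
          by (simp add: k distrib_left)
        then have "real (k * cut (2 * b i) + 1 + (k * cut (2 * b i + 1) + 1)) * G \<le> real (height L (b i) * cut (b i) + 1) * G"
          using G by (intro mult_right_mono of_nat_mono) auto
        then show ?thesis by (simp add: distrib_right)
      qed
      ultimately show ?thesis using 3(1) \<open>split b = i\<close> calm_mono by simp
    qed
  qed
  have "calm (real (height L (b i) * cut (b i) + 1) * G) (flags (terminals b h))"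
    by (intro main) (use Suc.prems in auto)
  moreover have "real (height L (b i) * cut (b i) + 1) * G \<le> real (2 * L + 1) * G"
  proof -
    have "height L (b i) * cut (b i) \<le> L * 2" by (intro mult_mono height_le cut_le) auto
    then show ?thesis using G by (intro mult_right_mono of_nat_mono) auto
  qed
  ultimately show ?case using calm_mono by (simp add: G_def mult.assoc)
qed

lemma root_gaps: "calm (real (2 * L + 1) ^ d * gap_full) (flags (terminals root (d * L)))"
  by (rule partial_gaps[OF box_at_root]) (auto simp: root_def)

end

section \<open>Loop-free programs\<close>

text \<open>The default 1 is not a bound for \<open>While\<close>; \<open>runs\<close> is applied to
  loop-free programs.\<close>

fun tick_bound :: "'a com \<Rightarrow> nat" where
  "tick_bound (Seq c c') = tick_bound c + tick_bound c'"
| "tick_bound (If g c c') = Suc (max (tick_bound c) (tick_bound c'))"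
| "tick_bound _ = 1"

text \<open>A total-correctness triple with a time bound. A trace that consists of ticks also says
  that nothing is reported.\<close>

definition runs :: "nat \<Rightarrow> 'a com \<Rightarrow> config \<Rightarrow> (config \<Rightarrow> bool) \<Rightarrow> bool" where
  "runs w c s Q \<longleftrightarrow> (\<exists>n s'. n \<le> tick_bound c \<and> exec w c s (replicate n Tick) s' \<and> Q s')"

lemma runsE:
  assumes "runs w c s Q"
  obtains n s' where "n \<le> tick_bound c" "exec w c s (replicate n Tick) s'" "Q s'"
  using assms by (auto simp: runs_def)

lemma runs_single:
  assumes "exec w c s [Tick] s'" "Q s'" "1 \<le> tick_bound c"
  shows "runs w c s Q"
  unfolding runs_def using assms by (intro exI[of _ 1] exI[of _ s']) simp

lemma runs_Skip: "Q s \<Longrightarrow> runs w Skip s Q"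
  by (rule runs_single[OF exec.Skip]) auto

lemma runs_Set: "Q (s\<lparr>wreg := (wreg s)(i := wval w s a)\<rparr>) \<Longrightarrow> runs w (Set i a) s Q"
  by (rule runs_single[OF exec.Set]) auto

lemma runs_Load:
  "wval w s a < length (wmem s) \<Longrightarrow> Q (s\<lparr>wreg := (wreg s)(i := wmem s ! wval w s a)\<rparr>) \<Longrightarrow>
    runs w (Load i a) s Q"
  by (rule runs_single[OF exec.Load]) auto

lemma runs_RLoad:
  "wval w s a < length (rmem s) \<Longrightarrow> Q (s\<lparr>rreg := (rreg s)(i := rmem s ! wval w s a)\<rparr>) \<Longrightarrow>
    runs w (RLoad i a) s Q"
  by (rule runs_single[OF exec.RLoad]) auto

lemma runs_Seq:
  assumes "runs w c s (\<lambda>s'. runs w c' s' Q)"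
  shows "runs w (Seq c c') s Q"
proof -
  from assms obtain n s' where 1: "n \<le> tick_bound c" "exec w c s (replicate n Tick) s'" "runs w c' s' Q"
    by (rule runsE)
  from 1(3) obtain m s'' where "m \<le> tick_bound c'" "exec w c' s' (replicate m Tick) s''" "Q s''"
    by (rule runsE)
  then show ?thesis
    unfolding runs_def using 1 exec.Seq[OF 1(2)]
    by (intro exI[of _ "n + m"] exI[of _ s'']) (simp add: replicate_add)
qed

lemma runs_If:
  assumes "gval w s g \<Longrightarrow> runs w c s Q" "\<not> gval w s g \<Longrightarrow> runs w c' s Q"
  shows "runs w (If g c c') s Q"
proof (cases "gval w s g")
  case True
  from assms(1)[OF this] obtain n s' where "n \<le> tick_bound c" "exec w c s (replicate n Tick) s'" "Q s'"
    by (rule runsE)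
  then show ?thesis
    unfolding runs_def using exec.If_True[OF True, of c "replicate n Tick" s']
    by (intro exI[of _ "Suc n"] exI[of _ s']) simp
next
  case False
  from assms(2)[OF this] obtain n s' where "n \<le> tick_bound c'" "exec w c' s (replicate n Tick) s'" "Q s'"
    by (rule runsE)
  then show ?thesis
    unfolding runs_def using exec.If_False[OF False, of c' "replicate n Tick" s']
    by (intro exI[of _ "Suc n"] exI[of _ s']) simp
qed

lemma runs_mono: "runs w c s P \<Longrightarrow> (\<And>s'. P s' \<Longrightarrow> Q s') \<Longrightarrow> runs w c s Q"
  by (auto simp: runs_def)

definition block :: "'a com list \<Rightarrow> 'a com" where
  "block cs = foldr Seq cs Skip"

lemma runs_block_Nil: "Q s \<Longrightarrow> runs w (block []) s Q"
  by (simp add: block_def runs_Skip)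

lemma runs_block_Cons: "runs w c s (\<lambda>s'. runs w (block cs) s' Q) \<Longrightarrow> runs w (block (c # cs)) s Q"
  by (simp add: block_def runs_Seq)

definition for_loop :: "nat \<Rightarrow> (nat \<Rightarrow> 'a com) \<Rightarrow> 'a com" where
  "for_loop n f = block (map f [0..<n])"

lemma runs_for_loop:
  assumes "I 0 s" "\<And>i s. i < n \<Longrightarrow> I i s \<Longrightarrow> runs w (f i) s (I (Suc i))"
    and "\<And>s. I n s \<Longrightarrow> Q s"
  shows "runs w (for_loop n f) s Q"
proof -
  have "runs w (block (map f [m..<n])) s Q" if "I m s" "m \<le> n" for m s
    using that
  proof (induction "n - m" arbitrary: m s)
    case 0
    then show ?case using assms(3) by (simp add: runs_block_Nil)
  next
    case (Suc k)
    then have m: "m < n" "[m..<n] = m # [Suc m..<n]" by (auto simp: upt_conv_Cons)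
    show ?case
      unfolding m(2) list.map
      by (rule runs_block_Cons, rule runs_mono[OF assms(2)[OF m(1) Suc.prems(1)]])
        (use Suc.hyps m(1) in auto)
  qed
  then show ?thesis using assms(1) by (simp add: for_loop_def)
qed

section \<open>The query program\<close>

text \<open>
  Word registers: 0 is the position among the \<open>2 ^ (d * L)\<close> leaves of the search tree, 1 the number
  of leaves below the current box, 2 the position relative to the current box, 3 tells whether the
  current box is dead, 4 is the coordinate to split, 5 and 7 hold \<open>2 ^ L\<close> and \<open>2 ^ (d * L)\<close>, and 6
  is the child to visit. The registers \<open>8 + 2 * i\<close> hold the current box, and the registers
  \<open>9 + 2 * j\<close> hold the pointers into the memory.
\<close>

definition check_com :: "nat \<Rightarrow> nat \<Rightarrow> 'a com" where
  "check_com d n = block [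
     Set 3 (Lit 0),
     Set 4 (Lit 0),
     for_loop n (\<lambda>j. If (Less (Reg (9 + 2 * j)) (Lit 1)) (Set 3 (Lit 1)) Skip),
     for_loop d (\<lambda>i. If (Less (Reg (8 + 2 * i)) (Reg 5)) (Set 4 (Lit i)) Skip),
     for_loop d (\<lambda>i. block [
       RLoad 2 (Op Mul (Lit 2) (Reg (8 + 2 * i))),
       RLoad 3 (Op Add (Op Mul (Lit 2) (Reg (8 + 2 * i))) (Lit 1)),
       If (Conj (Neg (RLess 2 0)) (Neg (RLess 1 3))) Skip (Set 4 (Lit i)),
       If (Conj (Neg (RLess 3 0)) (Neg (RLess 1 2))) Skip (Set 3 (Lit 1))])]"

text \<open>Register 1 is halved first, so its quotient into register 2 is the next bit of the leaf
  number, that is, the child to enter. The successor of a state is stored at its address plus twice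
  the coordinate plus the child.\<close>

definition step_com :: "nat \<Rightarrow> nat \<Rightarrow> 'a com" where
  "step_com d n = block [
     Set 1 (Op Div (Reg 1) (Lit 2)),
     Set 6 (Op Div (Reg 2) (Reg 1)),
     Set 2 (Op Mod (Reg 2) (Reg 1)),
     for_loop n (\<lambda>j. Load (9 + 2 * j) (Op Add (Op Add (Reg (9 + 2 * j)) (Op Mul (Lit 2) (Reg 4))) (Reg 6))),
     for_loop d (\<lambda>i. If (Conj (Neg (Less (Reg 4) (Lit i))) (Neg (Less (Lit i) (Reg 4))))
       (Set (8 + 2 * i) (Op Add (Op Mul (Lit 2) (Reg (8 + 2 * i))) (Reg 6))) Skip)]"

definition reset_com :: "nat \<Rightarrow> nat \<Rightarrow> 'a com" where
  "reset_com d n = block [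
     Set 1 (Reg 7),
     Set 2 (Reg 0),
     for_loop d (\<lambda>i. Set (8 + 2 * i) (Lit 1)),
     for_loop n (\<lambda>j. Load (9 + 2 * j) (Lit (2 + j))),
     check_com d n]"

definition descend_com :: "nat \<Rightarrow> nat \<Rightarrow> 'a com" where
  "descend_com d n = While (Conj (Less (Reg 3) (Lit 1)) (Less (Lit 1) (Reg 1))) (Seq (step_com d n) (check_com d n))"

definition fetch_com :: "nat \<Rightarrow> 'a com" where
  "fetch_com d = for_loop d (\<lambda>i. RLoad (4 + i) (Op Mul (Lit 2) (Reg (8 + 2 * i))))"

definition report_com :: "'a list \<Rightarrow> 'a com" where
  "report_com as = If (Less (Reg 3) (Lit 1))
     (Seq (fetch_com (length as)) (Report (map (\<lambda>i. (as ! i, 4 + i)) [0..<length as]))) Skip"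

definition visit_com :: "'a list \<Rightarrow> nat \<Rightarrow> 'a com" where
  "visit_com as n = Seq (reset_com (length as) n) (Seq (descend_com (length as) n)
     (Seq (report_com as) (Set 0 (Op Add (Reg 0) (Reg 1)))))"

definition query_com :: "'a list \<Rightarrow> nat \<Rightarrow> 'a com" where
  "query_com as n = Seq (Load 5 (Lit 0)) (Seq (Load 7 (Lit 1)) (While (Less (Reg 0) (Reg 7)) (visit_com as n)))"

definition visit_cost :: "'a list \<Rightarrow> nat \<Rightarrow> nat" where
  "visit_cost as n = 6 + tick_bound (reset_com (length as) n :: 'a com) + tick_bound (step_com (length as) n :: 'a com)
     + tick_bound (check_com (length as) n :: 'a com) + tick_bound (fetch_com (length as) :: 'a com)"

lemma register_distinct [simp]: "8 + 2 * i \<noteq> 9 + 2 * (j :: nat)" "9 + 2 * j \<noteq> 8 + 2 * (i :: nat)"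
  by presburger+

text \<open>The interface between search and memory: \<open>ptr j b\<close> is the address of the
  state of automaton \<open>j\<close> at box \<open>b\<close>, and 0 marks a rejected box. Node
  \<open>u\<close> keeps its bounds in the real cells \<open>2 * u\<close> and
  \<open>2 * u + 1\<close>, hence \<open>4 * 2 ^ L\<close> cells.\<close>

locale search_memory = join_instance Rs scheme rel as L val code W \<Delta>
  for Rs :: "'r set" and scheme :: "'r \<Rightarrow> 'a set" and rel :: "'r \<Rightarrow> 'a tuple set"
    and as :: "'a list" and L :: nat and val :: "nat \<Rightarrow> real" and code :: "real \<Rightarrow> nat"
    and W :: "'a set \<Rightarrow> real" and \<Delta> :: real +
  fixes w n :: nat and ptr :: "nat \<Rightarrow> (nat \<Rightarrow> nat) \<Rightarrow> nat" and wm :: "nat list" and rm :: "real list"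
  assumes null_ptr: "b \<in> boxes \<Longrightarrow> (\<exists>j<n. ptr j b = 0) \<longleftrightarrow> has_empty b \<or> heavy_empty b"
    and child_ptr: "b \<in> boxes \<Longrightarrow> j < n \<Longrightarrow> ptr j b \<noteq> 0 \<Longrightarrow> i < length as \<Longrightarrow> b i < 2 ^ L \<Longrightarrow> s < 2 \<Longrightarrow>
      ptr j b + 2 * i + s < length wm \<and> wm ! (ptr j b + 2 * i + s) = ptr j (child b i s)"
    and root_ptr: "j < n \<Longrightarrow> wm ! (2 + j) = ptr j root"
    and length_wm: "2 + n \<le> length wm" "length wm \<le> 2 ^ w"
    and wm_sizes: "wm ! 0 = 2 ^ L" "wm ! 1 = 2 ^ (length as * L)"
    and rm: "length rm = 4 * 2 ^ L" "4 * 2 ^ L \<le> (2 :: nat) ^ w"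
      "\<And>u. 1 \<le> u \<Longrightarrow> u < 2 ^ Suc L \<Longrightarrow> rm ! (2 * u) = lo u"
      "\<And>u. 1 \<le> u \<Longrightarrow> u < 2 ^ Suc L \<Longrightarrow> rm ! Suc (2 * u) = hi u"
    and words: "length as * L < w" "length as < 2 ^ w"

locale query_run = search_memory Rs scheme rel as L val code W \<Delta> w n ptr wm rm
    + range_search Rs scheme rel as L val code W \<Delta> x1 x2
  for Rs :: "'r set" and scheme :: "'r \<Rightarrow> 'a set" and rel :: "'r \<Rightarrow> 'a tuple set"
    and as :: "'a list" and L :: nat and val :: "nat \<Rightarrow> real" and code :: "real \<Rightarrow> nat"
    and W :: "'a set \<Rightarrow> real" and \<Delta> :: real
    and w n :: nat and ptr :: "nat \<Rightarrow> (nat \<Rightarrow> nat) \<Rightarrow> nat" and wm :: "nat list" and rm :: "real list"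
    and x1 x2 :: real
begin

definition ready :: "config \<Rightarrow> bool" where
  "ready s \<longleftrightarrow> wmem s = wm \<and> rmem s = rm \<and> rreg s 0 = x1 \<and> rreg s 1 = x2
     \<and> wreg s 5 = 2 ^ L \<and> wreg s 7 = 2 ^ (d * L)"

definition at_box :: "nat \<Rightarrow> nat \<Rightarrow> nat \<Rightarrow> (nat \<Rightarrow> nat) \<Rightarrow> config \<Rightarrow> bool" where
  "at_box z p y b s \<longleftrightarrow> ready s \<and> wreg s 0 = z \<and> wreg s 1 = p \<and> wreg s 2 = y
     \<and> (\<forall>i<d. wreg s (8 + 2 * i) = b i) \<and> (\<forall>j<n. wreg s (9 + 2 * j) = ptr j b)"

lemma w_not_0 [simp]: "0 < w"
  using words(1) by simp

lemma w_two: "2 < (2 :: nat) ^ w"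
proof -
  have "(4::nat) * 1 \<le> 4 * 2 ^ L" by (intro mult_le_mono) auto
  then show ?thesis using rm(2) by linarith
qed

lemma small_lit:
  "1 mod (2 :: nat) ^ w = 1" "Suc 0 mod (2 :: nat) ^ w = Suc 0" "2 mod (2 :: nat) ^ w = 2" "i < d \<Longrightarrow> i mod 2 ^ w = i"
  using w_two words(2) by simp_all

lemma node_word:
  assumes "b \<in> boxes" "i < d"
  shows "2 * b i mod 2 ^ w = 2 * b i" "Suc (2 * b i) mod 2 ^ w = Suc (2 * b i)"
    "Suc (2 * b i) < length rm" "rm ! (2 * b i) = lo (b i)" "rm ! Suc (2 * b i) = hi (b i)"
proof -
  have b: "1 \<le> b i" "b i < 2 ^ Suc L" using assms by (auto simp: boxes_def)
  then have "Suc (2 * b i) < 4 * 2 ^ L" by simp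
  then show "2 * b i mod 2 ^ w = 2 * b i" "Suc (2 * b i) mod 2 ^ w = Suc (2 * b i)"
    "Suc (2 * b i) < length rm" using rm(1,2) by simp_all
  show "rm ! (2 * b i) = lo (b i)" "rm ! Suc (2 * b i) = hi (b i)" using rm(3,4) b by simp_all
qed

lemma at_box_frame [simp]:
  "at_box z p y b (s\<lparr>wreg := (wreg s)(3 := v)\<rparr>) = at_box z p y b s"
  "at_box z p y b (s\<lparr>wreg := (wreg s)(4 := v)\<rparr>) = at_box z p y b s"
  "at_box z p y b (s\<lparr>wreg := (wreg s)(3 := v, 4 := v')\<rparr>) = at_box z p y b s"
  "2 \<le> k \<Longrightarrow> at_box z p y b (s\<lparr>rreg := (rreg s)(k := x)\<rparr>) = at_box z p y b s"
  by (simp_all add: at_box_def ready_def)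

lemma at_boxD:
  assumes "at_box z p y b s"
  shows "wmem s = wm" "rmem s = rm" "rreg s 0 = x1" "rreg s (Suc 0) = x2" "wreg s 5 = 2 ^ L" "wreg s 7 = 2 ^ (d * L)"
    "wreg s 0 = z" "wreg s (Suc 0) = p" "wreg s 2 = y"
    "i < d \<Longrightarrow> wreg s (8 + 2 * i) = b i" "j < n \<Longrightarrow> wreg s (9 + 2 * j) = ptr j b"
  using assms by (simp_all add: at_box_def ready_def)

lemma runs_check_pointers:
  assumes "at_box z p y b s" "wreg s 3 = 0" "wreg s 4 = 0"
  shows "runs w (for_loop n (\<lambda>j. If (Less (Reg (9 + 2 * j)) (Lit 1)) (Set 3 (Lit 1)) Skip)) s
    (\<lambda>s. at_box z p y b s \<and> wreg s 3 = of_bool (\<exists>j<n. ptr j b = 0) \<and> wreg s 4 = 0)"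
proof (rule runs_for_loop[where I = "\<lambda>i s. at_box z p y b s \<and> wreg s 3 = of_bool (\<exists>j<i. ptr j b = 0) \<and> wreg s 4 = 0"])
  fix i s assume i: "i < n" and I: "at_box z p y b s \<and> wreg s 3 = of_bool (\<exists>j<i. ptr j b = 0) \<and> wreg s 4 = 0"
  have r: "wreg s (9 + 2 * i) = ptr i b" using at_boxD(11)[OF conjunct1[OF I] i] .
  show "runs w (If (Less (Reg (9 + 2 * i)) (Lit 1)) (Set 3 (Lit 1)) Skip) s
    (\<lambda>s. at_box z p y b s \<and> wreg s 3 = of_bool (\<exists>j<Suc i. ptr j b = 0) \<and> wreg s 4 = 0)"
    by (intro runs_If runs_Set runs_Skip) (use I r in \<open>auto simp: small_lit less_Suc_eq\<close>)
qed (use assms in auto)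

lemma runs_check_leaves:
  assumes "at_box z p y b s" "wreg s 3 = v" "wreg s 4 = 0"
  shows "runs w (for_loop d (\<lambda>i. If (Less (Reg (8 + 2 * i)) (Reg 5)) (Set 4 (Lit i)) Skip)) s
    (\<lambda>s. at_box z p y b s \<and> wreg s 3 = v \<and> wreg s 4 = pick (\<lambda>i. b i < 2 ^ L) d 0)"
proof (rule runs_for_loop[where I = "\<lambda>i s. at_box z p y b s \<and> wreg s 3 = v \<and> wreg s 4 = pick (\<lambda>i. b i < 2 ^ L) i 0"])
  fix i s assume i: "i < d" and I: "at_box z p y b s \<and> wreg s 3 = v \<and> wreg s 4 = pick (\<lambda>i. b i < 2 ^ L) i 0"
  have r: "wreg s (8 + 2 * i) = b i" "wreg s 5 = 2 ^ L"
    using at_boxD(5,10)[OF conjunct1[OF I]] i by simp_all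
  show "runs w (If (Less (Reg (8 + 2 * i)) (Reg 5)) (Set 4 (Lit i)) Skip) s
    (\<lambda>s. at_box z p y b s \<and> wreg s 3 = v \<and> wreg s 4 = pick (\<lambda>i. b i < 2 ^ L) (Suc i) 0)"
    by (intro runs_If runs_Set runs_Skip) (use I r i in \<open>auto simp: small_lit\<close>)
qed (use assms in auto)

lemma runs_check_ranges:
  assumes "at_box z p y b s" "wreg s 3 = of_bool D" "wreg s 4 = k" and b: "b \<in> boxes"
  shows "runs w (for_loop d (\<lambda>i. block [
       RLoad 2 (Op Mul (Lit 2) (Reg (8 + 2 * i))),
       RLoad 3 (Op Add (Op Mul (Lit 2) (Reg (8 + 2 * i))) (Lit 1)),
       If (Conj (Neg (RLess 2 0)) (Neg (RLess 1 3))) Skip (Set 4 (Lit i)),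
       If (Conj (Neg (RLess 3 0)) (Neg (RLess 1 2))) Skip (Set 3 (Lit 1))])) s
    (\<lambda>s. at_box z p y b s \<and> wreg s 3 = of_bool (D \<or> (\<exists>i<d. disjoint (b i)))
      \<and> wreg s 4 = pick (\<lambda>i. \<not> contained (b i)) d k)"
proof (rule runs_for_loop[where I = "\<lambda>i s. at_box z p y b s \<and> wreg s 3 = of_bool (D \<or> (\<exists>j<i. disjoint (b j)))
      \<and> wreg s 4 = pick (\<lambda>i. \<not> contained (b i)) i k"])
  fix i s assume i: "i < d" and I: "at_box z p y b s \<and> wreg s 3 = of_bool (D \<or> (\<exists>j<i. disjoint (b j)))
      \<and> wreg s 4 = pick (\<lambda>i. \<not> contained (b i)) i k"
  note nw = node_word[OF b i]
  have load: "runs w (RLoad 2 (Op Mul (Lit 2) (Reg (8 + 2 * i)))) s R"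
    if "at_box z p y b s" "R (s\<lparr>rreg := (rreg s)(2 := lo (b i))\<rparr>)" for s R
    by (rule runs_RLoad) (use that(2) at_boxD[OF that(1)] i nw in \<open>simp_all add: small_lit\<close>)
  have load': "runs w (RLoad 3 (Op Add (Op Mul (Lit 2) (Reg (8 + 2 * i))) (Lit 1))) s R"
    if "at_box z p y b s" "R (s\<lparr>rreg := (rreg s)(3 := hi (b i))\<rparr>)" for s R
    by (rule runs_RLoad) (use that(2) at_boxD[OF that(1)] i nw in \<open>simp_all add: small_lit\<close>)
  have select: "runs w (If (Conj (Neg (RLess 2 0)) (Neg (RLess 1 3))) Skip (Set 4 (Lit i))) s R"
    if "at_box z p y b s" "rreg s 2 = lo (b i)" "rreg s 3 = hi (b i)"
      "contained (b i) \<Longrightarrow> R s" "\<not> contained (b i) \<Longrightarrow> R (s\<lparr>wreg := (wreg s)(4 := i)\<rparr>)" for s R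
    by (intro runs_If runs_Set runs_Skip)
      (use that at_boxD[OF that(1)] i in \<open>simp_all add: small_lit contained_def not_less\<close>)
  have mark: "runs w (If (Conj (Neg (RLess 3 0)) (Neg (RLess 1 2))) Skip (Set 3 (Lit 1))) s R"
    if "at_box z p y b s" "rreg s 2 = lo (b i)" "rreg s 3 = hi (b i)"
      "\<not> disjoint (b i) \<Longrightarrow> R s" "disjoint (b i) \<Longrightarrow> R (s\<lparr>wreg := (wreg s)(3 := 1)\<rparr>)" for s R
    by (intro runs_If runs_Set runs_Skip)
      (use that at_boxD[OF that(1)] i in \<open>simp_all add: small_lit disjoint_def not_less not_le\<close>)
  show "runs w (block [
       RLoad 2 (Op Mul (Lit 2) (Reg (8 + 2 * i))),
       RLoad 3 (Op Add (Op Mul (Lit 2) (Reg (8 + 2 * i))) (Lit 1)),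
       If (Conj (Neg (RLess 2 0)) (Neg (RLess 1 3))) Skip (Set 4 (Lit i)),
       If (Conj (Neg (RLess 3 0)) (Neg (RLess 1 2))) Skip (Set 3 (Lit 1))]) s
     (\<lambda>s. at_box z p y b s \<and> wreg s 3 = of_bool (D \<or> (\<exists>j<Suc i. disjoint (b j)))
      \<and> wreg s 4 = pick (\<lambda>i. \<not> contained (b i)) (Suc i) k)"
    by (intro runs_block_Cons runs_block_Nil load load' select mark)
      (use I in \<open>auto simp: at_box_def ready_def less_Suc_eq of_bool_def\<close>)
qed (use assms in auto)

text \<open>The loop for leaves precedes the loop for ranges, and later writes to register 4 win.
  This realises the nested \<open>pick\<close> in \<open>split\<close>.\<close>

lemma runs_check:
  assumes "at_box z p y b s" "b \<in> boxes"
  shows "runs w (check_com d n :: 'a com) s (\<lambda>s'. at_box z p y b s' \<and> wreg s' 3 = of_bool (dead b) \<and> wreg s' 4 = split b)"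
  unfolding check_com_def
  apply (intro runs_block_Cons runs_block_Nil runs_Set)
  apply (rule runs_mono[OF runs_check_pointers[of z p y b]])
  using assms(1) apply (simp_all add: small_lit)[3]
  apply (intro runs_block_Cons)
  apply (rule runs_mono[OF runs_check_leaves[of z p y b]])
  apply (blast+)[3]
  apply (intro runs_block_Cons)
  apply (rule runs_mono[OF runs_check_ranges[of z p y b _ "\<exists>j<n. ptr j b = 0"]])
  apply (simp_all add: assms(2))[4]
  apply (rule runs_block_Nil)
  using null_ptr[OF assms(2)] by (simp add: dead_def split_def)

lemma box_at_le: "box_at h b \<Longrightarrow> h \<le> d * L"
  using sum_bounded_above[of "{..<d}" "\<lambda>i. height L (b i)" L] height_le by (auto simp: box_at_def)

lemma leaves_word: "h \<le> d * L \<Longrightarrow> 2 ^ h < (2 :: nat) ^ w"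
  using words(1) by (intro power_strict_increasing) auto

lemma runs_step:
  assumes s: "at_box z (2 ^ Suc h) y b s" "wreg s 4 = split b"
    and b: "box_at (Suc h) b" "\<not> dead b" and y: "y < 2 ^ Suc h"
  shows "runs w (step_com d n :: 'a com) s (at_box z (2 ^ h) (y mod 2 ^ h) (child b (split b) (y div 2 ^ h)))"
proof -
  define side where "side = y div 2 ^ h"
  define b' where "b' = child b (split b) side"
  have side: "side < 2" using y by (simp add: side_def less_mult_imp_div_less)
  note sv = split_valid[OF b]
  have boxes: "b \<in> boxes" using b by (simp add: box_at_def)
  have h: "2 ^ Suc h < (2::nat) ^ w" using box_at_le[OF b(1)] by (rule leaves_word)
  have h': "2 ^ h < (2::nat) ^ w" by (rule leaves_word) (use box_at_le[OF b(1)] in simp)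
  \<comment> \<open>The first \<open>k\<close> pointers and the first \<open>i\<close> coordinates
    have already moved to the child.\<close>
  let ?S = "\<lambda>k i s. ready s \<and> wreg s 0 = z \<and> wreg s 1 = 2 ^ h \<and> wreg s 2 = y mod 2 ^ h
    \<and> wreg s 4 = split b \<and> wreg s 6 = side
    \<and> (\<forall>j<n. wreg s (9 + 2 * j) = (if j < k then ptr j b' else ptr j b))
    \<and> (\<forall>j<d. wreg s (8 + 2 * j) = (if j < i then b' j else b j))"
  have pointers: "runs w (for_loop n (\<lambda>j. Load (9 + 2 * j)
      (Op Add (Op Add (Reg (9 + 2 * j)) (Op Mul (Lit 2) (Reg 4))) (Reg 6)))) s (?S n 0)"
    if "?S 0 0 s" for s
  proof (rule runs_for_loop[where I = "\<lambda>k. ?S k 0"])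
    fix j s assume j: "j < n" and S: "?S j 0 s"
    \<comment> \<open>The null pointer is never followed, since the box would be dead.\<close>
    have "ptr j b \<noteq> 0" using b(2) null_ptr[OF boxes] j by (auto simp: dead_def)
    note cp = child_ptr[OF boxes j this sv(1,2) side]
    let ?a = "Op Add (Op Add (Reg (9 + 2 * j)) (Op Mul (Lit 2) (Reg 4))) (Reg 6)"
    have r: "wreg s (9 + 2 * j) = ptr j b" "wreg s 4 = split b" "wreg s 6 = side"
      using S j by auto
    have "wval w s ?a = ptr j b + 2 * split b + side"
      using cp length_wm(2) by (simp add: r small_lit)
    then show "runs w (Load (9 + 2 * j) ?a) s (?S (Suc j) 0)"
      using cp S j by (intro runs_Load) (auto simp: ready_def b'_def less_Suc_eq)
  qed (use that in auto)
  have coordinates: "runs w (for_loop d (\<lambda>i. If (Conj (Neg (Less (Reg 4) (Lit i))) (Neg (Less (Lit i) (Reg 4))))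
       (Set (8 + 2 * i) (Op Add (Op Mul (Lit 2) (Reg (8 + 2 * i))) (Reg 6))) Skip)) s (?S n d)"
    if "?S n 0 s" for s
  proof (rule runs_for_loop[where I = "?S n"])
    fix i s assume i: "i < d" and S: "?S n i s"
    have r: "wreg s (8 + 2 * i) = b i" "wreg s 4 = split b" "wreg s 6 = side"
      using S i by auto
    have eq: "2 * b i + side = b' i" if "split b = i" using that by (simp add: b'_def child_def)
    have ne: "b i = b' i" if "split b \<noteq> i" using that by (simp add: b'_def child_def)
    have "b i < 2 ^ L" if "split b = i" using that sv by simp
    then have "2 * b i + side < 2 ^ w" if "split b = i" using that side rm(2) by fastforce
    then have v: "wval w s (Op Add (Op Mul (Lit 2) (Reg (8 + 2 * i))) (Reg 6)) = b' i" if "split b = i"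
      using that eq by (simp add: r small_lit)
    show "runs w (If (Conj (Neg (Less (Reg 4) (Lit i))) (Neg (Less (Lit i) (Reg 4))))
       (Set (8 + 2 * i) (Op Add (Op Mul (Lit 2) (Reg (8 + 2 * i))) (Reg 6))) Skip) s (?S n (Suc i))"
    proof (rule runs_If)
      assume "gval w s (Conj (Neg (Less (Reg 4) (Lit i))) (Neg (Less (Lit i) (Reg 4))))"
      then have "split b = i" using i by (simp add: r small_lit)
      from v[OF this] show "runs w (Set (8 + 2 * i) (Op Add (Op Mul (Lit 2) (Reg (8 + 2 * i))) (Reg 6))) s (?S n (Suc i))"
        using S i by (intro runs_Set) (simp del: wval.simps, auto simp: ready_def less_Suc_eq)
    next
      assume "\<not> gval w s (Conj (Neg (Less (Reg 4) (Lit i))) (Neg (Less (Lit i) (Reg 4))))"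
      then have "split b \<noteq> i" using i by (auto simp: r small_lit)
      then show "runs w Skip s (?S n (Suc i))"
        using S ne i by (intro runs_Skip) (auto simp: less_Suc_eq)
    qed
  qed (use that in auto)
  have final: "at_box z (2 ^ h) (y mod 2 ^ h) b' s" if "?S n d s" for s
    using that by (auto simp: at_box_def)
  note D = at_boxD[OF s(1)]
  have "y mod 2 ^ h < 2 ^ w" using h' by (meson mod_less_divisor order.strict_trans zero_less_numeral zero_less_power)
  moreover have "side mod 2 ^ w = side" using side w_two by simp
  ultimately have start: "?S 0 0 (s\<lparr>wreg := (wreg s)(1 := 2 ^ h, 6 := side, 2 := y mod 2 ^ h)\<rparr>)"
    using D s(2) by (auto simp: ready_def side_def)
  show ?thesis
    unfolding step_com_def b'_def[symmetric] side_def[symmetric]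
    apply (intro runs_block_Cons runs_Set)
    apply (rule runs_mono[OF pointers])
    subgoal using start D h h' \<open>side mod 2 ^ w = side\<close> \<open>y mod 2 ^ h < 2 ^ w\<close>
      by (simp add: side_def[symmetric] small_lit)
    apply (rule runs_block_Cons)
    apply (rule runs_mono[OF coordinates], assumption)
    apply (rule runs_block_Nil)
    apply (rule final)
    apply assumption
    done
qed

lemma runs_reset:
  assumes "ready s" "wreg s 0 = z" "z < 2 ^ (d * L)"
  shows "runs w (reset_com d n :: 'a com) s (\<lambda>s. at_box z (2 ^ (d * L)) z root s \<and> wreg s 3 = of_bool (dead root) \<and> wreg s 4 = split root)"
proof -
  let ?S = "\<lambda>i j s. ready s \<and> wreg s 0 = z \<and> wreg s 1 = 2 ^ (d * L) \<and> wreg s 2 = z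
    \<and> (\<forall>k<i. wreg s (8 + 2 * k) = 1) \<and> (\<forall>k<j. wreg s (9 + 2 * k) = ptr k root)"
  have coordinates: "runs w (for_loop d (\<lambda>i. Set (8 + 2 * i) (Lit 1))) s (?S d 0)" if "?S 0 0 s" for s
    by (rule runs_for_loop[where I = "\<lambda>i. ?S i 0"])
      (use that in \<open>auto intro!: runs_Set simp: ready_def less_Suc_eq small_lit\<close>)
  have pointers: "runs w (for_loop n (\<lambda>j. Load (9 + 2 * j) (Lit (2 + j)))) s (?S d n)" if "?S d 0 s" for s
  proof (rule runs_for_loop[where I = "?S d"])
    fix j s assume j: "j < n" and S: "?S d j s"
    have "wval w s (Lit (2 + j)) = 2 + j" "2 + j < length (wmem s)"
      using length_wm j S by (simp_all add: ready_def)
    then show "runs w (Load (9 + 2 * j) (Lit (2 + j))) s (?S d (Suc j))"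
      using S root_ptr[OF j] by (intro runs_Load) (auto simp: ready_def less_Suc_eq simp del: wval.simps)
  qed (use that in auto)
  have start: "?S 0 0 (s\<lparr>wreg := (wreg s)(1 := 2 ^ (d * L), 2 := z)\<rparr>)"
    using assms by (auto simp: ready_def)
  have final: "at_box z (2 ^ (d * L)) z root s" if "?S d n s" for s
    using that by (auto simp: at_box_def root_def)
  show ?thesis
    unfolding reset_com_def
    apply (intro runs_block_Cons runs_Set)
    apply (rule runs_mono[OF coordinates])
    subgoal using start assms by (simp add: ready_def)
    apply (rule runs_block_Cons)
    apply (rule runs_mono[OF pointers], assumption)
    apply (rule runs_block_Cons)
    apply (rule runs_mono[OF runs_check])
    apply (rule final, assumption)
    apply (rule root_boxes)
    apply (rule runs_block_Nil, assumption)
    done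
qed

text \<open>The specification of one descent: the bits of \<open>y\<close> lead to the terminal node
  above leaf \<open>y\<close> of the subtree.\<close>

fun descend :: "(nat \<Rightarrow> nat) \<Rightarrow> nat \<Rightarrow> nat \<Rightarrow> nat \<times> (nat \<Rightarrow> nat) option" where
  "descend b 0 y = (0, if dead b then None else Some b)"
| "descend b (Suc h) y = (if dead b then (Suc h, None)
     else descend (child b (split b) (y div 2 ^ h)) h (y mod 2 ^ h))"

lemma exec_descend:
  assumes "at_box z (2 ^ h) y b s" "wreg s 3 = of_bool (dead b)" "wreg s 4 = split b" "box_at h b" "y < 2 ^ h"
  shows "\<exists>m s' y' b'. m \<le> Suc (h * Suc (tick_bound (step_com d n :: 'a com) + tick_bound (check_com d n :: 'a com)))
    \<and> exec w (descend_com d n :: 'a com) s (replicate m Tick) s'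
    \<and> at_box z (2 ^ fst (descend b h y)) y' b' s'
    \<and> wreg s' 3 = of_bool (snd (descend b h y) = None)
    \<and> (snd (descend b h y) \<noteq> None \<longrightarrow> snd (descend b h y) = Some b') \<and> b' \<in> boxes"
  using assms
proof (induction h arbitrary: b y s)
  case 0
  have "\<not> gval w s (Conj (Less (Reg 3) (Lit 1)) (Less (Lit 1) (Reg 1)))"
    using at_boxD[OF 0(1)] by (simp add: small_lit)
  then have "exec w (descend_com d n) s [Tick] s" unfolding descend_com_def by (rule While_False)
  then show ?case
    using 0 by (intro exI[of _ 1] exI[of _ s] exI[of _ y] exI[of _ b]) (simp add: box_at_def)
next
  case (Suc h)
  show ?case
  proof (cases "dead b")
    case True
    then have "\<not> gval w s (Conj (Less (Reg 3) (Lit 1)) (Less (Lit 1) (Reg 1)))"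
      using Suc.prems by (simp add: small_lit)
    then have "exec w (descend_com d n) s [Tick] s" unfolding descend_com_def by (rule While_False)
    then show ?thesis
      using Suc.prems True by (intro exI[of _ 1] exI[of _ s] exI[of _ y] exI[of _ b]) (simp add: box_at_def)
  next
    case False
    let ?b = "child b (split b) (y div 2 ^ h)" and ?y = "y mod 2 ^ h"
    have side: "y div 2 ^ h < 2" using Suc.prems(5) by (simp add: less_mult_imp_div_less)
    have b: "box_at h ?b" by (rule box_at_split[OF Suc.prems(4) False side])
    then have boxes: "?b \<in> boxes" by (simp add: box_at_def)
    have g: "gval w s (Conj (Less (Reg 3) (Lit 1)) (Less (Lit 1) (Reg 1)))"
      using Suc.prems(2) at_boxD[OF Suc.prems(1)] False one_less_power[of "2 :: nat" "Suc h"]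
      by (simp add: small_lit)
    have "runs w (Seq (step_com d n) (check_com d n) :: 'a com) s
      (\<lambda>s'. at_box z (2 ^ h) ?y ?b s' \<and> wreg s' 3 = of_bool (dead ?b) \<and> wreg s' 4 = split ?b)"
      by (rule runs_Seq, rule runs_mono[OF runs_step[OF Suc.prems(1,3,4) False Suc.prems(5)]],
          rule runs_check[OF _ boxes])
    then obtain m1 s1 where 1: "m1 \<le> tick_bound (Seq (step_com d n) (check_com d n) :: 'a com)"
      "exec w (Seq (step_com d n) (check_com d n) :: 'a com) s (replicate m1 Tick) s1"
      "at_box z (2 ^ h) ?y ?b s1" "wreg s1 3 = of_bool (dead ?b)" "wreg s1 4 = split ?b"
      by (elim runsE) blast
    obtain m2 s2 y' b' where 2:
      "m2 \<le> Suc (h * Suc (tick_bound (step_com d n :: 'a com) + tick_bound (check_com d n :: 'a com)))"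
      "exec w (descend_com d n :: 'a com) s1 (replicate m2 Tick) s2"
      "at_box z (2 ^ fst (descend ?b h ?y)) y' b' s2"
      "wreg s2 3 = of_bool (snd (descend ?b h ?y) = None)"
      "snd (descend ?b h ?y) \<noteq> None \<longrightarrow> snd (descend ?b h ?y) = Some b'" "b' \<in> boxes"
      using Suc.IH[OF 1(3-5) b] by auto
    have "exec w (descend_com d n :: 'a com) s (Tick # replicate m1 Tick @ replicate m2 Tick) s2"
      using While_True[OF g 1(2)] 2(2) unfolding descend_com_def by blast
    then have "exec w (descend_com d n :: 'a com) s (replicate (Suc (m1 + m2)) Tick) s2"
      by (simp add: replicate_add)
    moreover have "Suc (m1 + m2) \<le> Suc (Suc h * Suc (tick_bound (step_com d n :: 'a com) + tick_bound (check_com d n :: 'a com)))"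
      using 1(1) 2(1) by simp
    ultimately show ?thesis
      using 2 False by (intro exI[of _ "Suc (m1 + m2)"] exI[of _ s2] exI[of _ y'] exI[of _ b']) simp
  qed
qed

lemma descend_leaf:
  "box_at h b \<Longrightarrow> y < 2 ^ h \<Longrightarrow> snd (descend b h y) = Some b' \<Longrightarrow> box_at 0 b'"
proof (induction h arbitrary: b y)
  case (Suc h)
  have "\<not> dead b" using Suc.prems(3) by auto
  then show ?case
    using Suc.IH[of "child b (split b) (y div 2 ^ h)" "y mod 2 ^ h"] Suc.prems
      box_at_split[OF Suc.prems(1), of "y div 2 ^ h"] by (simp add: less_mult_imp_div_less)
qed (auto split: if_splits)

lemma runs_fetch:
  assumes "at_box z p y b s" "b \<in> boxes"
  shows "runs w (fetch_com d :: 'a com) s (\<lambda>s. at_box z p y b s \<and> (\<forall>i<d. rreg s (4 + i) = lo (b i)))"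
  unfolding fetch_com_def
proof (rule runs_for_loop[where I = "\<lambda>i s. at_box z p y b s \<and> (\<forall>j<i. rreg s (4 + j) = lo (b j))"])
  fix i s assume i: "i < d" and I: "at_box z p y b s \<and> (\<forall>j<i. rreg s (4 + j) = lo (b j))"
  note nw = node_word[OF assms(2) i] and D = at_boxD[OF conjunct1[OF I]]
  show "runs w (RLoad (4 + i) (Op Mul (Lit 2) (Reg (8 + 2 * i)))) s
    (\<lambda>s. at_box z p y b s \<and> (\<forall>j<Suc i. rreg s (4 + j) = lo (b j)))"
    by (rule runs_RLoad) (use I D i nw in \<open>auto simp: small_lit less_Suc_eq\<close>)
qed (use assms in auto)

definition emission :: "(nat \<Rightarrow> nat) option \<Rightarrow> 'a event list" where
  "emission x = (case x of None \<Rightarrow> [] | Some b \<Rightarrow> [Emit (tup b)])"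

lemma exec_report:
  assumes "at_box z p y b s" "b \<in> boxes" "wreg s 3 = of_bool (x = None)" "x \<noteq> None \<longrightarrow> x = Some b"
    and leaf: "x \<noteq> None \<Longrightarrow> box_at 0 b"
  shows "\<exists>m s'. m \<le> 2 + tick_bound (fetch_com d :: 'a com) \<and>
    exec w (report_com as) s (replicate m Tick @ emission x) s' \<and> at_box z p y b s'"
proof (cases x)
  case None
  then have "\<not> gval w s (Less (Reg 3) (Lit 1))" using assms(3) by (simp add: small_lit)
  then have "exec w (report_com as) s [Tick, Tick] s"
    unfolding report_com_def by (rule If_False[OF _ exec.Skip])
  then show ?thesis
    using assms(1) None by (intro exI[of _ 2] exI[of _ s]) (simp add: emission_def numeral_2_eq_2)
next
  case (Some b')
  with assms(4) have x: "x = Some b" by simp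
  have g: "gval w s (Less (Reg 3) (Lit 1))" using assms(3) x by (simp add: small_lit)
  obtain m s' where 1: "m \<le> tick_bound (fetch_com d :: 'a com)"
    "exec w (fetch_com d :: 'a com) s (replicate m Tick) s'"
    "at_box z p y b s'" "\<forall>i<d. rreg s' (4 + i) = lo (b i)"
    using runs_fetch[OF assms(1,2)] by (elim runsE) blast
  have "lo (b i) = val (b i)" if "i < d" for i
    using box_at_0[OF leaf that] x by (simp add: lo_hi_leaf)
  then have "map_of (map (\<lambda>(X, i). (X, rreg s' i)) (map (\<lambda>i. (as ! i, 4 + i)) [0..<d])) = tup b"
    unfolding tup_def using 1(4) by (intro arg_cong[where f = map_of]) auto
  then have "exec w (Report (map (\<lambda>i. (as ! i, 4 + i)) [0..<d])) s' [Tick, Emit (tup b)] s'"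
    using exec.Report[of w "map (\<lambda>i. (as ! i, 4 + i)) [0..<d]" s'] by simp
  from If_True[OF g exec.Seq[OF 1(2) this]]
  have "exec w (report_com as) s (Tick # replicate m Tick @ [Tick, Emit (tup b)]) s'"
    unfolding report_com_def by blast
  then have "exec w (report_com as) s (replicate (Suc (Suc m)) Tick @ emission x) s'"
    by (simp add: x emission_def replicate_app_Cons_same)
  then show ?thesis using 1 by (intro exI[of _ "Suc (Suc m)"] exI[of _ s']) simp
qed

text \<open>\<open>k\<close> and \<open>m\<close> are the ticks before and after a possible output.
  The extra 1 in \<open>Suc (k + m)\<close> is reserved for the guard of the enclosing loop.\<close>

lemma exec_visit:
  assumes "ready s" "wreg s 0 = z" "z < 2 ^ (d * L)"
  defines "x \<equiv> descend root (d * L) z"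
  assumes in_range: "z + 2 ^ fst x \<le> 2 ^ (d * L)"
  shows "\<exists>k m s'. Suc (k + m) \<le> visit_cost as n * Suc (d * L) \<and>
    exec w (visit_com as n) s (replicate k Tick @ emission (snd x) @ replicate m Tick) s'
    \<and> ready s' \<and> wreg s' 0 = z + 2 ^ fst x"
proof -
  let ?c = "tick_bound (step_com d n :: 'a com) + tick_bound (check_com d n :: 'a com)"
  obtain m1 s1 where 1: "m1 \<le> tick_bound (reset_com d n :: 'a com)"
    "exec w (reset_com d n :: 'a com) s (replicate m1 Tick) s1"
    "at_box z (2 ^ (d * L)) z root s1" "wreg s1 3 = of_bool (dead root)" "wreg s1 4 = split root"
    using runs_reset[OF assms(1-3)] by (elim runsE) blast
  obtain m2 s2 y b where 2: "m2 \<le> Suc (d * L * Suc ?c)"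
    "exec w (descend_com d n :: 'a com) s1 (replicate m2 Tick) s2"
    "at_box z (2 ^ fst x) y b s2" "wreg s2 3 = of_bool (snd x = None)"
    "snd x \<noteq> None \<longrightarrow> snd x = Some b" "b \<in> boxes"
    using exec_descend[OF 1(3-5) box_at_root assms(3)] unfolding x_def by blast
  have "box_at 0 b" if "snd x \<noteq> None"
    using descend_leaf[OF box_at_root assms(3)] 2(5) that by (simp add: x_def)
  then obtain m3 s3 where 3: "m3 \<le> 2 + tick_bound (fetch_com d :: 'a com)"
    "exec w (report_com as) s2 (replicate m3 Tick @ emission (snd x)) s3" "at_box z (2 ^ fst x) y b s3"
    using exec_report[OF 2(3,6,4,5)] by blast
  define s4 where "s4 = s3\<lparr>wreg := (wreg s3)(0 := z + 2 ^ fst x)\<rparr>"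
  have "(z + 2 ^ fst x) mod 2 ^ w = z + 2 ^ fst x"
    by (rule mod_less[OF le_less_trans[OF in_range leaves_word]]) simp
  then have 4: "exec w (Set 0 (Op Add (Reg 0) (Reg 1)) :: 'a com) s3 [Tick] s4"
    using exec.Set[of w 0 "Op Add (Reg 0) (Reg 1)" s3] at_boxD[OF 3(3)] by (simp add: s4_def)
  have "exec w (visit_com as n) s (replicate m1 Tick @ replicate m2 Tick @ (replicate m3 Tick @ emission (snd x)) @ [Tick]) s4"
    unfolding visit_com_def by (rule exec.Seq[OF 1(2) exec.Seq[OF 2(2) exec.Seq[OF 3(2) 4]]])
  then have "exec w (visit_com as n) s (replicate (m1 + m2 + m3) Tick @ emission (snd x) @ replicate 1 Tick) s4"
    by (simp add: replicate_add)
  moreover have "ready s4" "wreg s4 0 = z + 2 ^ fst x"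
    using 3(3) by (auto simp: s4_def at_box_def ready_def)
  moreover have "Suc (m1 + m2 + m3 + 1) \<le> visit_cost as n * Suc (d * L)"
  proof -
    have "Suc (m1 + m2 + m3 + 1) \<le> tick_bound (reset_com d n :: 'a com) + tick_bound (fetch_com d :: 'a com) + 5 + d * L * Suc ?c"
      using 1(1) 2(1) 3(1) by simp
    also have "\<dots> \<le> visit_cost as n + d * L * visit_cost as n"
      by (intro add_mono mult_left_mono) (simp_all add: visit_cost_def)
    finally show ?thesis by (simp add: mult.commute)
  qed
  ultimately show ?thesis by blast
qed

fun walk :: "(nat \<Rightarrow> nat \<times> 'x) \<Rightarrow> nat \<Rightarrow> nat \<Rightarrow> (nat \<times> 'x) list \<Rightarrow> bool" where
  "walk f z e [] \<longleftrightarrow> z = e"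
| "walk f z e (x # xs) \<longleftrightarrow> z < e \<and> f z = x \<and> walk f (z + 2 ^ fst x) e xs"

lemma walk_le: "walk f z e xs \<Longrightarrow> z \<le> e"
  by (cases xs) auto

lemma walk_append: "walk f z m xs \<Longrightarrow> walk f m e ys \<Longrightarrow> walk f z e (xs @ ys)"
proof (induction xs arbitrary: z)
  case (Cons x xs)
  then show ?case using walk_le[of f m e ys] by auto
qed simp

text \<open>The stackless search meets the nodes of the recursive \<open>terminals\<close>: skipping
  the leaves below one terminal ends at the first leaf of the next. The offset \<open>c\<close>
  places a subtree in the global numbering; its second child starts at
  \<open>c + 2 ^ h\<close>.\<close>

lemma walk_terminals:
  "(\<And>y. y < 2 ^ h \<Longrightarrow> f (c + y) = descend b h y) \<Longrightarrow> walk f c (c + 2 ^ h) (terminals b h)"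
proof (induction h arbitrary: b c)
  case 0
  then show ?case using 0[of 0] by simp
next
  case (Suc h)
  show ?case
  proof (cases "dead b")
    case True
    then show ?thesis using Suc.prems[of 0] by simp
  next
    case False
    have "walk f c (c + 2 ^ h) (terminals (child b (split b) 0) h)"
      using Suc.prems False by (intro Suc.IH) simp
    moreover have "walk f (c + 2 ^ h) (c + 2 ^ h + 2 ^ h) (terminals (child b (split b) 1) h)"
    proof (rule Suc.IH)
      fix y :: nat assume y: "y < 2 ^ h"
      then have "(2 ^ h + y) div 2 ^ h = 1" "(2 ^ h + y) mod 2 ^ h = y" by simp_all
      then show "f (c + 2 ^ h + y) = descend (child b (split b) 1) h y"
        using Suc.prems[of "2 ^ h + y"] y False by (simp add: add.assoc)
    qed
    ultimately show ?thesis using walk_append False by (simp add: mult_2 add.assoc)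
  qed
qed

text \<open>After \<open>k\<close> fruitless visits at most \<open>K * Suc k\<close> ticks have
  passed since the last output; the additional \<open>K\<close> is the rest of the visit that
  reported. The beginning of the next reporting visit adds another \<open>K\<close>, whence
  \<open>F + 2\<close>.\<close>

lemma exec_search:
  assumes "walk (descend root (d * L)) z (2 ^ (d * L)) xs" "gaps_within F k (flags xs)" "ready s" "wreg s 0 = z"
  defines "K \<equiv> visit_cost as n * Suc (d * L)"
  shows "\<exists>tr s'. exec w (While (Less (Reg 0) (Reg 7)) (visit_com as n)) s tr s' \<and> ready s'
    \<and> reported tr = map tup (results xs)
    \<and> (\<forall>c. c \<le> K * Suc k \<longrightarrow> delays_within (real K * (F + 2)) c tr)"
  using assms(1-4)
proof (induction xs arbitrary: z k s)
  case Nil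
  have K: "1 \<le> K" by (simp add: K_def visit_cost_def)
  have "\<not> gval w s (Less (Reg 0) (Reg 7))" using Nil by (simp add: ready_def)
  from While_False[OF this]
  have "exec w (While (Less (Reg 0) (Reg 7)) (visit_com as n)) s [Tick] s" .
  moreover have "delays_within (real K * (F + 2)) c [Tick]" if "c \<le> K * Suc k" for c
  proof -
    have "real (Suc c) \<le> real (K * Suc k + K)" using that K by (intro of_nat_mono) linarith
    also have "\<dots> = real K * (real k + 2)" by (simp add: algebra_simps)
    also have "\<dots> \<le> real K * (F + 2)" using Nil(2) by (intro mult_left_mono) auto
    finally show ?thesis by simp
  qed
  ultimately show ?case using Nil by (intro exI[of _ "[Tick]"] exI[of _ s]) (simp del: mult_Suc_right)
next
  case (Cons x xs)
  then have z: "z < 2 ^ (d * L)" "descend root (d * L) z = x"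
    "walk (descend root (d * L)) (z + 2 ^ fst x) (2 ^ (d * L)) xs" by simp_all
  have g: "gval w s (Less (Reg 0) (Reg 7))" using Cons.prems z by (simp add: ready_def)
  obtain k' m s1 where 1: "Suc (k' + m) \<le> K"
    "exec w (visit_com as n) s (replicate k' Tick @ emission (snd x) @ replicate m Tick) s1"
    "ready s1" "wreg s1 0 = z + 2 ^ fst x"
    using exec_visit[OF Cons.prems(3,4) z(1)] walk_le[OF z(3)] unfolding z(2) K_def by blast
  define k1 where "k1 = (if snd x = None then Suc k else 0)"
  have "gaps_within F k1 (flags xs)" using Cons.prems(2) by (auto simp: k1_def split: if_splits)
  from Cons.IH[OF z(3) this 1(3,4)] obtain tr s2 where 2:
    "exec w (While (Less (Reg 0) (Reg 7)) (visit_com as n)) s1 tr s2" "ready s2"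
    "reported tr = map tup (results xs)"
    "\<And>c. c \<le> K * Suc k1 \<Longrightarrow> delays_within (real K * (F + 2)) c tr" by blast
  let ?tr = "Tick # (replicate k' Tick @ emission (snd x) @ replicate m Tick) @ tr"
  have "exec w (While (Less (Reg 0) (Reg 7)) (visit_com as n)) s ?tr s2"
    by (rule While_True[OF g 1(2) 2(1)])
  moreover have "reported ?tr = map tup (results (x # xs))"
    using 2(3) by (cases x; cases "snd x") (simp_all add: emission_def)
  moreover have "delays_within (real K * (F + 2)) c ?tr" if c: "c \<le> K * Suc k" for c
  proof (cases "snd x")
    case None
    have "Suc c + k' + m \<le> K * Suc k1" using c 1(1) None by (simp add: k1_def)
    then show ?thesis using 2(4) None by (simp add: emission_def)
  next
    case (Some b)
    have "real k \<le> F" using Cons.prems(2) Some by simp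
    have "real (Suc c + k') \<le> real (K * Suc k + K)" using c 1(1) by (intro of_nat_mono) linarith
    also have "\<dots> = real K * (real k + 2)" by (simp add: algebra_simps)
    also have "\<dots> \<le> real K * (F + 2)" using \<open>real k \<le> F\<close> by (intro mult_left_mono) auto
    finally have "real (Suc c + k') \<le> real K * (F + 2)" .
    moreover have "m \<le> K * Suc k1" using 1(1) Some by (simp add: k1_def)
    ultimately show ?thesis using 2(4) Some by (simp add: emission_def)
  qed
  ultimately show ?case using 2(2) by blast
qed

lemma exec_query:
  defines "D \<equiv> real (visit_cost as n * Suc (d * L)) * (real (2 * L + 1) ^ d * gap_full + 2)"
  shows "\<exists>tr s. exec w (query_com as n) (query_start \<lparr>wmem = wm, rmem = rm\<rparr> x1 x2) tr s
    \<and> mem.truncate s = \<lparr>wmem = wm, rmem = rm\<rparr> \<and> distinct (reported tr)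
    \<and> set (reported tr) = range_join Rs scheme rel x1 x2 \<and> has_delay D tr"
proof -
  define K where "K = visit_cost as n * Suc (d * L)"
  define F where "F = real (2 * L + 1) ^ d * gap_full"
  define s where "s = query_start \<lparr>wmem = wm, rmem = rm\<rparr> x1 x2"
  have s: "wmem s = wm" "rmem s = rm" "rreg s 0 = x1" "rreg s 1 = x2" "wreg s 0 = 0"
    by (simp_all add: s_def query_start_def mem.defs config.defs)
  have lens: "0 < length wm" "1 < length wm" using length_wm(1) by linarith+
  define s1 where "s1 = s\<lparr>wreg := (wreg s)(5 := 2 ^ L)\<rparr>"
  define s2 where "s2 = s1\<lparr>wreg := (wreg s1)(7 := 2 ^ (d * L))\<rparr>"
  have 1: "exec w (Load 5 (Lit 0) :: 'a com) s [Tick] s1"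
    using exec.Load[of w s "Lit 0" 5] lens s wm_sizes by (simp add: s1_def)
  have 2: "exec w (Load 7 (Lit 1) :: 'a com) s1 [Tick] s2"
    using exec.Load[of w s1 "Lit 1" 7] lens s wm_sizes by (simp add: s1_def s2_def small_lit)
  have r: "ready s2" "wreg s2 0 = 0" using s by (simp_all add: ready_def s1_def s2_def)
  have "walk (descend root (d * L)) 0 (2 ^ (d * L)) (terminals root (d * L))"
    using walk_terminals[of "d * L" "descend root (d * L)" 0 root] by simp
  moreover have "gaps_within F 0 (flags (terminals root (d * L)))"
    using calm_gaps_within[of F 0] root_gaps by (simp add: F_def)
  ultimately obtain tr s3 where 3: "exec w (While (Less (Reg 0) (Reg 7)) (visit_com as n)) s2 tr s3"
    "ready s3" "reported tr = map tup (results (terminals root (d * L)))"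
    "\<And>c. c \<le> K * Suc 0 \<Longrightarrow> delays_within (real K * (F + 2)) c tr"
    using exec_search[OF _ _ r] unfolding K_def by blast
  have "exec w (query_com as n) s ([Tick] @ [Tick] @ tr) s3"
    unfolding query_com_def by (rule exec.Seq[OF 1 exec.Seq[OF 2 3(1)]])
  moreover have "mem.truncate s3 = \<lparr>wmem = wm, rmem = rm\<rparr>"
    using 3(2) by (simp add: ready_def mem.defs)
  moreover have "has_delay D ([Tick] @ [Tick] @ tr)"
  proof (rule has_delayI)
    \<comment> \<open>The two initial loads fit into the budget \<open>K * Suc 0\<close> allowed
      before the loop.\<close>
    have "2 \<le> K" unfolding K_def visit_cost_def by simp
    then have "delays_within (real K * (F + 2)) 0 ([Tick] @ [Tick] @ tr)"
      using 3(4)[of 2] by (simp add: numeral_2_eq_2)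
    then show "delays_within D 0 ([Tick] @ [Tick] @ tr)" by (simp add: D_def K_def F_def)
  qed
  ultimately show ?thesis
    using 3(3) map_tup_results unfolding s_def by (intro exI[of _ "[Tick] @ [Tick] @ tr"] exI[of _ s3]) simp
qed

end

section \<open>The memory\<close>

context join_instance
begin

text \<open>
  Every relation is an automaton that reads the splits of the current box: its states are the
  nonempty projections of boxes. A further automaton, with index \<open>length rs\<close>, recognises the heavy
  boxes whose join is empty; it has a single state \<open>\<lambda>_. 0\<close> for all light boxes.
\<close>

definition state :: "'r list \<Rightarrow> nat \<Rightarrow> (nat \<Rightarrow> nat) \<Rightarrow> (nat \<times> (nat \<Rightarrow> nat)) option" where
  "state rs j b = (if j < length rs then (if cnt (rs ! j) b = 0 then None else Some (j, project (rs ! j) b))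
     else if heavy_empty b then None else Some (j, if agm b \<le> \<Delta> then \<lambda>_. 0 else b))"

definition states :: "'r list \<Rightarrow> (nat \<times> (nat \<Rightarrow> nat)) set" where
  "states rs = {v. \<exists>j\<le>length rs. \<exists>b\<in>boxes. state rs j b = Some v}"

lemma project_child:
  assumes "project r b = project r b'" "i < d"
  shows "project r (child b i s) = project r (child b' i s)"
proof
  fix j
  have "project r b j = project r b' j" using assms(1) by simp
  then have "b j = b' j" if "j < d \<and> as ! j \<in> scheme r" using that by (simp add: project_def)
  then show "project r (child b i s) j = project r (child b' i s) j"
    unfolding project_def child_def by auto
qed

lemma cnt_project:
  assumes "r \<in> Rs" "project r b = project r b'"
  shows "cnt r b = cnt r b'"
proof -
  have "b i = b' i" if "i < d" "as ! i \<in> scheme r" for i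
    using fun_cong[OF assms(2), of i] that by (simp add: project_def)
  then have "inside b t \<longleftrightarrow> inside b' t" if "t \<in> rel r" for t
    using dom_rel[OF assms(1) that] by (auto simp: inside_def)
  then show ?thesis unfolding cnt_def by (metis (lifting))
qed

text \<open>A state determines its successors, so the pointer structure is well defined. The
  projection determines the count of a relation; light boxes may share a state because halving does
  not increase the AGM bound; a heavy box is its own state.\<close>

lemma state_child:
  assumes "set rs = Rs" "j \<le> length rs" "j' \<le> length rs" "b \<in> boxes" "b' \<in> boxes"
    and eq: "state rs j b = Some v" "state rs j' b' = Some v"
    and i: "i < d" "b i < 2 ^ L" "b' i < 2 ^ L" "s < 2"
  shows "j = j' \<and> state rs j (child b i s) = state rs j' (child b' i s)"
proof -
  have j: "j' = j" using eq by (auto simp: state_def split: if_splits)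
  show ?thesis
  proof (cases "j < length rs")
    case True
    then have r: "rs ! j \<in> Rs" using assms(1) nth_mem by blast
    have "project (rs ! j) b = project (rs ! j) b'"
      using eq True by (auto simp: state_def j split: if_splits)
    then have pc: "project (rs ! j) (child b i s) = project (rs ! j) (child b' i s)"
      by (rule project_child[OF _ i(1)])
    show ?thesis
      using True by (simp add: state_def j pc cnt_project[OF r pc])
  next
    case False
    have b: "1 \<le> b i" "1 \<le> b' i" using assms(4,5) i(1) by (auto simp: boxes_def)
    \<comment> \<open>Coordinates of boxes are positive, so the light state is not confused with a
      heavy box.\<close>
    have nz: "(\<lambda>_. 0) \<noteq> b" "(\<lambda>_. 0) \<noteq> b'" using b by force+
    show ?thesis
    proof (cases "agm b \<le> \<Delta>")
      case True
      then have "agm b' \<le> \<Delta>" using eq False nz by (auto simp: state_def j split: if_splits)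
      then have "agm (child b i s) \<le> \<Delta>" "agm (child b' i s) \<le> \<Delta>"
        using True agm_child_le[of i b s, OF i(1) b(1) i(2,4)] agm_child_le[of i b' s, OF i(1) b(2) i(3,4)]
        by simp_all
      then show ?thesis using False by (simp add: state_def j heavy_empty_def)
    next
      case light: False
      then have "b' = b" using eq False nz by (auto simp: state_def j split: if_splits)
      then show ?thesis by (simp add: j)
    qed
  qed
qed

lemma card_states:
  assumes "distinct rs" "set rs = Rs"
  shows "finite (states rs)"
    and "real (card (states rs)) \<le> 2 * (1 + real (input_size Rs rel)
      + real (input_size Rs rel) powr (\<Sum>e\<in>scheme ` Rs. W e) / \<Delta>) * real (Suc L ^ d)"
proof -
  define N where "N = real (input_size Rs rel)"
  define A where "A = N powr (\<Sum>e\<in>scheme ` Rs. W e)"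
  define P where "P r = {project r b |b. b \<in> boxes \<and> cnt r b \<noteq> 0}" for r
  define T where "T = (\<Union>j<length rs. Pair j ` P (rs ! j)) \<union> {(length rs, \<lambda>_. 0)} \<union> Pair (length rs) ` heavy"
  have "P r \<subseteq> project r ` boxes" for r by (auto simp: P_def)
  then have finP: "finite (P r)" for r using finite_boxes finite_subset by blast
  have finh: "finite heavy" using finite_boxes by (simp add: heavy_def)
  have finT: "finite T" using finP finh by (simp add: T_def)
  have sub: "states rs \<subseteq> T"
  proof
    fix v assume "v \<in> states rs"
    then obtain j b where jb: "j \<le> length rs" "b \<in> boxes" "state rs j b = Some v" by (auto simp: states_def)
    show "v \<in> T"
    proof (cases "j < length rs")
      case True
      then show ?thesis using jb by (auto simp: state_def T_def P_def split: if_splits)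
    next
      case False
      then show ?thesis using jb by (auto simp: state_def T_def heavy_def split: if_splits)
    qed
  qed
  then show "finite (states rs)" using finT finite_subset by blast
  have "card (\<Union>j<length rs. Pair j ` P (rs ! j)) \<le> (\<Sum>j<length rs. card (Pair j ` P (rs ! j)))"
    by (rule card_UN_le) simp
  also have "\<dots> \<le> (\<Sum>j<length rs. card (rel (rs ! j)) * Suc L ^ d)"
  proof (rule sum_mono)
    fix j assume "j \<in> {..<length rs}"
    then have "rs ! j \<in> Rs" using assms(2) nth_mem by blast
    have "card (Pair j ` P (rs ! j)) \<le> card (P (rs ! j))" by (rule card_image_le[OF finP])
    also have "\<dots> \<le> card (rel (rs ! j)) * Suc L ^ d"
      unfolding P_def by (rule card_projections[OF \<open>rs ! j \<in> Rs\<close>])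
    finally show "card (Pair j ` P (rs ! j)) \<le> card (rel (rs ! j)) * Suc L ^ d" .
  qed
  also have "\<dots> = (\<Sum>r\<leftarrow>rs. card (rel r)) * Suc L ^ d"
    by (simp add: sum_distrib_right sum_list_sum_nth atLeast0LessThan)
  also have "(\<Sum>r\<leftarrow>rs. card (rel r)) = input_size Rs rel"
    using assms by (simp add: sum_list_distinct_conv_sum_set input_size_def)
  finally have relations: "card (\<Union>j<length rs. Pair j ` P (rs ! j)) \<le> input_size Rs rel * Suc L ^ d" .
  have "card (states rs) \<le> card T" using sub finT by (rule card_mono[rotated])
  also have "\<dots> \<le> card (\<Union>j<length rs. Pair j ` P (rs ! j)) + 1 + card heavy"
    unfolding T_def using card_image_le[OF finh, of "Pair (length rs)"]
    by (intro order.trans[OF card_Un_le] add_mono) auto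
  finally have "real (card (states rs)) \<le> N * real (Suc L ^ d) + 1 + real (card heavy)"
    using relations unfolding N_def of_nat_mult[symmetric] by linarith
  also have "real (card heavy) \<le> real (Suc L ^ d) * (1 + A / \<Delta>)"
  proof -
    have "real (card heavy) * \<Delta> \<le> real (Suc L ^ d) * agm root" by (rule card_heavy)
    also have "\<dots> \<le> real (Suc L ^ d) * (1 + A)"
      using agm_le[of root] by (intro mult_left_mono) (simp_all add: A_def N_def)
    finally have "real (card heavy) \<le> real (Suc L ^ d) * (1 + A) / \<Delta>"
      using Delta by (simp add: pos_le_divide_eq)
    also have "\<dots> = real (Suc L ^ d) * ((1 + A) / \<Delta>)" by simp
    also have "\<dots> \<le> real (Suc L ^ d) * (1 + A / \<Delta>)"
      using Delta by (intro mult_left_mono) (simp_all add: add_divide_distrib divide_le_eq)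
    finally show ?thesis .
  qed
  finally have le: "real (card (states rs)) \<le> N * real (Suc L ^ d) + 1 + real (Suc L ^ d) * (1 + A / \<Delta>)" by simp
  define K where "K = real (Suc L ^ d)"
  have "1 \<le> K" by (simp add: K_def)
  moreover have "0 \<le> K * N" "0 \<le> K * (A / \<Delta>)"
    using Delta by (simp_all add: N_def A_def K_def)
  moreover have "real (card (states rs)) \<le> K * N + 1 + (K + K * (A / \<Delta>))"
    using le unfolding K_def[symmetric] by (simp add: algebra_simps)
  moreover have "2 * (1 + N + A / \<Delta>) * K = 2 * K + 2 * (K * N) + 2 * (K * (A / \<Delta>))"
    by (simp add: algebra_simps)
  ultimately have "real (card (states rs)) \<le> 2 * (1 + N + A / \<Delta>) * K" by linarith
  then show "real (card (states rs)) \<le> 2 * (1 + real (input_size Rs rel)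
      + real (input_size Rs rel) powr (\<Sum>e\<in>scheme ` Rs. W e) / \<Delta>) * real (Suc L ^ d)"
    by (simp only: N_def A_def K_def)
qed

text \<open>The layout consists of two constants, \<open>Suc (length rs)\<close> root pointers and a
  row of \<open>2 * d\<close> cells for each state. Rows start above address 0, which is free to be
  the null pointer.\<close>

lemma search_memory_exists:
  assumes rs: "distinct rs" "set rs = Rs"
    and w: "3 + length rs + 2 * d * card (states rs) < 2 ^ w" "4 * 2 ^ L \<le> (2 :: nat) ^ w" "d * L < w" "d < 2 ^ w"
  shows "\<exists>ptr wm rm. search_memory Rs scheme rel as L val code W \<Delta> w (Suc (length rs)) ptr wm rm
    \<and> length wm = 3 + length rs + 2 * d * card (states rs) \<and> length rm = 4 * 2 ^ L \<and> (\<forall>x\<in>set wm. x < 2 ^ w)"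
proof -
  let ?n = "Suc (length rs)" and ?S = "states rs"
  obtain idx where idx: "bij_betw idx ?S {0..<card ?S}"
    using ex_bij_betw_finite_nat[OF card_states(1)[OF rs]] by blast
  define addr where "addr x = (case x of None \<Rightarrow> 0 | Some v \<Rightarrow> 3 + length rs + 2 * d * idx v)" for x
  define ptr where "ptr j b = addr (state rs j b)" for j b
  \<comment> \<open>Several boxes may lead to the same state, so a cell is defined by choice, with 0
    where there is no transition; \<open>state_child\<close> makes the choice unique.\<close>
  define next_ptr where "next_ptr v i s p \<longleftrightarrow>
    (\<exists>j\<le>length rs. \<exists>b\<in>boxes. b i < 2 ^ L \<and> state rs j b = Some v \<and> p = ptr j (child b i s))" for v i s p
  define cell where "cell v i s = (if \<exists>p. next_ptr v i s p then SOME p. next_ptr v i s p else 0)" for v i s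
  define cells where "cells k = cell (the_inv_into ?S idx (k div (2 * d))) (k mod (2 * d) div 2) (k mod 2)" for k
  define wm where "wm = [2 ^ L, 2 ^ (d * L)] @ map (\<lambda>j. ptr j root) [0..<?n] @ map cells [0..<2 * d * card ?S]"
  define rm where "rm = map (\<lambda>k. if even k then lo (k div 2) else hi (k div 2)) [0..<4 * 2 ^ L]"
  have len: "length wm = 3 + length rs + 2 * d * card ?S" by (simp add: wm_def)
  have idx_less: "idx v < card ?S" if "v \<in> ?S" for v
    using bij_betwE[OF idx] that by auto
  have mem_states: "v \<in> ?S" if "state rs j b = Some v" "j \<le> length rs" "b \<in> boxes" for v j b
    using that by (auto simp: states_def)
  have ptr_bound: "ptr j b \<le> 3 + length rs + 2 * d * card ?S" if "j \<le> length rs" "b \<in> boxes" for j b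
    using idx_less[OF mem_states[OF _ that]]
    by (auto simp: ptr_def addr_def less_imp_le split: option.split)
  have cell_bound: "cell v i s \<le> 3 + length rs + 2 * d * card ?S" if "i < d" "s < 2" for v i s
  proof (cases "\<exists>p. next_ptr v i s p")
    case True
    then have "next_ptr v i s (cell v i s)" by (simp add: cell_def someI_ex)
    then obtain j b where "j \<le> length rs" "b \<in> boxes" "b i < 2 ^ L" "cell v i s = ptr j (child b i s)"
      by (auto simp: next_ptr_def)
    then show ?thesis using ptr_bound child_boxes that by simp
  qed (simp add: cell_def)
  have next_unique: "cell v i s = ptr j (child b i s)"
    if "j \<le> length rs" "b \<in> boxes" "b i < 2 ^ L" "state rs j b = Some v" "i < d" "s < 2" for v i s j b
  proof -
    have "next_ptr v i s (ptr j (child b i s))" using that by (auto simp: next_ptr_def)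
    then have "next_ptr v i s (cell v i s)" by (auto simp: cell_def intro: someI)
    then obtain j' b' where b': "j' \<le> length rs" "b' \<in> boxes" "b' i < 2 ^ L" "state rs j' b' = Some v"
      "cell v i s = ptr j' (child b' i s)" by (auto simp: next_ptr_def)
    have "state rs j' (child b' i s) = state rs j (child b i s)"
      by (rule sym[OF conjunct2[OF state_child[OF rs(2) that(1) b'(1) that(2) b'(2) that(4) b'(4) that(5,3) b'(3) that(6)]]])
    then show ?thesis unfolding b'(5) ptr_def by simp
  qed
  have cells_nth: "cells (2 * d * idx v + 2 * i + s) = cell v i s" "2 * d * idx v + 2 * i + s < 2 * d * card ?S"
    if "v \<in> ?S" "i < d" "s < 2" for v i s
  proof -
    have less: "2 * i + s < 2 * d" using that by simp
    have divmod: "(D * p + x) div D = p" "(D * p + x) mod D = x" if "x < D" for D p x :: nat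
      using that by (cases "D = 0"; simp)+
    note divmod[OF less, of "idx v"]
    moreover have "(2 * i + s) div 2 = i" using that(3) by simp
    moreover have "(2 * d * idx v + (2 * i + s)) mod 2 = s"
    proof -
      have "2 * d * idx v + (2 * i + s) = s + 2 * (d * idx v + i)" by simp
      then show ?thesis using that(3) by (simp only: mod_mult_self2) simp
    qed
    moreover have "the_inv_into ?S idx (idx v) = v"
      using idx that(1) by (auto simp: bij_betw_def intro: the_inv_into_f_f)
    ultimately show "cells (2 * d * idx v + 2 * i + s) = cell v i s"
      unfolding cells_def add.assoc by simp
    have "2 * d * Suc (idx v) \<le> 2 * d * card ?S" using idx_less[OF that(1)] by (intro mult_le_mono) auto
    then show "2 * d * idx v + 2 * i + s < 2 * d * card ?S" using less by simp
  qed
  have "search_memory Rs scheme rel as L val code W \<Delta> w ?n ptr wm rm"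
  proof unfold_locales
    fix b assume b: "b \<in> boxes"
    have "ptr j b = 0 \<longleftrightarrow> cnt (rs ! j) b = 0" if "j < length rs" for j
      using that by (simp add: ptr_def addr_def state_def)
    moreover have "ptr (length rs) b = 0 \<longleftrightarrow> heavy_empty b"
      by (simp add: ptr_def addr_def state_def)
    moreover have "r \<in> Rs \<longleftrightarrow> (\<exists>j<length rs. rs ! j = r)" for r
      using rs(2) by (auto simp: in_set_conv_nth)
    then have "has_empty b \<longleftrightarrow> (\<exists>j<length rs. cnt (rs ! j) b = 0)"
      by (auto simp: has_empty_def)
    ultimately show "(\<exists>j<?n. ptr j b = 0) \<longleftrightarrow> has_empty b \<or> heavy_empty b"
      by (auto simp: less_Suc_eq)
  next
    fix b j i s assume a: "b \<in> boxes" "j < ?n" "ptr j b \<noteq> 0" "i < d" "b i < 2 ^ L" "s < (2 :: nat)"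
    then obtain v where v: "state rs j b = Some v" by (auto simp: ptr_def addr_def split: option.splits)
    have vS: "v \<in> ?S" using mem_states[OF v] a by simp
    have "ptr j b + 2 * i + s = ?n + 2 + (2 * d * idx v + 2 * i + s)" by (simp add: ptr_def addr_def v)
    moreover have "wm ! (?n + 2 + k) = cells k" "?n + 2 + k < length wm" if "k < 2 * d * card ?S" for k
      using that len by (simp_all add: wm_def nth_append)
    note this[OF cells_nth(2)[OF vS a(4,6)]]
    moreover have "cell v i s = ptr j (child b i s)"
      using next_unique[OF _ a(1,5) v a(4,6)] a(2) by simp
    ultimately show "ptr j b + 2 * i + s < length wm \<and> wm ! (ptr j b + 2 * i + s) = ptr j (child b i s)"
      using cells_nth(1)[OF vS a(4,6)] by (simp only:)
  next
    fix j assume "j < ?n"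
    then show "wm ! (2 + j) = ptr j root" by (simp add: wm_def nth_append del: upt_Suc)
  next
    fix u :: nat assume "1 \<le> u" "u < 2 ^ Suc L"
    then show "rm ! (2 * u) = lo u" "rm ! Suc (2 * u) = hi u" by (simp_all add: rm_def)
  qed (use w len in \<open>simp_all add: wm_def rm_def del: upt_Suc\<close>)
  moreover have "x < 2 ^ w" if x: "x \<in> set wm" for x
  proof -
    consider "x = 2 ^ L" | "x = 2 ^ (d * L)" | j where "j \<le> length rs" "x = ptr j root"
      | k where "k < 2 * d * card ?S" "x = cells k"
      using x by (auto simp: wm_def less_Suc_eq_le simp del: upt_Suc)
    then show ?thesis
    proof cases
      case 1
      have "(0::nat) < 2 ^ L" by simp
      then show ?thesis using w(2) 1 by linarith
    next
      case 2
      then show ?thesis using w(3) by simp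
    next
      case (3 j)
      then show ?thesis using ptr_bound[OF _ root_boxes, of j] w(1) by simp
    next
      case (4 k)
      then have "0 < d" by (cases "d = 0") auto
      then have "k mod (2 * d) < 2 * d" by simp
      then have "k mod (2 * d) div 2 < d" by linarith
      then show ?thesis using 4 cell_bound[of "k mod (2 * d) div 2" "k mod 2"] w(1)
        unfolding cells_def by (meson le_less_trans mod_less_divisor zero_less_numeral)
    qed
  qed
  ultimately show ?thesis using len by (intro exI[of _ ptr] exI[of _ wm] exI[of _ rm]) (simp add: rm_def)
qed

lemma range_join_structure_query:
  assumes "distinct rs" "set rs = Rs"
    and "3 + length rs + 2 * d * card (states rs) < 2 ^ w" "4 * 2 ^ L \<le> (2 :: nat) ^ w" "d * L < w" "d < 2 ^ w"
    and S: "real (3 + length rs + 2 * d * card (states rs) + 4 * 2 ^ L) \<le> S"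
    and D: "real (visit_cost as (Suc (length rs)) * Suc (d * L))
      * (real (2 * L + 1) ^ d * (2 * real (d * L + 1) * (1 + real (d * L) * \<Delta>)) + 2) \<le> D"
  shows "\<exists>Ms. range_join_structure w (query_com as (Suc (length rs))) Rs scheme rel S D Ms"
proof -
  obtain ptr wm rm where mem: "search_memory Rs scheme rel as L val code W \<Delta> w (Suc (length rs)) ptr wm rm"
    and len: "length wm = 3 + length rs + 2 * d * card (states rs)" "length rm = 4 * 2 ^ L"
    and word: "\<forall>x\<in>set wm. x < 2 ^ w"
    using search_memory_exists[OF assms(1-6)] by blast
  define m where "m = \<lparr>wmem = wm, rmem = rm\<rparr>"
  have "\<exists>tr s. exec w (query_com as (Suc (length rs))) (query_start m x1 x2) tr s \<and> mem.truncate s = m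
    \<and> distinct (reported tr) \<and> set (reported tr) = range_join Rs scheme rel x1 x2 \<and> has_delay D tr" for x1 x2
  proof -
    interpret search_memory Rs scheme rel as L val code W \<Delta> w "Suc (length rs)" ptr wm rm by (rule mem)
    interpret query_run Rs scheme rel as L val code W \<Delta> w "Suc (length rs)" ptr wm rm x1 x2 by unfold_locales
    show ?thesis
      using exec_query D unfolding m_def gap_full_def has_delay_def by (meson order.trans)
  qed
  moreover have "valid_mem w S m"
    using S len word by (simp add: valid_mem_def m_def)
  ultimately show ?thesis
    \<comment> \<open>A query restores the memory exactly, so a singleton is closed under
      queries.\<close>
    unfolding range_join_structure_def by (intro exI[of _ "{m}"]) auto
qed

end

section \<open>Choice of the parameters\<close>

lemma space_bound:
  fixes l N X \<kappa> :: real and d L S m :: nat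
  assumes l: "1 \<le> l" and N: "0 \<le> N" and X: "0 \<le> X" and S: "real S \<le> 2 * (1 + N + X) * real (Suc L ^ d)"
    and L: "real (Suc L) \<le> \<kappa> * l" "(2::real) ^ L \<le> 2 ^ d * (2 * (N + 2))"
  shows "real (3 + m + 2 * d * S + 4 * 2 ^ L) \<le> (3 + real m + 4 * real d * \<kappa> ^ d + 16 * 2 ^ d) * (1 + N + X) * l ^ d"
proof -
  define Y where "Y = (1 + N + X) * l ^ d"
  have ld: "1 \<le> l ^ d" using l by simp
  have Y: "1 + N + X \<le> Y" using ld N X mult_left_mono[of 1 "l ^ d" "1 + N + X"] by (simp add: Y_def)
  then have Y1: "1 \<le> Y" using N X by linarith
  have "real (Suc L ^ d) \<le> (\<kappa> * l) ^ d" unfolding of_nat_power by (intro power_mono L) simp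
  then have "2 * (1 + N + X) * real (Suc L ^ d) \<le> 2 * (1 + N + X) * (\<kappa> * l) ^ d"
    using N X by (intro mult_left_mono) auto
  also have "\<dots> = 2 * \<kappa> ^ d * Y" by (simp add: Y_def power_mult_distrib)
  finally have S': "real S \<le> 2 * \<kappa> ^ d * Y" using S by linarith
  have "2 * real d * real S \<le> 2 * real d * (2 * \<kappa> ^ d * Y)" using S' by (intro mult_left_mono) auto
  then have 2: "2 * real d * real S \<le> 4 * real d * \<kappa> ^ d * Y" by simp
  have "N + 2 \<le> 2 * Y" using Y N X by linarith
  then have "2 ^ d * (2 * (N + 2)) \<le> 2 ^ d * (2 * (2 * Y))" by (intro mult_left_mono) auto
  then have 3: "4 * (2::real) ^ L \<le> 16 * 2 ^ d * Y" using L(2) by linarith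
  have 1: "3 + real m \<le> (3 + real m) * Y" using Y1 mult_left_mono[of 1 Y "3 + real m"] by simp
  have "real (3 + m + 2 * d * S + 4 * 2 ^ L) = 3 + real m + 2 * real d * real S + 4 * 2 ^ L" by simp
  also have "\<dots> \<le> (3 + real m) * Y + 4 * real d * \<kappa> ^ d * Y + 16 * 2 ^ d * Y" using 1 2 3 by linarith
  also have "\<dots> = (3 + real m + 4 * real d * \<kappa> ^ d + 16 * 2 ^ d) * (1 + N + X) * l ^ d"
    by (simp add: Y_def distrib_right mult.assoc)
  finally show ?thesis .
qed

text \<open>The exponent \<open>d + 3\<close> collects \<open>d\<close> factors from coordinates
  that stick out of the query, two from the gaps in full boxes and one from the length of a
  descent.\<close>

lemma delay_bound:
  fixes l \<Delta> \<kappa> :: real and d L V :: nat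
  assumes l: "1 \<le> l" and Delta: "1 \<le> \<Delta>" and L: "real (Suc L) \<le> \<kappa> * l"
  defines "\<mu> \<equiv> (real d + 1) * \<kappa>"
  shows "real (V * Suc (d * L)) * (real (2 * L + 1) ^ d * (2 * real (d * L + 1) * (1 + real (d * L) * \<Delta>)) + 2)
    \<le> (real V * \<mu> * ((2 * \<kappa>) ^ d * (2 * \<mu> * \<mu>) + 2)) * \<Delta> * l ^ (d + 3)"
proof -
  have H: "real (d * L + 1) \<le> \<mu> * l"
  proof -
    have "real (d * L + 1) \<le> (real d + 1) * real (Suc L)" by (simp add: algebra_simps)
    also have "\<dots> \<le> (real d + 1) * (\<kappa> * l)" using L by (intro mult_left_mono) auto
    finally show ?thesis by (simp add: \<mu>_def)
  qed
  have \<kappa>: "0 < \<kappa>" using L l by (metis less_le_trans of_nat_0_less_iff zero_less_Suc zero_less_mult_pos2 zero_less_one)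
  then have \<mu>: "0 < \<mu>" by (simp add: \<mu>_def)
  have G: "real (2 * L + 1) ^ d \<le> (2 * \<kappa> * l) ^ d"
    using L by (intro power_mono) auto
  have E: "1 + real (d * L) * \<Delta> \<le> \<mu> * l * \<Delta>"
  proof -
    have "1 + real (d * L) * \<Delta> \<le> real (d * L + 1) * \<Delta>" using Delta by (simp add: distrib_right)
    also have "\<dots> \<le> \<mu> * l * \<Delta>" using H Delta by (intro mult_right_mono) auto
    finally show ?thesis .
  qed
  have "2 * real (d * L + 1) * (1 + real (d * L) * \<Delta>) \<le> 2 * (\<mu> * l) * (\<mu> * l * \<Delta>)"
    using H E \<mu> l Delta by (intro mult_mono) auto
  then have "real (2 * L + 1) ^ d * (2 * real (d * L + 1) * (1 + real (d * L) * \<Delta>)) + 2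
      \<le> (2 * \<kappa> * l) ^ d * (2 * (\<mu> * l) * (\<mu> * l * \<Delta>)) + 2 * (\<Delta> * l ^ (d + 2))"
  proof (rule add_mono[OF mult_mono[OF G]])
    have "1 * 1 \<le> \<Delta> * l ^ (d + 2)" using l Delta by (intro mult_mono one_le_power) auto
    then show "2 \<le> 2 * (\<Delta> * l ^ (d + 2))" by simp
  qed (use \<kappa> l Delta in simp_all)
  also have "\<dots> = ((2 * \<kappa>) ^ d * (2 * \<mu> * \<mu>) + 2) * \<Delta> * l ^ (d + 2)"
    by (simp add: power_mult_distrib power_add power2_eq_square algebra_simps)
  finally have "real (V * Suc (d * L)) * (real (2 * L + 1) ^ d * (2 * real (d * L + 1) * (1 + real (d * L) * \<Delta>)) + 2)
    \<le> (real V * (\<mu> * l)) * (((2 * \<kappa>) ^ d * (2 * \<mu> * \<mu>) + 2) * \<Delta> * l ^ (d + 2))"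
  proof (rule mult_mono[rotated])
    have "real V * real (d * L + 1) \<le> real V * (\<mu> * l)" using H by (rule mult_left_mono) simp
    then show "real (V * Suc (d * L)) \<le> real V * (\<mu> * l)" by (simp only: of_nat_mult Suc_eq_plus1)
  qed (use l \<mu> \<kappa> Delta in simp_all)
  also have "\<dots> = (real V * \<mu> * ((2 * \<kappa>) ^ d * (2 * \<mu> * \<mu>) + 2)) * \<Delta> * l ^ (d + 3)"
    by (simp add: numeral_eq_Suc mult_ac)
  finally show ?thesis .
qed

lemma powr_le_power_of_2:
  assumes "N \<le> 2 ^ q" "\<rho> \<le> real r"
  shows "real N powr \<rho> \<le> 2 ^ (q * r)"
proof (cases "N = 0")
  case False
  then have "real N powr \<rho> \<le> real N powr real r" using assms(2) by (intro powr_mono) auto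
  also have "\<dots> = real (N ^ r)" using False by (simp add: powr_realpow)
  also have "\<dots> \<le> real ((2 ^ q) ^ r)" using assms(1) by (intro of_nat_mono power_mono) auto
  finally show ?thesis by (simp add: power_mult)
qed simp

theorem theorem9:
  fixes Rs :: "'r set" and scheme :: "'r \<Rightarrow> 'a set"
  assumes "is_schema Rs scheme"
  shows "\<exists>(P :: 'a com) (k :: nat) (c :: nat) (C :: real).
    \<forall>(rel :: 'r \<Rightarrow> 'a tuple set) (\<Delta> :: real) (N :: nat).
      is_instance Rs scheme rel \<longrightarrow> N = input_size Rs rel \<longrightarrow> \<Delta> \<ge> 1 \<longrightarrow>
      (\<exists>Ms. range_join_structure (word_length k N) P Rs scheme rel
         (C * (1 + real N + real N powr rho_star Rs scheme / \<Delta>) * polylog c N)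
         (C * \<Delta> * polylog c N) Ms)"
proof -
  have fin: "finite Rs" "finite (attributes Rs scheme)"
    using assms by (auto simp: is_schema_def attributes_def)
  obtain rs where rs: "set rs = Rs" "distinct rs" using finite_distinct_list[OF fin(1)] by blast
  obtain as where as: "set as = attributes Rs scheme" "distinct as" using finite_distinct_list[OF fin(2)] by blast
  define d where "d = length as"
  define m where "m = length rs"
  define \<rho> where "\<rho> = rho_star Rs scheme"
  obtain W where W: "fractional_edge_covering (attributes Rs scheme) (scheme ` Rs) W" "(\<Sum>e\<in>scheme ` Rs. W e) = \<rho>"
    using fractional_edge_covering_number_attained[of "scheme ` Rs" "attributes Rs scheme"] fin
    by (auto simp: \<rho>_def rho_star_def attributes_def)
  define r where "r = nat \<lceil>\<rho>\<rceil>"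
  have r: "\<rho> \<le> real r" unfolding r_def by (rule real_nat_ceiling_ge)
  \<comment> \<open>It will hold that \<open>Suc L = q + d + 1\<close> with
    \<open>q \<le> 2 * l\<close> and \<open>1 \<le> l\<close>.\<close>
  define \<kappa> where "\<kappa> = real d + 3"
  define \<mu> where "\<mu> = (real d + 1) * \<kappa>"
  define CS where "CS = 3 + real m + 4 * real d * \<kappa> ^ d + 16 * 2 ^ d"
  define V where "V = visit_cost as (Suc m)"
  define CD where "CD = real V * \<mu> * ((2 * \<kappa>) ^ d * (2 * \<mu> * \<mu>) + 2)"
  have CS: "0 \<le> CS" by (simp add: CS_def \<kappa>_def)
  have CD: "0 \<le> CD" by (simp add: CD_def \<mu>_def \<kappa>_def)
  obtain a :: nat where a: "CS < 2 ^ a" using real_arch_pow[of 2 CS] by auto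
  \<comment> \<open>The word length is \<open>k * q\<close>. The first three summands cover the
    factors \<open>CS\<close>, \<open>1 + real N + X\<close> and \<open>l ^ d\<close> of the space;
    the others ensure \<open>d * L < w\<close>, so that leaf numbers of the search tree fit into a
    word.\<close>
  define k where "k = a + (r + 2) + d + (d * (d + 1) + 1) + (d + 3)"
  have main: "\<exists>Ms. range_join_structure (word_length k N) (query_com as (Suc m)) Rs scheme rel
         ((CS + CD) * (1 + real N + real N powr \<rho> / \<Delta>) * polylog (d + 3) N)
         ((CS + CD) * \<Delta> * polylog (d + 3) N) Ms"
    if inst: "is_instance Rs scheme rel" and N: "N = input_size Rs rel" and Delta: "1 \<le> \<Delta>" for rel \<Delta> N
  proof -
    define l where "l = log 2 (real N + 2)"
    define q where "q = nat \<lceil>l\<rceil>"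
    \<comment> \<open>At most \<open>N * d\<close> values occur, and
      \<open>d \<le> 2 ^ d\<close>.\<close>
    define L where "L = q + d"
    define w where "w = word_length k N"
    define X where "X = real N powr \<rho> / \<Delta>"
    have X: "0 \<le> X" using Delta by (simp add: X_def)
    have l: "1 \<le> l" by (simp add: l_def le_log_iff)
    have q: "1 \<le> q" "real q \<le> 2 * l" "l \<le> real q" using l by (auto simp: q_def; linarith)+
    have w: "w = k * q" by (simp add: w_def word_length_def q_def l_def)
    have "2 powr l = real N + 2" by (simp add: l_def)
    moreover have "2 powr l \<le> 2 powr real q" using q by (intro powr_mono) auto
    ultimately have N2: "real N + 2 \<le> 2 ^ q" by (simp add: powr_realpow)
    have "2 powr real q \<le> 2 powr (l + 1)" using l by (intro powr_mono) (auto simp: q_def; linarith)+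
    then have q2: "2 ^ q \<le> 2 * (real N + 2)" using \<open>2 powr l = _\<close> by (simp add: powr_realpow powr_add)
    have L1: "real (Suc L) \<le> \<kappa> * l"
    proof -
      have "real d * 1 \<le> real d * l" using l by (intro mult_left_mono) auto
      then show ?thesis using q l by (simp add: L_def \<kappa>_def distrib_right)
    qed
    have L2: "(2::real) ^ L \<le> 2 ^ d * (2 * (real N + 2))"
      using q2 by (simp add: L_def power_add mult.commute mult_left_mono)

    define vals where "vals = (\<Union>r\<in>Rs. \<Union>t\<in>rel r. ran t)"
    have rel: "finite (rel r)" "\<And>t. t \<in> rel r \<Longrightarrow> dom t = scheme r" "card (scheme r) \<le> d" "finite (scheme r)" if "r \<in> Rs" for r
    proof -
      show "finite (rel r)" "\<And>t. t \<in> rel r \<Longrightarrow> dom t = scheme r" "finite (scheme r)"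
        using inst assms that by (auto simp: is_instance_def is_schema_def)
      have "scheme r \<subseteq> set as" using that as by (auto simp: attributes_def)
      then show "card (scheme r) \<le> d" unfolding d_def using card_mono card_length le_trans by (metis List.finite_set)
    qed
    have ran: "finite (ran t)" "card (ran t) \<le> d" if "r \<in> Rs" "t \<in> rel r" for r t
    proof -
      have "ran t = (\<lambda>x. the (t x)) ` scheme r"
        using rel(2)[OF that] by (force simp: ran_def image_def dom_def)
      then show "finite (ran t)" "card (ran t) \<le> d"
        using rel(3,4)[OF that(1)] card_image_le[of "scheme r" "\<lambda>x. the (t x)"] by auto
    qed
    have "finite vals" using fin(1) rel(1) ran(1) by (auto simp: vals_def)
    have "card vals \<le> (\<Sum>r\<in>Rs. card (\<Union>t\<in>rel r. ran t))"
      unfolding vals_def by (rule card_UN_le[OF fin(1)])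
    also have "\<dots> \<le> (\<Sum>r\<in>Rs. card (rel r) * d)"
    proof (rule sum_mono)
      fix r assume r: "r \<in> Rs"
      have "card (\<Union>t\<in>rel r. ran t) \<le> (\<Sum>t\<in>rel r. card (ran t))" by (rule card_UN_le[OF rel(1)[OF r]])
      also have "\<dots> \<le> (\<Sum>t\<in>rel r. d)" using ran(2)[OF r] by (intro sum_mono)
      finally show "card (\<Union>t\<in>rel r. ran t) \<le> card (rel r) * d" by simp
    qed
    also have "\<dots> = N * d" by (simp add: N input_size_def sum_distrib_right)
    also have "\<dots> \<le> 2 ^ q * 2 ^ d"
    proof (rule mult_le_mono)
      have "real N \<le> 2 ^ q" using N2 by linarith
      then show "N \<le> 2 ^ q" by simp
      show "d \<le> 2 ^ d" by (rule less_imp_le[OF less_exp])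
    qed
    finally have "card vals \<le> 2 ^ L" by (simp add: L_def power_add)
    from rank_coding[OF \<open>finite vals\<close> this] obtain val code where vc: "mono (val :: nat \<Rightarrow> real)"
      "\<forall>x\<in>vals. 2 ^ L \<le> code x \<and> code x < 2 ^ Suc L \<and> val (code x) = x"
      by (elim exE conjE)
    interpret join_instance Rs scheme rel as L val code W \<Delta>
      by unfold_locales (use assms inst as vc W(1) Delta in \<open>auto simp: vals_def\<close>)
    have card: "real (card (states rs)) \<le> 2 * (1 + real N + X) * real (Suc L ^ d)"
      using card_states(2)[OF rs(2,1)] by (simp add: N X_def W(2) d_def)
    have space: "real (3 + m + 2 * d * card (states rs) + 4 * 2 ^ L) \<le> CS * (1 + real N + X) * l ^ d"
      unfolding CS_def by (rule space_bound[OF l _ X card L1 L2]) simp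
    have "CS * (1 + real N + X) * l ^ d < 2 ^ w"
    proof -
      have "l \<le> 2 ^ q" using q(3) less_exp[of q] by (meson less_imp_le of_nat_less_two_power order.trans)
      then have ld: "l ^ d \<le> 2 ^ (q * d)" using l power_mono[of l "2 ^ q" d] by (simp add: power_mult)
      have "X \<le> real N powr \<rho>" using Delta by (simp add: X_def divide_le_eq mult_le_cancel_left1)
      also have "\<dots> \<le> 2 ^ (q * r)"
      proof (rule powr_le_power_of_2[OF _ r])
        have "real N \<le> 2 ^ q" using N2 by linarith
        then show "N \<le> 2 ^ q" by simp
      qed
      finally have "1 + real N + X \<le> 2 ^ q + 2 ^ (q * r)" using N2 by linarith
      also have "\<dots> \<le> 2 ^ (q * (r + 1)) + 2 ^ (q * (r + 1))"
        by (intro add_mono power_increasing) auto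
      also have "\<dots> = 2 ^ Suc (q * (r + 1))" by simp
      also have "\<dots> \<le> 2 ^ (q * (r + 2))" using q(1) by (intro power_increasing) (auto simp: algebra_simps)
      finally have NX: "1 + real N + X \<le> 2 ^ (q * (r + 2))" .
      have "(2::real) ^ a \<le> 2 ^ (q * a)" using q(1) by (intro power_increasing) auto
      then have "CS < 2 ^ (q * a)" using a by linarith
      then have "CS * (1 + real N + X) < 2 ^ (q * a) * 2 ^ (q * (r + 2))"
        using NX X CS by (intro mult_less_le_imp_less) auto
      then have "CS * (1 + real N + X) * l ^ d < 2 ^ (q * a) * 2 ^ (q * (r + 2)) * 2 ^ (q * d)"
        by (rule mult_less_le_imp_less[OF _ ld]) (use l X CS in auto)
      also have "\<dots> = 2 ^ (q * a + q * (r + 2) + q * d)" by (simp only: power_add)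
      also have "\<dots> \<le> 2 ^ w" unfolding w k_def by (intro power_increasing) (auto simp: algebra_simps)
      finally show ?thesis .
    qed
    with space have "real (3 + m + 2 * d * card (states rs) + 4 * 2 ^ L) < real (2 ^ w)" by simp
    then have words: "3 + m + 2 * d * card (states rs) + 4 * 2 ^ L < 2 ^ w" by (simp only: of_nat_less_iff)
    have kq: "(d * (d + 1) + 1) * q + (d + 3) * q \<le> w" unfolding w k_def by (simp add: algebra_simps)
    have dq: "d * 1 \<le> d * q" "d * (d * 1) \<le> d * (d * q)" using q(1) by simp_all
    have "(d * (d + 1) + 1) * q + (d + 3) * q = d * (d * q) + 2 * (d * q) + 4 * q"
      by (simp add: algebra_simps)
    moreover have "d * L = d * q + d * (d * 1)" by (simp add: L_def distrib_left)
    ultimately have dL: "d * L < w" "d \<le> w" using kq dq q(1) by linarith+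
    from dL(2) have dw: "d < 2 ^ w" using less_exp[of w] by linarith
    have poly: "l ^ (d + 3) = polylog (d + 3) N" by (simp add: polylog_def l_def)
    have "CS * (1 + real N + X) * l ^ d \<le> (CS + CD) * (1 + real N + X) * l ^ (d + 3)"
      using CS CD X l by (intro mult_mono power_increasing) auto
    then have S: "real (3 + m + 2 * d * card (states rs) + 4 * 2 ^ L) \<le> (CS + CD) * (1 + real N + X) * polylog (d + 3) N"
      unfolding poly[symmetric] using space by (rule order.trans[rotated])
    have "CD * \<Delta> * l ^ (d + 3) \<le> (CS + CD) * \<Delta> * l ^ (d + 3)"
      using CS CD Delta l by (intro mult_right_mono) auto
    then have D: "real (V * Suc (d * L)) * (real (2 * L + 1) ^ d * (2 * real (d * L + 1) * (1 + real (d * L) * \<Delta>)) + 2)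
        \<le> (CS + CD) * \<Delta> * polylog (d + 3) N"
      unfolding poly[symmetric] CD_def \<mu>_def using delay_bound[OF l Delta L1, of V d] by (rule order.trans[rotated])
    show ?thesis
      using range_join_structure_query[OF rs(2,1), of w, folded m_def, folded d_def, folded V_def, OF _ _ dL(1) dw S D] words
      unfolding w_def X_def by simp
  qed
  show ?thesis
    using main unfolding \<rho>_def by blast
qed

end
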